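(* Let $\boldsymbol{a}=(a_0,a_1,\dots)$ be a sequence of integers with all $a_j>1$, and let $X=\Sigma_{\boldsymbol{a}}$ be the $\boldsymbol{a}$-adic solenoid. Let $\xi_1,\xi_2,\xi_3,\xi_4$ be independent random variables with values in $X$ with nonvanishing characteristic functions, and let $b_1,b_2,b_3,b_4$ be continuous endomorphisms of the group $X$. Let $L_2=b_1\xi_1+b_2\xi_2+b_3\xi_3+b_4\xi_4$. Assume that either (I) $L_1=\xi_1+\xi_2+\xi_3+\xi_4$ and ${\rm Ker}(b_i-b_j)=\{0\}$ for all $i\ne j$, $i,j\in\{1,2,3,4\}$, or (II) $L_1=\xi_1+\xi_2+\xi_3$ and ${\rm Ker}(b_i-b_j)=\{0\}$ for all $i\neq j$, $i,j\in\{1,2,3\}$, and ${\rm Ker}\,b_4=\{0\}$. Then the distribution of the random vector $(L_1,L_2)$ determines the distributions of the random variables $\xi_j$ up to convolution with a Gaussian distribution. That is: if $\eta_1,\eta_2,\eta_3,\eta_4$ are independent random variables with values in $X$ with nonvanishing characteristic functions, $M_2=b_1\eta_1+b_2\eta_2+b_3\eta_3+b_4\eta_4$, and $M_1=\eta_1+\eta_2+\eta_3+\eta_4$ in case (I), respectively $M_1=\eta_1+\eta_2+\eta_3$ in case (II), and if the random vectors $(L_1,L_2)$ and $(M_1,M_2)$ (with values in $X\times X$) are identically distributed, then for each $j=1,2,3,4$ there is a Gaussian distribution $\gamma_j$ on $X$ such that either $\nu_j=\mu_j*\gamma_j$ or $\mu_j=\nu_j*\gamma_j$, where $\mu_j$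 and $\nu_j$ are the distributions of $\xi_j$ and $\eta_j$ respectively.
   Context: Definition of the $\boldsymbol{a}$-adic solenoid: let $\boldsymbol{a}=(a_0,a_1,\dots)$ with all $a_j\in\mathbb{Z}$, $a_j>1$. Let $\Delta_{\boldsymbol{a}}$ be the compact group of $\boldsymbol{a}$-adic integers, i.e. sequences $(x_0,x_1,\dots)$ with $x_n\in\{0,1,\dots,a_n-1\}$, with the product topology and addition with carry (equivalently, the inverse limit of the groups $\mathbb{Z}/a_0a_1\cdots a_n\mathbb{Z}$). Let $\mathbf{u}=(1,0,\dots,0,\dots)\in\Delta_{\boldsymbol{a}}$ and $B=\{(n,n\mathbf{u})\}_{n=-\infty}^{\infty}\subset\mathbb{R}\times\Delta_{\boldsymbol{a}}$. Then $\Sigma_{\boldsymbol{a}}=(\mathbb{R}\times\Delta_{\boldsymbol{a}})/B$; it is a compact connected Abelian group of dimension 1, and its character group is topologically isomorphic to the discrete group $H_{\boldsymbol{a}}=\{m/(a_0a_1\cdots a_n): n=0,1,\dots;\ m\in\mathbb{Z}\}$. For a second countable locally compact Abelian group $X$ (written additively), $Y$ denotes its character group and $(x,y)$ the value of the character $y\in Y$ at $x\in X$. The characteristic function of a (Borel) probability distribution $\mu$ on $X$ is $\hat\mu(y)=\int_X (x,y)\,d\mu(x)$, $y\in Y$; the characteristic function of a random variable is that of its distribution, and it is nonvanishing if it has no zeros on $Y$. The symbol $*$ denotes convolution. Endomorphisms are group homomorphisms $X\to X$, with pointwise sums and differences. A probability distribution $\gamma$ on $X$ is called Gaussian if $\hat\gamma(y)=(x,y)\exp\{-\varphi(y)\}$,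 $y\in Y$, where $x\in X$ and $\varphi$ is a continuous nonnegative function on $Y$ satisfying $\varphi(u+v)+\varphi(u-v)=2[\varphi(u)+\varphi(v)]$ for all $u,v\in Y$. (Degenerate distributions are thus included. For $X=\Sigma_{\boldsymbol{a}}$, with $Y$ identified with $H_{\boldsymbol{a}}$, this means $\hat\gamma(y)=(x,y)\exp\{-\sigma y^2\}$, $y\in H_{\boldsymbol{a}}$, with $x\in\Sigma_{\boldsymbol{a}}$ and $\sigma\ge 0$.) *)

theory Defs
  imports "HOL-Probability.Probability" "HOL-Algebra.Coset"
begin

text \<open>All groups are \<^typ>\<open>'a monoid\<close> records (hence written multiplicatively) and
  carry a separate topology of type \<^typ>\<open>'a topology\<close> on the same carrier.\<close>

definition quotient_topology :: "'a topology \<Rightarrow> ('a \<Rightarrow> 'b) \<Rightarrow> 'b topology" where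
  "quotient_topology T p =
     topology (\<lambda>U. U \<subseteq> p ` topspace T \<and> openin T {x \<in> topspace T. p x \<in> U})"

lemma openin_quotient_topology:
  "openin (quotient_topology T p) U \<longleftrightarrow>
     U \<subseteq> p ` topspace T \<and> openin T {x \<in> topspace T. p x \<in> U}"
proof -
  have "istopology (\<lambda>U. U \<subseteq> p ` topspace T \<and> openin T {x \<in> topspace T. p x \<in> U})"
    unfolding istopology_def
  proof (intro conjI allI impI)
    fix S U
    assume "S \<subseteq> p ` topspace T \<and> openin T {x \<in> topspace T. p x \<in> S}"
      and "U \<subseteq> p ` topspace T \<and> openin T {x \<in> topspace T. p x \<in> U}"
    moreover have "{x \<in> topspace T. p x \<in> S \<inter> U} =
        {x \<in> topspace T. p x \<in> S} \<inter> {x \<in> topspace T. p x \<in> U}" by blast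
    ultimately show "S \<inter> U \<subseteq> p ` topspace T"
      and "openin T {x \<in> topspace T. p x \<in> S \<inter> U}" by auto
  next
    fix \<K>
    assume *: "\<forall>K\<in>\<K>. K \<subseteq> p ` topspace T \<and> openin T {x \<in> topspace T. p x \<in> K}"
    then show "\<Union>\<K> \<subseteq> p ` topspace T" by blast
    have "{x \<in> topspace T. p x \<in> \<Union>\<K>} = (\<Union>K\<in>\<K>. {x \<in> topspace T. p x \<in> K})" by blast
    with * show "openin T {x \<in> topspace T. p x \<in> \<Union>\<K>}" by auto
  qed
  then show ?thesis
    by (simp add: quotient_topology_def topology_inverse')
qed

lemma topspace_quotient_topology [simp]: "topspace (quotient_topology T p) = p ` topspace T"
proof -
  have "openin (quotient_topology T p) (p ` topspace T)"
  proof -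
    have "{x \<in> topspace T. p x \<in> p ` topspace T} = topspace T" by blast
    then show ?thesis by (simp add: openin_quotient_topology)
  qed
  moreover have "topspace (quotient_topology T p) \<subseteq> p ` topspace T"
    using openin_topspace[of "quotient_topology T p"] unfolding openin_quotient_topology by (rule conjunct1)
  ultimately show ?thesis
    by (intro subset_antisym openin_subset)
qed

lemma quotient_map_quotient_topology: "quotient_map T (quotient_topology T p) p"
  by (simp add: quotient_map_def openin_quotient_topology)

definition borel_of :: "'a topology \<Rightarrow> 'a measure" where
  "borel_of T = sigma (topspace T) {U. openin T U}"

lemma space_borel_of [simp]: "space (borel_of T) = topspace T"
  by (simp add: borel_of_def space_measure_of_conv)

text \<open>Elements of \<open>\<Delta>\<^sub>a\<close> are digit sequences \<open>x\<close> with \<open>0 \<le> x n < a n\<close>;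
  \<open>adic_carry a x y n\<close> is the carry into position \<open>n\<close>.\<close>

fun adic_carry :: "(nat \<Rightarrow> int) \<Rightarrow> (nat \<Rightarrow> int) \<Rightarrow> (nat \<Rightarrow> int) \<Rightarrow> nat \<Rightarrow> int" where
  "adic_carry a x y 0 = 0"
| "adic_carry a x y (Suc n) = (x n + y n + adic_carry a x y n) div a n"

definition adic_add :: "(nat \<Rightarrow> int) \<Rightarrow> (nat \<Rightarrow> int) \<Rightarrow> (nat \<Rightarrow> int) \<Rightarrow> nat \<Rightarrow> int" where
  "adic_add a x y n = (x n + y n + adic_carry a x y n) mod a n"

lemma adic_add_partial_sums:
  "(\<Sum>k<n. adic_add a x y k * (\<Prod>i<k. a i)) + adic_carry a x y n * (\<Prod>i<n. a i) =
     (\<Sum>k<n. x k * (\<Prod>i<k. a i)) + (\<Sum>k<n. y k * (\<Prod>i<k. a i))"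
proof (induction n)
  case (Suc n)
  let ?s = "x n + y n + adic_carry a x y n" and ?P = "\<Prod>i<n. a i"
  have "r * p + q * (p * m) = (q * m + r) * p" for q r p m :: int
    by (simp add: algebra_simps)
  then have "?s mod a n * ?P + ?s div a n * (?P * a n) = ?s * ?P"
    by (simp only: div_mult_mod_eq)
  moreover have "?s * ?P = x n * ?P + y n * ?P + adic_carry a x y n * ?P"
    by (simp only: distrib_right)
  moreover have "(\<Sum>k<Suc n. adic_add a x y k * (\<Prod>i<k. a i)) =
      (\<Sum>k<n. adic_add a x y k * (\<Prod>i<k. a i)) + ?s mod a n * ?P"
    by (simp add: adic_add_def)
  moreover have "adic_carry a x y (Suc n) * (\<Prod>i<Suc n. a i) = ?s div a n * (?P * a n)"
    by simp
  moreover have "(\<Sum>k<Suc n. x k * (\<Prod>i<k. a i)) = (\<Sum>k<n. x k * (\<Prod>i<k. a i)) + x n * ?P"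
    "(\<Sum>k<Suc n. y k * (\<Prod>i<k. a i)) = (\<Sum>k<n. y k * (\<Prod>i<k. a i)) + y n * ?P"
    by simp_all
  ultimately show ?case
    using Suc.IH by linarith
qed simp

definition adic_integers :: "(nat \<Rightarrow> int) \<Rightarrow> (nat \<Rightarrow> int) monoid" where
  "adic_integers a =
     \<lparr>carrier = {x. \<forall>n. x n \<in> {0..<a n}}, mult = adic_add a, one = (\<lambda>_. 0)\<rparr>"

definition adic_topology :: "(nat \<Rightarrow> int) \<Rightarrow> (nat \<Rightarrow> int) topology" where
  "adic_topology a = product_topology (\<lambda>n. discrete_topology {0..<a n}) UNIV"

lemma topspace_adic_topology: "topspace (adic_topology a) = carrier (adic_integers a)"
  by (auto simp: adic_topology_def adic_integers_def PiE_UNIV_domain)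

definition adic_unit :: "nat \<Rightarrow> int" where
  "adic_unit n = (if n = 0 then 1 else 0)"

definition real_group :: "real monoid" where
  "real_group = \<lparr>carrier = UNIV, mult = (+), one = 0\<rparr>"

definition solenoid_subgroup :: "(nat \<Rightarrow> int) \<Rightarrow> (real \<times> (nat \<Rightarrow> int)) set" where
  "solenoid_subgroup a =
     range (\<lambda>n::int. (real_of_int n, adic_unit [^]\<^bsub>adic_integers a\<^esub> n))"

definition solenoid :: "(nat \<Rightarrow> int) \<Rightarrow> (real \<times> (nat \<Rightarrow> int)) set monoid" where
  "solenoid a = (real_group \<times>\<times> adic_integers a) Mod solenoid_subgroup a"

definition solenoid_topology :: "(nat \<Rightarrow> int) \<Rightarrow> (real \<times> (nat \<Rightarrow> int)) set topology" where
  "solenoid_topology a =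
     quotient_topology (prod_topology euclideanreal (adic_topology a))
       (\<lambda>x. solenoid_subgroup a #>\<^bsub>real_group \<times>\<times> adic_integers a\<^esub> x)"

lemma topspace_solenoid_topology: "topspace (solenoid_topology a) = carrier (solenoid a)"
  by (auto simp: solenoid_topology_def solenoid_def FactGroup_def RCOSETS_def
      topspace_adic_topology real_group_def DirProd_def)

definition circle_group :: "complex monoid" where
  "circle_group = \<lparr>carrier = {z. cmod z = 1}, mult = (*), one = 1\<rparr>"

text \<open>Characters are taken to be extensional, so that each character is represented by exactly
  one HOL function.\<close>

definition dual_group :: "('a, 'm) monoid_scheme \<Rightarrow> 'a topology \<Rightarrow> ('a \<Rightarrow> complex) monoid" where
  "dual_group G T =
     \<lparr>carrier = {y \<in> extensional (carrier G). y \<in> hom G circle_group \<and> continuous_map T euclidean y},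
      mult = (\<lambda>y z. \<lambda>x\<in>carrier G. y x * z x),
      one = (\<lambda>x\<in>carrier G. 1)\<rparr>"

text \<open>The topology of uniform convergence on compact sets.\<close>

definition dual_topology :: "('a, 'm) monoid_scheme \<Rightarrow> 'a topology \<Rightarrow> ('a \<Rightarrow> complex) topology" where
  "dual_topology G T = topology_generated_by
     {{y \<in> carrier (dual_group G T). \<forall>x\<in>K. cmod (y x - y\<^sub>0 x) < \<epsilon>} | K y\<^sub>0 \<epsilon>.
        compactin T K \<and> y\<^sub>0 \<in> carrier (dual_group G T) \<and> 0 < \<epsilon>}"

lemma topspace_dual_topology: "topspace (dual_topology G T) = carrier (dual_group G T)"
proof -
  let ?B = "{{y \<in> carrier (dual_group G T). \<forall>x\<in>K. cmod (y x - y\<^sub>0 x) < \<epsilon>} | K y\<^sub>0 \<epsilon>.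
      compactin T K \<and> y\<^sub>0 \<in> carrier (dual_group G T) \<and> 0 < \<epsilon>}"
  have "y \<in> \<Union>?B" if y: "y \<in> carrier (dual_group G T)" for y
  proof (rule UnionI)
    show "carrier (dual_group G T) \<in> ?B"
      using y by (intro CollectI exI[of _ "{}"] exI[of _ y] exI[of _ "1::real"]) simp
  qed (rule y)
  moreover have "\<Union>?B \<subseteq> carrier (dual_group G T)"
    by (rule Union_least) blast
  ultimately show ?thesis
    unfolding dual_topology_def topology_generated_by_topspace by blast
qed

definition charfun :: "'a measure \<Rightarrow> ('a \<Rightarrow> complex) \<Rightarrow> complex" where
  "charfun \<mu> y = (\<integral>x. y x \<partial>\<mu>)"

definition nonvanishing_charfun ::
    "('a, 'm) monoid_scheme \<Rightarrow> 'a topology \<Rightarrow> 'a measure \<Rightarrow> bool" where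
  "nonvanishing_charfun G T \<mu> \<longleftrightarrow> (\<forall>y\<in>carrier (dual_group G T). charfun \<mu> y \<noteq> 0)"

definition group_convolution ::
    "('a, 'm) monoid_scheme \<Rightarrow> 'a topology \<Rightarrow> 'a measure \<Rightarrow> 'a measure \<Rightarrow> 'a measure" where
  "group_convolution G T \<mu> \<nu> = distr (\<mu> \<Otimes>\<^sub>M \<nu>) (borel_of T) (\<lambda>(x, y). x \<otimes>\<^bsub>G\<^esub> y)"

definition gaussian_distribution ::
    "('a, 'm) monoid_scheme \<Rightarrow> 'a topology \<Rightarrow> 'a measure \<Rightarrow> bool" where
  "gaussian_distribution G T \<gamma> \<longleftrightarrow>
     prob_space \<gamma> \<and> sets \<gamma> = sets (borel_of T) \<and>
     (\<exists>x\<in>carrier G. \<exists>\<phi>.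
        continuous_map (dual_topology G T) euclideanreal \<phi> \<and>
        (\<forall>u\<in>carrier (dual_group G T). 0 \<le> \<phi> u) \<and>
        (\<forall>u\<in>carrier (dual_group G T). \<forall>v\<in>carrier (dual_group G T).
           \<phi> (u \<otimes>\<^bsub>dual_group G T\<^esub> v) + \<phi> (u \<otimes>\<^bsub>dual_group G T\<^esub> inv\<^bsub>dual_group G T\<^esub> v) =
             2 * (\<phi> u + \<phi> v)) \<and>
        (\<forall>u\<in>carrier (dual_group G T). charfun \<gamma> u = u x * complex_of_real (exp (- \<phi> u))))"

definition continuous_endomorphism ::
    "('a, 'm) monoid_scheme \<Rightarrow> 'a topology \<Rightarrow> ('a \<Rightarrow> 'a) \<Rightarrow> bool" where
  "continuous_endomorphism G T f \<longleftrightarrow> f \<in> hom G G \<and> continuous_map T T f"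

definition hom_diff :: "('a, 'm) monoid_scheme \<Rightarrow> ('a \<Rightarrow> 'a) \<Rightarrow> ('a \<Rightarrow> 'a) \<Rightarrow> 'a \<Rightarrow> 'a" where
  "hom_diff G f g = (\<lambda>x. f x \<otimes>\<^bsub>G\<^esub> inv\<^bsub>G\<^esub> g x)"

end

theory Submission
  imports Defs
begin

text \<open>The characters of the solenoid are \<open>chr s\<close> for \<open>s\<close> in a subgroup \<open>freq\<close> of the rationals; a
  continuous endomorphism \<open>b\<^sub>j\<close> acts on them as multiplication by a number \<open>\<beta>\<^sub>j\<close>, and injectivity of
  \<open>b\<^sub>i - b\<^sub>j\<close> makes \<open>\<beta>\<^sub>i - \<beta>\<^sub>j\<close> act surjectively on \<open>freq\<close>. The quotients \<open>h\<^sub>j\<close> of the characteristic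
  functions of \<open>\<xi>\<^sub>j\<close> and \<open>\<eta>\<^sub>j\<close> satisfy \<open>\<Prod>\<^sub>j h\<^sub>j (\<alpha>\<^sub>j u + \<beta>\<^sub>j v) = 1\<close> with \<open>\<alpha>\<^sub>j \<in> {0, 1}\<close>. Three
  multiplicative differences, each along the kernel of one of the forms, eliminate all factors but
  one, so every third multiplicative difference of \<open>h\<^sub>j\<close> is trivial. Together with
  \<open>h\<^sub>j (- s) = cnj (h\<^sub>j s)\<close> and the local cyclicity of \<open>freq\<close> this forces \<open>h\<^sub>j\<close> to be a character of
  \<open>freq\<close>, that is a point of the solenoid, times \<open>exp (\<kappa> s\<^sup>2)\<close> with \<open>\<kappa>\<close> real; the sign of \<open>\<kappa>\<close> decides
  which of the two distributions carries the Gaussian factor.\<close>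

section \<open>The adic integers and the solenoid\<close>

text \<open>Injectivity of b_i - b_j, rather than b_i \<noteq> b_j, matters because
  \<open>freq\<close> need not be divisible: the increments available for the differences are the
  values of one form on the kernel of another, and surjectivity of \<beta>_i - \<beta>_j makes them
  fill \<open>freq\<close>. Trivial third differences alone would still admit a unimodular quadratic
  factor such as exp(i c s^2); Hermitian symmetry, inherited from the characteristic functions,
  excludes it. Since \<open>freq\<close> is an increasing union of cyclic groups, arithmetic on one
  generator at a time does the work that continuity would do on the real line.

  Duality is made concrete by the countably many characters of frequency 1 /
  \<open>radix_prod n\<close>. Each is a power of the next and together they separate points, so
  compactness reduces a question about the solenoid to one about the circle at some level
  \<open>n\<close>. This yields in turn the list of all characters, the points with prescribed
  character values, generators of the Borel sets, and uniqueness of a measure with a given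
  characteristic function.\<close>

locale adic_base =
  fixes a :: "nat \<Rightarrow> int"
  assumes base_gt_1: "\<And>j. a j > 1"
begin

section \<open>Digit sequences as compatible residues\<close>

definition radix_prod :: "nat \<Rightarrow> int" where
  "radix_prod n = (\<Prod>i<n. a i)"

text \<open>For \<open>x\<close> in \<Delta> this integer represents the image of \<open>x\<close>
  in Z / \<open>radix_prod n\<close>; the sequence of these residues is \<open>x\<close> seen as a
  point of the inverse limit.\<close>

definition partial_value :: "nat \<Rightarrow> (nat \<Rightarrow> int) \<Rightarrow> int" where
  "partial_value n x = (\<Sum>k<n. x k * radix_prod k)"

abbreviation "\<Delta> \<equiv> adic_integers a"

lemma radix_prod_0 [simp]: "radix_prod 0 = 1"
  by (simp add: radix_prod_def)

lemma radix_prod_Suc: "radix_prod (Suc n) = radix_prod n * a n"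
  by (simp add: radix_prod_def)

lemma radix_prod_pos [simp]: "radix_prod n > 0"
  unfolding radix_prod_def by (rule prod_pos) (use base_gt_1 in \<open>auto intro: less_trans[of 0 1]\<close>)

lemma radix_prod_nonzero [simp]: "radix_prod n \<noteq> 0"
  using radix_prod_pos[of n] by linarith

lemma radix_prod_dvd: "n \<le> m \<Longrightarrow> radix_prod n dvd radix_prod m"
  unfolding radix_prod_def by (intro prod_dvd_prod_subset) auto

lemma partial_value_0 [simp]: "partial_value 0 x = 0"
  by (simp add: partial_value_def)

lemma partial_value_Suc: "partial_value (Suc n) x = partial_value n x + x n * radix_prod n"
  by (simp add: partial_value_def)

lemma mem_adic_integers: "x \<in> carrier \<Delta> \<longleftrightarrow> (\<forall>n. 0 \<le> x n \<and> x n < a n)"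
  by (simp add: adic_integers_def)

lemma partial_value_bounds:
  assumes "x \<in> carrier \<Delta>"
  shows "0 \<le> partial_value n x \<and> partial_value n x < radix_prod n"
proof (induction n)
  case (Suc n)
  have "0 \<le> x n \<and> x n < a n" using assms by (simp add: mem_adic_integers)
  then have x: "0 \<le> x n" "x n + 1 \<le> a n" by auto
  have "(x n + 1) * radix_prod n \<le> a n * radix_prod n"
    by (rule mult_right_mono) (use x radix_prod_pos[of n] in linarith)+
  moreover have "0 \<le> x n * radix_prod n"
    using x radix_prod_pos[of n] by (intro mult_nonneg_nonneg) linarith+
  ultimately show ?case
    using Suc by (simp add: partial_value_Suc radix_prod_Suc algebra_simps)
qed simp

lemma partial_value_mod:
  "n \<le> m \<Longrightarrow> partial_value m x mod radix_prod n = partial_value n x mod radix_prod n"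
proof (induction m rule: dec_induct)
  case (step m)
  have "radix_prod n dvd x m * radix_prod m"
    using radix_prod_dvd[OF step(1)] by simp
  then have "(partial_value m x + x m * radix_prod m) mod radix_prod n = partial_value m x mod radix_prod n"
    by (metis add.right_neutral mod_0_imp_dvd dvd_imp_mod_0 mod_add_right_eq)
  then show ?case using step by (simp add: partial_value_Suc)
qed simp

text \<open>The partial values lie in the range from 0 to \<open>radix_prod n - 1\<close>, so a
  residue determines the value, and two consecutive values determine the digit between them.\<close>

lemma adic_integers_eqI:
  assumes "x \<in> carrier \<Delta>" "y \<in> carrier \<Delta>"
    and "\<And>n. partial_value n x mod radix_prod n = partial_value n y mod radix_prod n"
  shows "x = y"
proof
  fix n
  have eq: "partial_value m x = partial_value m y" for m
    using assms(3)[of m] partial_value_bounds[OF assms(1), of m] partial_value_bounds[OF assms(2), of m]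
    by (simp add: mod_pos_pos_trivial)
  have "x n * radix_prod n = y n * radix_prod n"
    using eq[of n] eq[of "Suc n"] by (simp add: partial_value_Suc)
  then show "x n = y n" by simp
qed

text \<open>Digit \<open>n\<close> is the quotient of the residue at level \<open>n + 1\<close> by
  \<open>radix_prod n\<close>; compatibility makes the remainder equal to the residue at level
  \<open>n\<close>. This surjectivity onto the inverse limit supplies negatives in \<Delta> without
  a digit formula.\<close>

lemma adic_integers_realize:
  assumes r: "\<And>n. r (Suc n) mod radix_prod n = r n mod radix_prod n"
  obtains x where "x \<in> carrier \<Delta>" "\<And>n. partial_value n x = r n mod radix_prod n"
proof -
  define x where "x n = (r (Suc n) mod radix_prod (Suc n)) div radix_prod n" for n
  have pos: "0 < radix_prod n" for n by simp
  have "0 \<le> x n \<and> x n < a n" for n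
  proof -
    have "0 \<le> r (Suc n) mod radix_prod (Suc n)" "r (Suc n) mod radix_prod (Suc n) < radix_prod n * a n"
      using pos[of "Suc n"] by (simp_all add: radix_prod_Suc)
    then show ?thesis
      unfolding x_def using pos[of n] div_le_mono
      by (smt (verit) div_mult_mod_eq mult.commute mult_less_cancel_right pos_imp_zdiv_nonneg_iff pos_mod_sign)
  qed
  moreover have "partial_value n x = r n mod radix_prod n" for n
  proof (induction n)
    case (Suc n)
    let ?q = "r (Suc n) mod radix_prod (Suc n)"
    have "?q mod radix_prod n = r n mod radix_prod n"
      using r[of n] by (simp add: mod_mod_cancel radix_prod_Suc)
    then show ?case
      using Suc by (simp add: partial_value_Suc x_def) (metis mod_div_mult_eq)
  qed simp
  ultimately show ?thesis by (intro that[of x]) (auto simp: mem_adic_integers)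
qed

lemma adic_add_closed: "adic_add a x y \<in> carrier \<Delta>"
  using base_gt_1 by (auto simp: mem_adic_integers adic_add_def intro!: pos_mod_sign pos_mod_bound less_trans[OF zero_less_one])

lemma partial_value_add:
  "partial_value n (adic_add a x y) mod radix_prod n = (partial_value n x + partial_value n y) mod radix_prod n"
proof -
  have "partial_value n x + partial_value n y
      = partial_value n (adic_add a x y) + adic_carry a x y n * radix_prod n"
    using adic_add_partial_sums[of a x y n] by (simp add: partial_value_def radix_prod_def)
  then show ?thesis by simp
qed

lemma adic_mult [simp]: "x \<otimes>\<^bsub>\<Delta>\<^esub> y = adic_add a x y"
  by (simp add: adic_integers_def)

lemma adic_one [simp]: "\<one>\<^bsub>\<Delta>\<^esub> = (\<lambda>_. 0)"
  by (simp add: adic_integers_def)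

lemma partial_value_zero [simp]: "partial_value n (\<lambda>_. 0) = 0"
  by (simp add: partial_value_def)

text \<open>The group identities are compared modulo every \<open>radix_prod n\<close>, where
  \<open>adic_add\<close> is ordinary addition and the carries have disappeared.\<close>

lemma comm_group_adic_integers: "comm_group \<Delta>"
proof (rule comm_groupI; (unfold adic_mult adic_one)?)
  have zero: "(\<lambda>_. 0) \<in> carrier \<Delta>"
    using base_gt_1 by (auto simp: mem_adic_integers intro: less_trans[OF zero_less_one])
  show "(\<lambda>_. 0) \<in> carrier \<Delta>" by fact
  show "adic_add a x y \<in> carrier \<Delta>" for x y by (rule adic_add_closed)
  show "adic_add a (adic_add a x y) z = adic_add a x (adic_add a y z)" for x y z
  proof (rule adic_integers_eqI[OF adic_add_closed adic_add_closed])
    fix n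
    show "partial_value n (adic_add a (adic_add a x y) z) mod radix_prod n =
        partial_value n (adic_add a x (adic_add a y z)) mod radix_prod n"
      unfolding partial_value_add
      by (metis (no_types, lifting) partial_value_add add.assoc mod_add_left_eq mod_add_right_eq)
  qed
  show "adic_add a x y = adic_add a y x" for x y
    by (rule adic_integers_eqI[OF adic_add_closed adic_add_closed]) (simp add: partial_value_add add.commute)
  show "adic_add a (\<lambda>_. 0) x = x" if "x \<in> carrier \<Delta>" for x
    by (rule adic_integers_eqI[OF adic_add_closed that]) (simp add: partial_value_add)
  show "\<exists>y\<in>carrier \<Delta>. adic_add a y x = (\<lambda>_. 0)" if "x \<in> carrier \<Delta>" for x
  proof -
    have "(- partial_value (Suc n) x) mod radix_prod n = (- partial_value n x) mod radix_prod n" for n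
      using partial_value_mod[of n "Suc n" x] by (metis le_add2 mod_minus_eq plus_1_eq_Suc)
    then obtain y where y: "y \<in> carrier \<Delta>" "\<And>n. partial_value n y = (- partial_value n x) mod radix_prod n"
      using adic_integers_realize[of "\<lambda>n. - partial_value n x"] by blast
    have "adic_add a y x = (\<lambda>_. 0)"
    proof (rule adic_integers_eqI[OF adic_add_closed zero])
      fix n
      show "partial_value n (adic_add a y x) mod radix_prod n = partial_value n (\<lambda>_. 0) mod radix_prod n"
        by (simp add: partial_value_add y(2) mod_add_left_eq)
    qed
    with y show ?thesis by blast
  qed
qed

lemma adic_unit_in: "adic_unit \<in> carrier \<Delta>"
  using base_gt_1 by (auto simp: mem_adic_integers adic_unit_def intro: less_trans[OF zero_less_one])

lemma partial_value_unit: "partial_value n adic_unit mod radix_prod n = 1 mod radix_prod n"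
\<comment> \<open>At level 0 the partial value is the empty sum 0, not 1; the congruence holds there
  because the modulus is 1.\<close>
proof (cases n)
  case (Suc m)
  have "partial_value n adic_unit = 1"
    unfolding Suc partial_value_def by (subst sum.remove[of _ 0]) (auto simp: adic_unit_def)
  then show ?thesis by simp
qed simp

lemma partial_value_unit_pow:
  "partial_value n (adic_unit [^]\<^bsub>\<Delta>\<^esub> (k::int)) mod radix_prod n = k mod radix_prod n"
proof -
  interpret D: comm_group \<Delta> by (rule comm_group_adic_integers)
  have nat: "partial_value n (adic_unit [^]\<^bsub>\<Delta>\<^esub> (m::nat)) mod radix_prod n = int m mod radix_prod n" for m
  proof (induction m)
    case (Suc m)
    have "partial_value n (adic_unit [^]\<^bsub>\<Delta>\<^esub> Suc m) mod radix_prod n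
       = (partial_value n (adic_unit [^]\<^bsub>\<Delta>\<^esub> m) mod radix_prod n + partial_value n adic_unit mod radix_prod n) mod radix_prod n"
      by (simp add: partial_value_add mod_add_eq)
    then show ?case unfolding Suc partial_value_unit by (simp add: mod_simps add.commute)
  qed simp
  show ?thesis
  proof (cases "k \<ge> 0")
    case True
    then show ?thesis using nat[of "nat k"] by (simp add: pow_nat)
  next
    case False
    define u where "u = adic_unit [^]\<^bsub>\<Delta>\<^esub> k"
    define v where "v = adic_unit [^]\<^bsub>\<Delta>\<^esub> (-k)"
    have v: "partial_value n v mod radix_prod n = (-k) mod radix_prod n"
      using nat[of "nat (-k)"] False by (simp add: v_def pow_nat)
    have "u \<otimes>\<^bsub>\<Delta>\<^esub> v = \<one>\<^bsub>\<Delta>\<^esub>"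
      unfolding u_def v_def D.int_pow_mult[OF adic_unit_in, symmetric] by simp
    then have "partial_value n (adic_add a u v) = 0" by simp
    then have "(partial_value n u + partial_value n v) mod radix_prod n = 0"
      by (metis partial_value_add mod_0)
    then have "(partial_value n u + (-k)) mod radix_prod n = 0"
      using v by (metis mod_add_right_eq)
    then show ?thesis
      by (simp add: u_def mod_eq_dvd_iff dvd_eq_mod_eq_0)
  qed
qed

section \<open>The quotient by the subgroup B and its compactness\<close>

abbreviation "\<Gamma> \<equiv> real_group \<times>\<times> \<Delta>"
abbreviation "\<Sigma> \<equiv> solenoid a"
abbreviation "\<T> \<equiv> solenoid_topology a"

definition proj :: "real \<times> (nat \<Rightarrow> int) \<Rightarrow> (real \<times> (nat \<Rightarrow> int)) set" where
  "proj p = solenoid_subgroup a #>\<^bsub>\<Gamma>\<^esub> p"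

lemma comm_group_real: "comm_group real_group"
proof (rule comm_groupI)
  show "\<exists>y\<in>carrier real_group. y \<otimes>\<^bsub>real_group\<^esub> x = \<one>\<^bsub>real_group\<^esub>" for x
    by (rule bexI[of _ "- x"]) (simp_all add: real_group_def)
qed (simp_all add: real_group_def)

lemma comm_group_product: "comm_group \<Gamma>"
proof -
  interpret R: comm_group real_group by (rule comm_group_real)
  interpret D: comm_group \<Delta> by (rule comm_group_adic_integers)
  show ?thesis
    by (rule group.group_comm_groupI[OF DirProd_group[OF R.group_axioms D.group_axioms]])
      (auto simp: DirProd_def R.m_comm D.m_comm simp del: adic_mult)
qed

lemma subgroup_solenoid_subgroup: "subgroup (solenoid_subgroup a) \<Gamma>"
proof -
  interpret D: comm_group \<Delta> by (rule comm_group_adic_integers)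
  interpret R: comm_group real_group by (rule comm_group_real)
  interpret G: comm_group \<Gamma> by (rule comm_group_product)
  have inv: "inv\<^bsub>real_group\<^esub> x = -x" for x
    by (rule R.inv_equality) (auto simp: real_group_def)
  show ?thesis
  proof (rule G.subgroupI)
    show "solenoid_subgroup a \<subseteq> carrier \<Gamma>"
      using adic_unit_in by (auto simp: solenoid_subgroup_def real_group_def)
    show "solenoid_subgroup a \<noteq> {}" by (auto simp: solenoid_subgroup_def)
  next
    fix p assume "p \<in> solenoid_subgroup a"
    then obtain k :: int where k: "p = (of_int k, adic_unit [^]\<^bsub>\<Delta>\<^esub> k)" by (auto simp: solenoid_subgroup_def)
    have "inv\<^bsub>\<Gamma>\<^esub> p = (of_int (-k), adic_unit [^]\<^bsub>\<Delta>\<^esub> (-k))"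
      unfolding k using adic_unit_in R.group_axioms D.group_axioms
      by (subst inv_DirProd) (auto simp: inv D.int_pow_neg, simp add: real_group_def)
    then show "inv\<^bsub>\<Gamma>\<^esub> p \<in> solenoid_subgroup a" unfolding solenoid_subgroup_def by blast
  next
    fix p q assume "p \<in> solenoid_subgroup a" "q \<in> solenoid_subgroup a"
    then obtain k l :: int where k: "p = (of_int k, adic_unit [^]\<^bsub>\<Delta>\<^esub> k)" "q = (of_int l, adic_unit [^]\<^bsub>\<Delta>\<^esub> l)"
      by (auto simp: solenoid_subgroup_def)
    have "p \<otimes>\<^bsub>\<Gamma>\<^esub> q = (of_int (k+l), adic_unit [^]\<^bsub>\<Delta>\<^esub> (k+l))"
      unfolding k using adic_unit_in by (simp add: D.int_pow_mult real_group_def)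
    then show "p \<otimes>\<^bsub>\<Gamma>\<^esub> q \<in> solenoid_subgroup a" unfolding solenoid_subgroup_def by blast
  qed
qed

lemma comm_group_solenoid: "comm_group \<Sigma>"
  unfolding solenoid_def
  by (rule comm_group.abelian_FactGroup[OF comm_group_product subgroup_solenoid_subgroup])

lemma carrier_product: "carrier \<Gamma> = UNIV \<times> carrier \<Delta>"
  by (simp add: real_group_def)

lemma carrier_solenoid: "carrier \<Sigma> = proj ` (UNIV \<times> carrier \<Delta>)"
  unfolding solenoid_def carrier_FactGroup proj_def[abs_def] carrier_product ..

lemma proj_in: "x \<in> carrier \<Delta> \<Longrightarrow> proj (t, x) \<in> carrier \<Sigma>"
  by (auto simp: carrier_solenoid)

lemma proj_mult:
  assumes "x \<in> carrier \<Delta>" "y \<in> carrier \<Delta>"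
  shows "proj (t, x) \<otimes>\<^bsub>\<Sigma>\<^esub> proj (s, y) = proj (t + s, adic_add a x y)"
proof -
  interpret G: comm_group \<Gamma> by (rule comm_group_product)
  have N: "solenoid_subgroup a \<lhd> \<Gamma>"
    using subgroup_solenoid_subgroup by (simp add: G.normal_iff_subgroup)
  show ?thesis
    using normal.r_coset_hom_Mod[OF N] assms
    by (auto simp: hom_def proj_def solenoid_def real_group_def DirProd_def)
qed

lemma proj_zero: "proj (0, \<lambda>_. 0) = \<one>\<^bsub>\<Sigma>\<^esub>"
proof -
  interpret G: comm_group \<Gamma> by (rule comm_group_product)
  have "(0, \<lambda>_. 0) = \<one>\<^bsub>\<Gamma>\<^esub>" by (simp add: real_group_def)
  then show ?thesis
    unfolding proj_def solenoid_def
    by (metis G.coset_mult_one one_FactGroup subgroup.subset subgroup_solenoid_subgroup)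
qed

lemma proj_eqI:
  assumes "x \<in> carrier \<Delta>" "y \<in> carrier \<Delta>" "s = t + of_int k"
    and "y = adic_add a (adic_unit [^]\<^bsub>\<Delta>\<^esub> (k::int)) x"
  shows "proj (s, y) = proj (t, x)"
proof -
  interpret G: comm_group \<Gamma> by (rule comm_group_product)
  have "(s, y) = (of_int k, adic_unit [^]\<^bsub>\<Delta>\<^esub> k) \<otimes>\<^bsub>\<Gamma>\<^esub> (t, x)"
    using assms by (simp add: real_group_def)
  then have "(s, y) \<in> proj (t, x)"
    unfolding proj_def r_coset_def solenoid_subgroup_def by blast
  moreover have "(t, x) \<in> carrier \<Gamma>" using assms by (simp add: real_group_def)
  ultimately show ?thesis
    unfolding proj_def using G.repr_independence subgroup_solenoid_subgroup by metis
qed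

lemma mem_proj:
  assumes "p \<in> proj (t, x)"
  obtains k :: int where "p = (t + of_int k, adic_add a (adic_unit [^]\<^bsub>\<Delta>\<^esub> k) x)"
proof -
  from assms obtain k :: int where "p = (of_int k, adic_unit [^]\<^bsub>\<Delta>\<^esub> k) \<otimes>\<^bsub>\<Gamma>\<^esub> (t, x)"
    unfolding proj_def r_coset_def solenoid_subgroup_def by blast
  then show ?thesis by (intro that[of k]) (simp add: real_group_def)
qed

lemma proj_self: "x \<in> carrier \<Delta> \<Longrightarrow> (t, x) \<in> proj (t, x)"
proof -
  interpret G: comm_group \<Gamma> by (rule comm_group_product)
  show "x \<in> carrier \<Delta> \<Longrightarrow> ?thesis"
    unfolding proj_def by (intro G.rcos_self subgroup_solenoid_subgroup) (simp add: real_group_def)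
qed

lemma topspace_\<T>: "topspace \<T> = carrier \<Sigma>"
  by (rule topspace_solenoid_topology)

lemma quotient_map_proj: "quotient_map (prod_topology euclideanreal (adic_topology a)) \<T> proj"
  unfolding solenoid_topology_def proj_def[abs_def] by (rule quotient_map_quotient_topology)

text \<open>The compact set [0, 1] x \<Delta> already meets every coset: adding -floor t times the
  generator of B moves the real coordinate \<open>t\<close> to its fractional part.\<close>

lemma compact_space_\<T>: "compact_space \<T>"
proof -
  have "compact_space (adic_topology a)"
    unfolding adic_topology_def
    by (simp add: compact_space_product_topology compact_space_discrete_topology)
  then have "compactin (prod_topology euclideanreal (adic_topology a)) ({0..1} \<times> carrier \<Delta>)"
    by (simp add: compactin_Times compact_space_def topspace_adic_topology)
  then have "compactin \<T> (proj ` ({0..1} \<times> carrier \<Delta>))"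
    by (rule image_compactin[OF _ quotient_imp_continuous_map[OF quotient_map_proj]])
  moreover have "proj ` ({0..1} \<times> carrier \<Delta>) = carrier \<Sigma>"
  proof -
    have "proj (t, x) \<in> proj ` ({0..1} \<times> carrier \<Delta>)" if x: "x \<in> carrier \<Delta>" for t x
    proof -
      let ?y = "adic_add a (adic_unit [^]\<^bsub>\<Delta>\<^esub> (-\<lfloor>t\<rfloor>)) x"
      have "proj (frac t, ?y) = proj (t, x)"
        by (rule proj_eqI[OF x adic_add_closed, of _ _ "-\<lfloor>t\<rfloor>"]) (auto simp: frac_def)
      then show ?thesis
        using adic_add_closed frac_lt_1[of t] by (metis (no_types, lifting) SigmaI atLeastAtMost_iff frac_ge_0 image_eqI less_eq_real_def)
    qed
    then show ?thesis by (auto simp: carrier_solenoid)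
  qed
  ultimately show ?thesis by (simp add: compact_space_def topspace_\<T>)
qed

end

section \<open>Characters of the solenoid\<close>

lemma cis_2pi_cong:
  assumes "x - y \<in> \<int>"
  shows "cis (2 * pi * x) = cis (2 * pi * y)"
proof -
  have "cis (2 * pi * x) = cis (2 * pi * y) * cis (2 * pi * (x - y))"
    unfolding cis_mult by (simp add: algebra_simps)
  then show ?thesis using assms by (simp del: mult.right_neutral add: cis_multiple_2pi)
qed

lemma cis_2pi_eqD:
  assumes "cis (2 * pi * x) = cis (2 * pi * y)"
  shows "x - y \<in> \<int>"
proof -
  have "cis (2 * pi * (x - y)) = cis (2 * pi * x) / cis (2 * pi * y)"
    unfolding cis_divide by (simp add: algebra_simps)
  then have "cis (2 * pi * (x - y)) = 1" using assms by simp
  then have "cos (2 * pi * (x - y)) = 1" by (metis cis.sel(1) one_complex.sel(1))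
  then obtain n :: int where "2 * pi * (x - y) = of_int n * 2 * pi" unfolding cos_one_2pi_int by blast
  then have "x - y = of_int n" by simp
  then show ?thesis by (metis Ints_of_int)
qed

lemma cis_2pi_surj:
  assumes "cmod z = 1"
  obtains t where "z = cis (2 * pi * t)"
proof -
  have "z = cis (Arg z)" using assms cis_Arg[of z] by (cases "z = 0") (simp_all add: sgn_eq)
  then show ?thesis by (intro that[of "Arg z / (2 * pi)"]) simp
qed

context adic_base
begin

text \<open>The group H_a: \<open>radix_prod n\<close> is a_0 ... a_(n-1), so the elements are the
  fractions m / (a_0 ... a_(n-1)). Level 0 contributes the integers, which occur at every later
  level as well.\<close>

definition freq :: "real set" where
  "freq = {s. \<exists>n. s * of_int (radix_prod n) \<in> \<int>}"

text \<open>The phase is independent of the representative of the coset and of the level \<open>n\<close>, as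
  long as \<open>s * radix_prod n\<close> is an integer.\<close>

definition chr :: "real \<Rightarrow> (real \<times> (nat \<Rightarrow> int)) set \<Rightarrow> complex" where
  "chr s = (\<lambda>C\<in>carrier \<Sigma>.
     let p = SOME p. p \<in> C; n = LEAST n. s * of_int (radix_prod n) \<in> \<int>
     in cis (2 * pi * (s * (fst p - of_int (partial_value n (snd p))))))"

lemma radix_prod_multiple_in_Ints:
  assumes "s * of_int (radix_prod n) \<in> \<int>" "u mod radix_prod n = v mod radix_prod n"
  shows "s * of_int u - s * of_int v \<in> \<int>"
proof -
  obtain k where "u - v = radix_prod n * k"
    using assms(2) by (metis mod_eq_dvd_iff dvdE)
  then have "s * of_int u - s * of_int v = (s * of_int (radix_prod n)) * of_int k"
    by (metis (no_types, opaque_lifting) mult.assoc of_int_diff of_int_mult right_diff_distrib)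
  then show ?thesis using assms(1) by (simp add: Ints_mult)
qed

lemma freq_level_mono:
  assumes "s * of_int (radix_prod n) \<in> \<int>" "n \<le> m"
  shows "s * of_int (radix_prod m) \<in> \<int>"
proof -
  obtain k where "radix_prod m = radix_prod n * k"
    using radix_prod_dvd[OF assms(2)] by blast
  then have "s * of_int (radix_prod m) = (s * of_int (radix_prod n)) * of_int k" by (simp add: mult.assoc)
  then show ?thesis using assms(1) by (simp only: Ints_mult Ints_of_int)
qed

text \<open>Another representative adds an integer \<open>k\<close> to \<open>t\<close> and, modulo
  \<open>radix_prod m\<close> at the least admissible level \<open>m\<close>, also to the partial
  value; the discrepancy is a multiple of \<open>radix_prod m\<close>, which \<open>s\<close> turns
  into an integer. Later computations can therefore use any representative and any level common to
  several frequencies.\<close>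

lemma chr_proj:
  assumes s: "s * of_int (radix_prod n) \<in> \<int>" and x: "x \<in> carrier \<Delta>"
  shows "chr s (proj (t, x)) = cis (2 * pi * (s * (t - of_int (partial_value n x))))"
proof -
  define m where "m = (LEAST n. s * of_int (radix_prod n) \<in> \<int>)"
  have m: "s * of_int (radix_prod m) \<in> \<int>" unfolding m_def using s by (rule LeastI)
  have mn: "m \<le> n" unfolding m_def using s by (rule Least_le)
  define p where "p = (SOME p. p \<in> proj (t, x))"
  have "p \<in> proj (t, x)" unfolding p_def using proj_self[OF x] by (rule someI)
  then obtain k where p: "p = (t + of_int k, adic_add a (adic_unit [^]\<^bsub>\<Delta>\<^esub> k) x)"
    by (rule mem_proj)
  have "(k + partial_value n x) mod radix_prod m = partial_value m (snd p) mod radix_prod m"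
    unfolding p snd_conv partial_value_add
    by (metis mod_add_cong partial_value_mod[OF mn] partial_value_unit_pow)
  then have "s * of_int (k + partial_value n x) - s * of_int (partial_value m (snd p)) \<in> \<int>"
    by (rule radix_prod_multiple_in_Ints[OF m])
  then have "s * (fst p - of_int (partial_value m (snd p))) - s * (t - of_int (partial_value n x)) \<in> \<int>"
    unfolding p by (simp add: algebra_simps)
  then show ?thesis
    using proj_in[OF x, of t] by (simp add: chr_def m_def[symmetric] p_def[symmetric] Let_def cis_2pi_cong)
qed

lemma solenoid_cases:
  assumes "C \<in> carrier \<Sigma>"
  obtains t x where "x \<in> carrier \<Delta>" "C = proj (t, x)"
  using assms by (auto simp: carrier_solenoid)

lemma freq_common_level:
  assumes "s \<in> freq" "s' \<in> freq"
  obtains n where "s * of_int (radix_prod n) \<in> \<int>" "s' * of_int (radix_prod n) \<in> \<int>"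
proof -
  obtain n m where "s * of_int (radix_prod n) \<in> \<int>" "s' * of_int (radix_prod m) \<in> \<int>"
    using assms by (auto simp: freq_def)
  then show ?thesis
    by (intro that[of "max n m"]) (auto elim: freq_level_mono)
qed

lemma freq_add: "s \<in> freq \<Longrightarrow> s' \<in> freq \<Longrightarrow> s + s' \<in> freq"
  by (erule (1) freq_common_level) (auto simp: freq_def distrib_right intro: Ints_add)

lemma freq_minus: "s \<in> freq \<Longrightarrow> - s \<in> freq"
  by (auto simp: freq_def)

lemma freq_diff: "s \<in> freq \<Longrightarrow> s' \<in> freq \<Longrightarrow> s - s' \<in> freq"
  using freq_add[OF _ freq_minus] by simp

lemma freq_zero [simp]: "0 \<in> freq"
  by (simp add: freq_def)

lemma freq_one [simp]: "1 \<in> freq"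
  by (simp add: freq_def)

lemma freq_of_int_mult:
  assumes "s \<in> freq"
  shows "of_int k * s \<in> freq"
proof -
  obtain n where "s * of_int (radix_prod n) \<in> \<int>" using assms by (auto simp: freq_def)
  then have "of_int k * (s * of_int (radix_prod n)) \<in> \<int>" by (simp only: Ints_mult Ints_of_int)
  then show ?thesis unfolding freq_def by (metis (mono_tags, lifting) mem_Collect_eq mult.assoc)
qed

lemma level_in_freq: "of_int k / of_int (radix_prod n) \<in> freq"
  unfolding freq_def by (intro CollectI exI[of _ n]) simp

lemma freq_cases:
  assumes "s \<in> freq"
  obtains k n where "s = of_int k / of_int (radix_prod n)"
proof -
  obtain n where "s * of_int (radix_prod n) \<in> \<int>" using assms by (auto simp: freq_def)
  then obtain k where "s * of_int (radix_prod n) = of_int k" by (auto elim: Ints_cases)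
  then show ?thesis by (intro that[of k n]) (simp add: field_simps)
qed

lemma chr_mult:
  assumes "s \<in> freq" "C \<in> carrier \<Sigma>" "D \<in> carrier \<Sigma>"
  shows "chr s (C \<otimes>\<^bsub>\<Sigma>\<^esub> D) = chr s C * chr s D"
proof -
  obtain n where n: "s * of_int (radix_prod n) \<in> \<int>" using assms(1) by (auto simp: freq_def)
  obtain t x where x: "x \<in> carrier \<Delta>" "C = proj (t, x)" using assms(2) by (rule solenoid_cases)
  obtain t' x' where x': "x' \<in> carrier \<Delta>" "D = proj (t', x')" using assms(3) by (rule solenoid_cases)
  have "s * of_int (partial_value n x + partial_value n x') - s * of_int (partial_value n (adic_add a x x')) \<in> \<int>"
    by (rule radix_prod_multiple_in_Ints[OF n]) (simp add: partial_value_add)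
  then have "cis (2 * pi * (s * (t + t' - of_int (partial_value n (adic_add a x x')))))
    = cis (2 * pi * (s * (t - of_int (partial_value n x)) + s * (t' - of_int (partial_value n x'))))"
    by (intro cis_2pi_cong) (simp add: algebra_simps)
  then show ?thesis
    by (simp add: x x' proj_mult chr_proj[OF n] adic_add_closed cis_mult distrib_left)
qed

lemma norm_chr [simp]:
  assumes "C \<in> carrier \<Sigma>"
  shows "cmod (chr s C) = 1"
  using assms by (simp add: chr_def Let_def)

lemma chr_add:
  assumes "s \<in> freq" "s' \<in> freq" "C \<in> carrier \<Sigma>"
  shows "chr (s + s') C = chr s C * chr s' C"
proof -
  obtain n where n: "s * of_int (radix_prod n) \<in> \<int>" "s' * of_int (radix_prod n) \<in> \<int>"
    using freq_common_level[OF assms(1,2)] .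
  then have n': "(s + s') * of_int (radix_prod n) \<in> \<int>" by (simp add: distrib_right)
  obtain t x where x: "x \<in> carrier \<Delta>" "C = proj (t, x)" using assms(3) by (rule solenoid_cases)
  show ?thesis by (simp add: x chr_proj[OF n(1)] chr_proj[OF n(2)] chr_proj[OF n'] cis_mult algebra_simps)
qed

lemma chr_of_int_mult:
  assumes "s \<in> freq" "C \<in> carrier \<Sigma>"
  shows "chr (of_int k * s) C = chr s C powi k"
proof -
  obtain n where n: "s * of_int (radix_prod n) \<in> \<int>" using assms(1) by (auto simp: freq_def)
  then have n': "of_int k * s * of_int (radix_prod n) \<in> \<int>" by (simp only: mult.assoc Ints_mult Ints_of_int)
  obtain t x where x: "x \<in> carrier \<Delta>" "C = proj (t, x)" using assms(2) by (rule solenoid_cases)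
  show ?thesis unfolding x(2) chr_proj[OF n x(1)] chr_proj[OF n' x(1)] cis_power_int by (simp add: algebra_simps)
qed

lemma chr_zero: "C \<in> carrier \<Sigma> \<Longrightarrow> chr 0 C = 1"
  by (simp add: chr_def)

lemma chr_minus:
  assumes "s \<in> freq" "C \<in> carrier \<Sigma>"
  shows "chr (- s) C = cnj (chr s C)"
proof -
  have "chr (-s) C = inverse (chr s C)"
    using chr_of_int_mult[OF assms, of "-1"] by (simp add: power_int_minus)
  moreover have "chr s C * cnj (chr s C) = 1"
    using complex_norm_square[of "chr s C"] norm_chr[OF assms(2)] by simp
  ultimately show ?thesis by (simp add: inverse_unique)
qed

text \<open>The one-parameter subgroup coming from the real factor. On it \<open>chr s\<close> is
  the ordinary character of frequency \<open>s\<close>, which is enough to tell the characters apart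
  and, at any single level, to reach every value on the circle.\<close>

definition line :: "real \<Rightarrow> (real \<times> (nat \<Rightarrow> int)) set" where
  "line t = proj (t, \<lambda>_. 0)"

lemma zero_in_adic: "(\<lambda>_. 0) \<in> carrier \<Delta>"
  using comm_group_adic_integers adic_one by (metis comm_group_def comm_monoid_def monoid.one_closed)

lemma line_in [simp]: "line t \<in> carrier \<Sigma>"
  unfolding line_def by (rule proj_in[OF zero_in_adic])

lemma line_zero: "line 0 = \<one>\<^bsub>\<Sigma>\<^esub>"
  unfolding line_def by (rule proj_zero)

lemma line_add: "line (s + t) = line s \<otimes>\<^bsub>\<Sigma>\<^esub> line t"
proof -
  interpret D: comm_group \<Delta> by (rule comm_group_adic_integers)
  have "adic_add a (\<lambda>_. 0) (\<lambda>_. 0) = (\<lambda>_. 0)"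
    using D.l_one[OF zero_in_adic] by simp
  then show ?thesis by (simp add: line_def proj_mult zero_in_adic)
qed

lemma chr_line:
  assumes "s \<in> freq"
  shows "chr s (line t) = cis (2 * pi * (s * t))"
proof -
  obtain n where n: "s * of_int (radix_prod n) \<in> \<int>" using assms(1) by (auto simp: freq_def)
  show ?thesis by (simp add: line_def chr_proj[OF n] zero_in_adic)
qed

lemma chr_inj:
  assumes "s \<in> freq" "s' \<in> freq" "\<And>t. chr s (line t) = chr s' (line t)"
  shows "s = s'"
proof (rule ccontr)
  assume ne: "s \<noteq> s'"
  \<comment> \<open>At this point of the line the two phases differ by exactly half a turn.\<close>
  define t where "t = 1 / (2 * (s - s'))"
  have "s * t - s' * t \<in> \<int>"
    using assms(3)[of t] unfolding chr_line[OF assms(1)] chr_line[OF assms(2)] by (rule cis_2pi_eqD)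
  moreover have "s * t - s' * t = 1 / 2" proof -
    have "s * t - s' * t = (s - s') * t" by (simp add: left_diff_distrib)
    then show ?thesis using ne by (simp add: t_def)
  qed
  ultimately obtain k :: int where "1 / 2 = real_of_int k" by (metis Ints_cases)
  then have "real_of_int (2 * k) = of_int 1" by simp
  then have "2 * k = 1" by (simp only: of_int_eq_iff)
  then show False by presburger
qed

text \<open>Level 0 shows that the real coordinates differ by an integer \<open>k\<close>; level
  \<open>n\<close> then says that the partial values differ by \<open>k\<close> modulo
  \<open>radix_prod n\<close>. As this holds for all \<open>n\<close>, the two representatives
  differ by the element of B with index \<open>k\<close>.\<close>

lemma chr_separates:
  assumes "C \<in> carrier \<Sigma>" "D \<in> carrier \<Sigma>"
    and eq: "\<And>n. chr (1 / of_int (radix_prod n)) C = chr (1 / of_int (radix_prod n)) D"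
  shows "C = D"
proof -
  obtain t x where x: "x \<in> carrier \<Delta>" "C = proj (t, x)" using assms(1) by (rule solenoid_cases)
  obtain t' y where y: "y \<in> carrier \<Delta>" "D = proj (t', y)" using assms(2) by (rule solenoid_cases)
  have Z: "((t - of_int (partial_value n x)) - (t' - of_int (partial_value n y))) / of_int (radix_prod n) \<in> \<int>" for n
  proof -
    have n: "1 / of_int (radix_prod n) * of_int (radix_prod n) \<in> (\<int> :: real set)" by simp
    have "1 / of_int (radix_prod n) * (t - of_int (partial_value n x)) - 1 / of_int (radix_prod n) * (t' - of_int (partial_value n y)) \<in> \<int>"
      using eq[of n] unfolding x(2) y(2) chr_proj[OF n x(1)] chr_proj[OF n y(1)] by (rule cis_2pi_eqD)
    then show ?thesis by (simp add: diff_divide_distrib)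
  qed
  obtain k :: int where k: "t - t' = of_int k" using Z[of 0] by (auto elim: Ints_cases)
  have "proj (t, x) = proj (t', y)"
  proof (rule proj_eqI[OF y(1) x(1), of _ _ k])
    show "t = t' + of_int k" using k by simp
    show "x = adic_add a (adic_unit [^]\<^bsub>\<Delta>\<^esub> k) y"
    proof (rule adic_integers_eqI[OF x(1) adic_add_closed])
      fix n
      obtain l :: int where "((t - of_int (partial_value n x)) - (t' - of_int (partial_value n y))) / of_int (radix_prod n) = of_int l"
        using Z[of n] by (auto elim: Ints_cases)
      then have "real_of_int (k - partial_value n x + partial_value n y) = of_int (l * radix_prod n)"
        using k by (simp add: field_simps)
      then have "k - partial_value n x + partial_value n y = l * radix_prod n" by (simp only: of_int_eq_iff)
      then have "partial_value n x mod radix_prod n = (k + partial_value n y) mod radix_prod n"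
        by (simp add: mod_eq_dvd_iff) (metis add_diff_eq diff_diff_eq2 dvd_minus_iff dvd_triv_right minus_diff_eq add.commute)
      then show "partial_value n x mod radix_prod n = partial_value n (adic_add a (adic_unit [^]\<^bsub>\<Delta>\<^esub> k) y) mod radix_prod n"
        unfolding partial_value_add by (metis mod_add_left_eq partial_value_unit_pow)
    qed
  qed
  then show ?thesis by (simp add: x y)
qed

text \<open>Continuity on a quotient is continuity of the pullback, and at a fixed level the phase
  involves only the real coordinate and finitely many digits.\<close>

lemma continuous_chr:
  assumes "s \<in> freq"
  shows "continuous_map \<T> euclidean (chr s)"
proof (rule continuous_compose_quotient_map[OF quotient_map_proj])
  obtain n where n: "s * of_int (radix_prod n) \<in> \<int>" using assms(1) by (auto simp: freq_def)
  let ?P = "prod_topology euclideanreal (adic_topology a)"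
  have coord: "continuous_map (adic_topology a) euclideanreal (\<lambda>x. of_int (x k))" for k
  proof -
    have 1: "continuous_map (adic_topology a) (discrete_topology {0..<a k}) (\<lambda>x. x k)"
      unfolding adic_topology_def by (rule continuous_map_product_projection) simp
    have 2: "continuous_map (discrete_topology {0..<a k}) euclideanreal of_int"
      by simp
    show ?thesis using continuous_map_compose[OF 1 2] by (simp add: o_def)
  qed
  have coord': "continuous_map ?P euclideanreal (\<lambda>p. of_int (snd p k))" for k
    using continuous_map_compose[OF continuous_map_snd coord] by (simp add: o_def)
  have "continuous_map ?P euclideanreal (\<lambda>p. 2 * pi * (s * (fst p - (\<Sum>k<n. of_int (snd p k) * of_int (radix_prod k)))))"
    by (intro continuous_map_real_mult continuous_map_diff continuous_map_sum coord' continuous_map_fst) simp_all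
  then have "continuous_map ?P euclidean (cis \<circ> (\<lambda>p. 2 * pi * (s * (fst p - (\<Sum>k<n. of_int (snd p k) * of_int (radix_prod k))))))"
    by (rule continuous_map_compose) (simp add: continuous_on_cis continuous_on_id)
  then show "continuous_map ?P euclidean (chr s \<circ> proj)"
  proof (rule continuous_map_eq)
    fix p assume "p \<in> topspace ?P"
    then show "(cis \<circ> (\<lambda>p. 2 * pi * (s * (fst p - (\<Sum>k<n. of_int (snd p k) * of_int (radix_prod k)))))) p = (chr s \<circ> proj) p"
      by (cases p) (simp add: topspace_adic_topology chr_proj[OF n] partial_value_def)
  qed
qed

lemma continuous_line: "continuous_map euclideanreal \<T> line"
proof -
  have "continuous_map euclideanreal (prod_topology euclideanreal (adic_topology a)) (\<lambda>t. (t, \<lambda>_. 0))"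
    using zero_in_adic by (simp add: continuous_map_pairwise o_def topspace_adic_topology)
  from continuous_map_compose[OF this quotient_imp_continuous_map[OF quotient_map_proj]]
  show ?thesis by (simp add: o_def line_def[abs_def])
qed

text \<open>Compactness: the decreasing level sets \<open>g n z = w n\<close> shrink into any neighbourhood of
  their intersection. With \<open>U = {}\<close> this is used contrapositively to solve infinitely many equations.\<close>

lemma level_sets_in_open:
  assumes g: "\<And>n. continuous_map \<T> euclidean (g n)"
    and step: "\<And>n z. z \<in> carrier \<Sigma> \<Longrightarrow> g (Suc n) z = w (Suc n) \<Longrightarrow> g n z = (w n :: complex)"
    and U: "openin \<T> U"
    and sub: "\<And>z. z \<in> carrier \<Sigma> \<Longrightarrow> \<forall>n. g n z = w n \<Longrightarrow> z \<in> U"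
  shows "\<exists>n. \<forall>z\<in>carrier \<Sigma>. g n z = w n \<longrightarrow> z \<in> U"
proof (rule ccontr)
  assume ne: "\<not> ?thesis"
  define C where "C n = {z \<in> topspace \<T>. g n z \<in> {w n}} - U" for n
  have "(\<Inter>n. C n) \<noteq> {}"
  proof (rule compact_space_imp_nest[OF compact_space_\<T>])
    show "closedin \<T> (C n)" for n
      unfolding C_def by (intro closedin_diff closedin_continuous_map_preimage[OF g] U) simp
    show "C n \<noteq> {}" for n using ne by (auto simp: C_def topspace_\<T>)
    show "decseq C" by (rule decseq_SucI) (auto simp: C_def topspace_\<T> step)
  qed
  then show False using sub by (auto simp: C_def topspace_\<T>)
qed

lemma inverse_radix_prod_Suc:
  "1 / real_of_int (radix_prod n) = of_int (a n) * (1 / of_int (radix_prod (Suc n)))"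
  using base_gt_1[of n] by (simp add: radix_prod_Suc)

text \<open>The equation at level \<open>n + 1\<close> implies the one at level \<open>n\<close>,
  since the lower character is a power of the higher one. Each single equation is solved by a point
  of the line, so compactness gives a common solution. This is the half of Pontryagin duality by
  which a unimodular character of \<open>freq\<close> becomes a point of the solenoid, the shift of
  a Gaussian.\<close>

lemma exists_with_chr:
  assumes l: "\<And>s s'. s \<in> freq \<Longrightarrow> s' \<in> freq \<Longrightarrow> l (s + s') = l s * l s'"
    and norm: "\<And>s. s \<in> freq \<Longrightarrow> cmod (l s) = 1"
  obtains C where "C \<in> carrier \<Sigma>" "\<And>s. s \<in> freq \<Longrightarrow> chr s C = l s"
proof -
  let ?q = "\<lambda>n. 1 / real_of_int (radix_prod n)"
  have q: "?q n \<in> freq" for n using level_in_freq[of 1 n] by simp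
  have nat: "l (of_nat k * s) = l s ^ k" if "s \<in> freq" for k s
  proof (induction k)
    case 0
    have "l 0 = l 0 * l 0" "cmod (l 0) = 1" using l[of 0 0] norm[of 0] by auto
    then show ?case by auto
  next
    case (Suc k)
    have "of_nat k * s \<in> freq" using freq_of_int_mult[OF that, of "int k"] by simp
    from l[OF that this] show ?case using Suc by (simp add: distrib_right)
  qed
  have int: "l (of_int k * s) = l s powi k" if "s \<in> freq" for k s
  proof (cases "k \<ge> 0")
    case True then show ?thesis using nat[OF that, of "nat k"] by (simp add: power_int_def)
  next
    case False
    have k: "of_int (-k) * s \<in> freq" "of_int k * s \<in> freq" using freq_of_int_mult[OF that] by blast+
    have "l (of_int k * s) * l (of_int (-k) * s) = l 0" using l[OF k(2,1)] by simp
    moreover have "l 0 = 1" using nat[OF that, of 0] by simp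
    moreover have "l (of_int (-k) * s) = l s ^ nat (-k)" using nat[OF that, of "nat (-k)"] False by simp
    ultimately show ?thesis using False by (simp add: power_int_def power_inverse) (metis inverse_unique mult.commute)
  qed
  have "\<exists>z\<in>carrier \<Sigma>. \<forall>n. chr (?q n) z = l (?q n)"
  proof (rule ccontr)
    assume none: "\<not> ?thesis"
    have "\<exists>n. \<forall>z\<in>carrier \<Sigma>. chr (?q n) z = l (?q n) \<longrightarrow> z \<in> {}"
    proof (rule level_sets_in_open)
      show "continuous_map \<T> euclidean (chr (?q n))" for n by (rule continuous_chr[OF q])
      show "chr (?q n) z = l (?q n)" if "z \<in> carrier \<Sigma>" "chr (?q (Suc n)) z = l (?q (Suc n))" for n z
        using that unfolding inverse_radix_prod_Suc[of n] by (simp only: int[OF q] chr_of_int_mult[OF q])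
    qed (use none in auto)
    then obtain n where n: "\<And>z. z \<in> carrier \<Sigma> \<Longrightarrow> chr (?q n) z \<noteq> l (?q n)" by auto
    obtain t where "l (?q n) = cis (2 * pi * t)" using cis_2pi_surj[OF norm[OF q]] .
    then have "chr (?q n) (line (t * of_int (radix_prod n))) = l (?q n)"
      by (simp add: chr_line[OF q])
    then show False using n line_in by blast
  qed
  then obtain z where z: "z \<in> carrier \<Sigma>" "\<And>n. chr (?q n) z = l (?q n)" by blast
  have "chr s z = l s" if s: "s \<in> freq" for s
  proof -
    obtain k n where "s = of_int k / of_int (radix_prod n)" using freq_cases[OF s] .
    then have "s = of_int k * ?q n" by simp
    then show ?thesis using int[OF q] chr_of_int_mult[OF q z(1)] z(2) by simp
  qed
  then show ?thesis using z that by blast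
qed

end

section \<open>Duality\<close>

text \<open>If all powers stay within 1/2 of 1, then |w + 1| \<ge> 3/2 for each power w, and |w^2 -
  1| = |w + 1| |w - 1| shows that repeated squaring multiplies a nonzero distance to 1 by at least
  3/2 each time.\<close>

lemma circle_no_small_subgroups:
  fixes z :: complex
  assumes small: "\<And>k. cmod (z ^ k - 1) < 1 / 2"
  shows "z = 1"
proof (rule ccontr)
  assume "z \<noteq> 1"
  have grow: "(3 / 2) ^ j * cmod (z - 1) \<le> cmod (z ^ (2 ^ j) - 1)" for j
  proof (induction j)
    case (Suc j)
    let ?w = "z ^ (2 ^ j)"
    have "2 = cmod ((?w + 1) - (?w - 1))" by simp
    also have "\<dots> \<le> cmod (?w + 1) + cmod (?w - 1)" by (rule norm_triangle_ineq4)
    finally have "3 / 2 \<le> cmod (?w + 1)" using small[of "2 ^ j"] by linarith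
    then have "3 / 2 * ((3 / 2) ^ j * cmod (z - 1)) \<le> cmod (?w + 1) * cmod (?w - 1)"
      using Suc by (intro mult_mono) auto
    also have "\<dots> = cmod ((?w + 1) * (?w - 1))" by (simp add: norm_mult)
    also have "(?w + 1) * (?w - 1) = z ^ (2 ^ Suc j) - 1"
      by (simp add: algebra_simps power_mult power2_eq_square flip: power_add)
    finally show ?case by simp
  qed simp
  obtain j where "1 / cmod (z - 1) < (3 / 2) ^ j" using real_arch_pow[of "3/2"] by auto
  then have "1 < (3 / 2) ^ j * cmod (z - 1)" using \<open>z \<noteq> 1\<close> by (simp add: field_simps)
  then show False using grow[of j] small[of "2 ^ j"] by linarith
qed

text \<open>A continuous logarithm of \<open>f\<close> differs from a linear function by an additive function that
  is periodic, hence bounded, hence zero.\<close>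

lemma periodic_circle_hom:
  fixes f :: "real \<Rightarrow> complex"
  assumes cont: "continuous_on UNIV f" and hom: "\<And>s t. f (s + t) = f s * f t"
    and nz: "\<And>t. f t \<noteq> 0" and p: "p > 0" "f p = 1"
  obtains m :: int where "\<And>t. f t = cis (2 * pi * (of_int m / p * t))"
proof -
  obtain g where g: "continuous_on UNIV g" "\<And>x. f x = exp (g x)"
    using continuous_logarithm_on_contractible[OF cont] nz
    by (metis UNIV_I convex_UNIV convex_imp_contractible)
  have "f 0 = f 0 * f 0" using hom[of 0 0] by simp
  then have f0: "f 0 = 1" using nz[of 0] by auto
  have add: "g (x + y) - g x - g y = - g 0" for x y
  proof -
    let ?d = "\<lambda>y. g (x + y) - g x - g y"
    have cd: "continuous_on UNIV ?d"
      by (intro continuous_intros continuous_on_compose2[OF g(1)]) auto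
    \<comment> \<open>For fixed \<open>x\<close> the exponential of \<open>?d\<close> is 1, so
      \<open>?d\<close> is continuous with values in the integer multiples of 2 \<pi> i; distinct
      values are at least 2 \<pi> apart. The constant is the value at 0, namely
      \<open>- g 0\<close>.\<close>
    have "?d constant_on UNIV"
    proof (rule continuous_discrete_range_constant[OF _ cd])
      fix y
      have dist: "2 * pi \<le> norm (?d y' - ?d y)" if "?d y' \<noteq> ?d y" for y'
      proof -
        have e: "exp (?d z) = 1" for z
          using hom[of x z] nz by (simp add: exp_diff g(2)[symmetric])
        have "exp (?d y' - ?d y) = 1" using exp_diff[of "?d y'" "?d y"] unfolding e by simp
        then obtain n :: int where n: "Re (?d y' - ?d y) = 0" "Im (?d y' - ?d y) = of_int (2 * n) * pi"
          unfolding exp_eq_1 by blast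
        have "n \<noteq> 0"
        proof
          assume "n = 0"
          then have "?d y' - ?d y = 0" using n by (simp add: complex_eq_iff)
          then have "?d y' = ?d y" by (simp only: right_minus_eq)
          then show False using that by blast
        qed
        then have "1 \<le> \<bar>real_of_int n\<bar>" by linarith
        then have "2 * pi \<le> \<bar>Im (?d y' - ?d y)\<bar>" unfolding n(2) by (simp add: abs_mult)
        then show ?thesis using abs_Im_le_cmod order_trans by blast
      qed
      show "\<exists>e>0. \<forall>y'. y' \<in> UNIV \<and> ?d y' \<noteq> ?d y \<longrightarrow> e \<le> norm (?d y' - ?d y)"
        by (rule exI[of _ "2 * pi"]) (use dist in auto)
    qed auto
    then have "?d y = ?d 0" unfolding constant_on_def by (metis UNIV_I)
    then show ?thesis by simp
  qed
  \<comment> \<open>The chord of \<open>g\<close> from 0 to \<open>p\<close> is subtracted: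
    \<open>h\<close> stays additive and now vanishes at \<open>p\<close>, which makes it
    periodic.\<close>
  define h where "h x = g x - g 0 - of_real (x / p) * (g p - g 0)" for x
  have h_add: "h (x + y) = h x + h y" for x y
  proof -
    have "g (x + y) = g x + g y - g 0" using add[of x y] by (simp add: algebra_simps)
    then show ?thesis by (simp add: h_def algebra_simps add_divide_distrib)
  qed
  have hp: "h p = 0" using p(1) by (simp add: h_def)
  have h_nat: "h (of_nat k * x) = of_nat k * h x" for k x
  proof (induction k)
    case 0 show ?case by (simp add: h_def)
  next
    case (Suc k) then show ?case by (simp add: distrib_right h_add)
  qed
  have "h 0 = 0" by (simp add: h_def)
  then have h_minus: "h (- x) = - h x" for x
    using h_add[of "-x" x] by (simp add: eq_neg_iff_add_eq_0)
  have h_int: "h (of_int k * p) = 0" for k :: int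
  proof (cases "k \<ge> 0")
    case True then show ?thesis using h_nat[of "nat k" p] hp by simp
  next
    case False
    then have "h (of_int (-k) * p) = 0" using h_nat[of "nat (-k)" p] hp by simp
    then show ?thesis using h_minus[of "of_int k * p"] by simp
  qed
  have "continuous_on {0..p} h"
    unfolding h_def by (intro continuous_intros continuous_on_subset[OF g(1)]) (use p in auto)
  then have "bounded (h ` {0..p})"
    by (intro compact_imp_bounded compact_continuous_image) auto
  then obtain M where M: "\<And>x. x \<in> {0..p} \<Longrightarrow> norm (h x) \<le> M" unfolding bounded_iff by blast
  have bound: "norm (h x) \<le> M" for x
  proof -
    define k where "k = \<lfloor>x / p\<rfloor>"
    have "of_int k \<le> x / p" "x / p < of_int k + 1" unfolding k_def by linarith+
    then have "x - of_int k * p \<in> {0..p}" using p(1) by (simp add: field_simps)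
    moreover have "h x = h (x - of_int k * p)" using h_add[of "x - of_int k * p" "of_int k * p"] h_int[of k] by simp
    ultimately show ?thesis using M by simp
  qed
  have h0: "h x = 0" for x
  proof (rule ccontr)
    assume "h x \<noteq> 0"
    then obtain k :: nat where k: "M < of_nat k * norm (h x)" using reals_Archimedean3[of "norm (h x)"] by auto
    then show False using bound[of "of_nat k * x"] h_nat[of k x] by (simp add: norm_mult)
  qed
  have eg0: "exp (g 0) = 1" using f0 g(2) by simp
  have "exp (g p - g 0) = 1" using p(2) g(2) eg0 by (simp add: exp_diff)
  then obtain m :: int where m: "Re (g p - g 0) = 0" "Im (g p - g 0) = of_int (2 * m) * pi"
    unfolding exp_eq_1 by blast
  then have gp: "g p - g 0 = \<i> * of_real (2 * pi * of_int m)" by (simp add: complex_eq_iff)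
  have "f t = cis (2 * pi * (of_int m / p * t))" for t
  proof -
    have "f t = exp (g t - g 0)" using g(2) eg0 by (simp add: exp_diff)
    also have "g t - g 0 = of_real (t / p) * (g p - g 0)" using h0[of t] by (simp add: h_def)
    also have "\<dots> = \<i> * of_real (2 * pi * (of_int m / p * t))" unfolding gp by simp
    finally show ?thesis by (simp add: cis_conv_exp)
  qed
  then show ?thesis by (rule that)
qed

context adic_base
begin

lemma chr_one: "s \<in> freq \<Longrightarrow> chr s \<one>\<^bsub>\<Sigma>\<^esub> = 1"
  using chr_line[of s 0] by (simp add: line_zero)

lemma chr_eq_1_everywhere:
  assumes "C \<in> carrier \<Sigma>" "\<And>s. s \<in> freq \<Longrightarrow> chr s C = 1"
  shows "C = \<one>\<^bsub>\<Sigma>\<^esub>"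
proof (rule chr_separates[OF assms(1)])
  show "\<one>\<^bsub>\<Sigma>\<^esub> \<in> carrier \<Sigma>" using line_in[of 0] by (simp add: line_zero)
  show "chr (1 / of_int (radix_prod n)) C = chr (1 / of_int (radix_prod n)) \<one>\<^bsub>\<Sigma>\<^esub>" for n
    using level_in_freq[of 1 n] assms(2) by (simp add: chr_one)
qed

text \<open>The kernels of \<open>chr (r / radix_prod n)\<close> decrease, and by
  \<open>triv\<close> their intersection is trivial, so by compactness one of them lies where
  \<open>y\<close> is within 1/2 of 1. That kernel is closed under powers, and the circle has no
  small subgroups, hence \<open>y\<close> is 1 on it. The case \<open>r = 1\<close> serves to find
  all characters; general \<open>r\<close> serves to invert a multiplier.\<close>

lemma kernel_level:
  assumes r: "\<And>s. s \<in> freq \<Longrightarrow> r * s \<in> freq"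
    and triv: "\<And>C. C \<in> carrier \<Sigma> \<Longrightarrow> (\<And>s. s \<in> freq \<Longrightarrow> chr (r * s) C = 1) \<Longrightarrow> C = \<one>\<^bsub>\<Sigma>\<^esub>"
    and y: "continuous_map \<T> euclidean y"
    and mult: "\<And>C D. C \<in> carrier \<Sigma> \<Longrightarrow> D \<in> carrier \<Sigma> \<Longrightarrow> y (C \<otimes>\<^bsub>\<Sigma>\<^esub> D) = y C * (y D :: complex)"
    and nz: "y \<one>\<^bsub>\<Sigma>\<^esub> = 1"
  obtains n where "\<And>C. C \<in> carrier \<Sigma> \<Longrightarrow> chr (r / of_int (radix_prod n)) C = 1 \<Longrightarrow> y C = 1"
proof -
  interpret S: comm_group \<Sigma> by (rule comm_group_solenoid)
  have q: "r / of_int (radix_prod n) \<in> freq" for n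
    using r[OF level_in_freq[of 1 n]] by simp
  have "\<exists>n. \<forall>z\<in>carrier \<Sigma>. chr (r / of_int (radix_prod n)) z = 1 \<longrightarrow> z \<in> {z \<in> topspace \<T>. y z \<in> ball 1 (1/2)}"
  proof (rule level_sets_in_open)
    show "continuous_map \<T> euclidean (chr (r / of_int (radix_prod n)))" for n
      by (rule continuous_chr[OF q])
    show "chr (r / of_int (radix_prod n)) z = 1"
      if "z \<in> carrier \<Sigma>" "chr (r / of_int (radix_prod (Suc n))) z = 1" for n z
    proof -
      have "r / of_int (radix_prod n) = of_int (a n) * (r / of_int (radix_prod (Suc n)))"
        using base_gt_1[of n] by (simp add: radix_prod_Suc)
      then show ?thesis using that chr_of_int_mult[OF q] by simp
    qed
    show "openin \<T> {z \<in> topspace \<T>. y z \<in> ball 1 (1/2)}"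
      by (rule openin_continuous_map_preimage[OF y]) simp
    show "z \<in> {z \<in> topspace \<T>. y z \<in> ball 1 (1/2)}"
      if z: "z \<in> carrier \<Sigma>" "\<forall>n. chr (r / of_int (radix_prod n)) z = 1" for z
    proof -
      have "chr (r * s) z = 1" if "s \<in> freq" for s
      proof -
        from \<open>s \<in> freq\<close> obtain k n where "s = of_int k / of_int (radix_prod n)" by (rule freq_cases)
        then have "r * s = of_int k * (r / of_int (radix_prod n))" by simp
        then show ?thesis using z chr_of_int_mult[OF q z(1)] by simp
      qed
      then have "z = \<one>\<^bsub>\<Sigma>\<^esub>" using triv[OF z(1)] by blast
      then show ?thesis using z(1) nz by (simp add: topspace_\<T>)
    qed
  qed
  then obtain n where n: "\<And>z. z \<in> carrier \<Sigma> \<Longrightarrow> chr (r / of_int (radix_prod n)) z = 1 \<Longrightarrow> cmod (y z - 1) < 1/2"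
    by (auto simp: dist_norm norm_minus_commute)
  have "y C = 1" if C: "C \<in> carrier \<Sigma>" "chr (r / of_int (radix_prod n)) C = 1" for C
  proof (rule circle_no_small_subgroups)
    fix k
    have "y (C [^]\<^bsub>\<Sigma>\<^esub> k) = y C ^ k \<and> chr (r / of_int (radix_prod n)) (C [^]\<^bsub>\<Sigma>\<^esub> k) = 1"
    proof (induction k)
      case 0 show ?case using nz chr_one[OF q] by simp
    next
      case (Suc k) then show ?case using C by (simp add: mult chr_mult[OF q])
    qed
    then show "cmod (y C ^ k - 1) < 1/2" using n[of "C [^]\<^bsub>\<Sigma>\<^esub> k"] C by simp
  qed
  then show ?thesis by (rule that)
qed

section \<open>The dual group, its discreteness, and the dual of an endomorphism\<close>

abbreviation "\<Sigma>_dual \<equiv> dual_group \<Sigma> \<T>"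

lemma chr_in_dual:
  assumes "s \<in> freq"
  shows "chr s \<in> carrier \<Sigma>_dual"
proof -
  have "chr s \<in> extensional (carrier \<Sigma>)" by (auto simp: chr_def extensional_def)
  then show ?thesis
    using assms by (auto simp: dual_group_def hom_def circle_group_def chr_mult continuous_chr)
qed

lemma dualD:
  assumes "y \<in> carrier \<Sigma>_dual"
  shows "continuous_map \<T> euclidean y"
    and "\<And>C D. C \<in> carrier \<Sigma> \<Longrightarrow> D \<in> carrier \<Sigma> \<Longrightarrow> y (C \<otimes>\<^bsub>\<Sigma>\<^esub> D) = y C * y D"
    and "\<And>C. C \<in> carrier \<Sigma> \<Longrightarrow> cmod (y C) = 1"
    and "y \<in> extensional (carrier \<Sigma>)"
  using assms by (auto simp: dual_group_def hom_def circle_group_def Pi_iff)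

text \<open>Let \<open>y\<close> be trivial on the kernel of \<open>chr ?q\<close> with
  \<open>?q\<close> = 1 / \<open>radix_prod n\<close>. Along the line \<open>y\<close> then has
  period \<open>radix_prod n\<close>, so it is the exponential of frequency \<open>m * ?q\<close>
  for an integer \<open>m\<close>. Every \<open>C\<close> differs from some \<open>line u\<close> by
  an element of that kernel, so the formula on the line determines \<open>y\<close>
  everywhere.\<close>

lemma dual_eq_chr:
  assumes y: "y \<in> carrier \<Sigma>_dual"
  obtains s where "s \<in> freq" "y = chr s"
proof -
  interpret S: comm_group \<Sigma> by (rule comm_group_solenoid)
  have y1: "y \<one>\<^bsub>\<Sigma>\<^esub> = 1"
    using dualD(2)[OF y, of "\<one>\<^bsub>\<Sigma>\<^esub>" "\<one>\<^bsub>\<Sigma>\<^esub>"] dualD(3)[OF y, of "\<one>\<^bsub>\<Sigma>\<^esub>"] by auto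
  have id: "1 * s \<in> freq" if "s \<in> freq" for s using that by simp
  have triv: "C = \<one>\<^bsub>\<Sigma>\<^esub>" if "C \<in> carrier \<Sigma>" "\<And>s. s \<in> freq \<Longrightarrow> chr (1 * s) C = 1" for C
    using chr_eq_1_everywhere[OF that(1)] that(2) by simp
  obtain n where n: "\<And>C. C \<in> carrier \<Sigma> \<Longrightarrow> chr (1 / of_int (radix_prod n)) C = 1 \<Longrightarrow> y C = 1"
    using kernel_level[OF id triv dualD(1,2)[OF y] y1] by blast
  let ?q = "1 / real_of_int (radix_prod n)"
  have q: "?q \<in> freq" using level_in_freq[of 1 n] by simp
  have "continuous_map euclideanreal euclidean (y \<circ> line)"
    by (rule continuous_map_compose[OF continuous_line dualD(1)[OF y]])
  then have cont: "continuous_on UNIV (\<lambda>t. y (line t))" by (simp add: o_def)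
  have hom: "y (line (s + t)) = y (line s) * y (line t)" for s t
    by (simp add: line_add dualD(2)[OF y])
  have nz: "y (line t) \<noteq> 0" for t using dualD(3)[OF y line_in[of t]] by auto
  have "chr ?q (line (of_int (radix_prod n))) = 1" unfolding chr_line[OF q] by simp
  then have per: "y (line (of_int (radix_prod n))) = 1" by (rule n[OF line_in])
  obtain m :: int where m: "\<And>t. y (line t) = cis (2 * pi * (of_int m / of_int (radix_prod n) * t))"
    using periodic_circle_hom[OF cont hom nz _ per] by auto
  have "y C = chr (of_int m * ?q) C" if C: "C \<in> carrier \<Sigma>" for C
  proof -
    obtain t where t: "chr ?q C = cis (2 * pi * t)" using cis_2pi_surj[OF norm_chr[OF C]] .
    define u where "u = t * of_int (radix_prod n)"
    have u: "chr ?q C = chr ?q (line u)" unfolding t u_def chr_line[OF q] by simp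
    have "chr ?q (C \<otimes>\<^bsub>\<Sigma>\<^esub> line (- u)) = chr ?q (line u) * chr ?q (line (- u))"
      by (simp add: chr_mult[OF q C] u)
    also have "\<dots> = 1" by (simp add: chr_line[OF q] cis_mult)
    finally have "y (C \<otimes>\<^bsub>\<Sigma>\<^esub> line (- u)) = 1" using n C by simp
    then have "y C * y (line (- u)) = 1" using dualD(2)[OF y C] by simp
    moreover have "y (line u) * y (line (- u)) = 1"
      using hom[of u "-u"] y1 by (simp add: line_zero)
    ultimately have "y C = y (line u)" using nz[of "-u"] by (metis mult_right_cancel)
    also have "\<dots> = chr ?q (line u) powi m"
      unfolding m chr_line[OF q] cis_power_int by (simp add: algebra_simps)
    also have "\<dots> = chr (of_int m * ?q) C" unfolding chr_of_int_mult[OF q C] u ..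
    finally show ?thesis .
  qed
  moreover have s: "of_int m * ?q \<in> freq" by (rule freq_of_int_mult[OF q])
  ultimately have "y = chr (of_int m * ?q)"
    using dualD(4)[OF y] dualD(4)[OF chr_in_dual[OF s]] by (intro extensionalityI) auto
  then show ?thesis using s that by blast
qed

lemma dual_mult_chr:
  assumes "s \<in> freq" "s' \<in> freq"
  shows "chr s \<otimes>\<^bsub>\<Sigma>_dual\<^esub> chr s' = chr (s + s')"
proof -
  have "chr s \<otimes>\<^bsub>\<Sigma>_dual\<^esub> chr s' = (\<lambda>C\<in>carrier \<Sigma>. chr s C * chr s' C)"
    by (simp add: dual_group_def)
  also have "\<dots> = chr (s + s')"
    using dualD(4)[OF chr_in_dual[OF freq_add[OF assms]]]
    by (intro extensionalityI[where A = "carrier \<Sigma>"]) (auto simp: chr_add assms)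
  finally show ?thesis .
qed

lemma dual_one_chr: "\<one>\<^bsub>\<Sigma>_dual\<^esub> = chr 0"
  unfolding dual_group_def
  by (simp, intro extensionalityI[where A = "carrier \<Sigma>"]) (auto simp: chr_zero chr_def)

lemma chr_eq_iff:
  assumes "s \<in> freq" "s' \<in> freq"
  shows "chr s = chr s' \<longleftrightarrow> s = s'"
  using chr_inj[OF assms] by auto

lemma dual_inv_chr:
  assumes "s \<in> freq"
  shows "inv\<^bsub>\<Sigma>_dual\<^esub> chr s = chr (- s)"
  unfolding m_inv_def
proof (rule the_equality)
  show "chr (- s) \<in> carrier \<Sigma>_dual \<and> chr s \<otimes>\<^bsub>\<Sigma>_dual\<^esub> chr (- s) = \<one>\<^bsub>\<Sigma>_dual\<^esub>
      \<and> chr (- s) \<otimes>\<^bsub>\<Sigma>_dual\<^esub> chr s = \<one>\<^bsub>\<Sigma>_dual\<^esub>"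
    using assms freq_minus by (simp add: chr_in_dual dual_mult_chr dual_one_chr)
next
  fix y assume y: "y \<in> carrier \<Sigma>_dual \<and> chr s \<otimes>\<^bsub>\<Sigma>_dual\<^esub> y = \<one>\<^bsub>\<Sigma>_dual\<^esub>
      \<and> y \<otimes>\<^bsub>\<Sigma>_dual\<^esub> chr s = \<one>\<^bsub>\<Sigma>_dual\<^esub>"
  then obtain s' where s': "s' \<in> freq" "y = chr s'" using dual_eq_chr by blast
  then have "chr (s + s') = chr 0" using y assms by (simp add: dual_mult_chr dual_one_chr)
  then have "s' = - s" using chr_eq_iff[OF freq_add[OF assms s'(1)] freq_zero] by simp
  then show "y = chr (- s)" using s' by simp
qed

text \<open>By compactness the whole solenoid is admissible as the test set, and two different
  characters are at distance 2 at some point of the line, so the ball of radius 1 isolates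
  \<open>chr s\<close>. Consequently the continuity demanded of \<phi> in
  \<open>gaussian_distribution\<close> holds automatically.\<close>

lemma openin_dual_singleton:
  assumes "s \<in> freq"
  shows "openin (dual_topology \<Sigma> \<T>) {chr s}"
proof -
  let ?N = "{y \<in> carrier \<Sigma>_dual. \<forall>C\<in>topspace \<T>. cmod (y C - chr s C) < 1}"
  have "y = chr s" if "y \<in> ?N" for y
  proof -
    obtain s' where s': "s' \<in> freq" "y = chr s'" using \<open>y \<in> ?N\<close> dual_eq_chr by blast
    have "s' = s"
    proof (rule ccontr)
      assume ne: "s' \<noteq> s"
      define t where "t = 1 / (2 * (s' - s))"
      have "s' * t = s * t + 1 / 2"
      proof -
        have "s' * t - s * t = (s' - s) * t" by (simp add: left_diff_distrib)
        moreover have "(s' - s) * t = 1 / 2" using ne unfolding t_def by (simp del: distrib_left_numeral right_diff_distrib_numeral)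
        ultimately show ?thesis by linarith
      qed
      then have "chr s' (line t) = cis (2 * pi * (s * t) + pi)"
        unfolding chr_line[OF s'(1)] by (simp add: algebra_simps)
      then have "chr s' (line t) - chr s (line t) = - 2 * cis (2 * pi * (s * t))"
        unfolding chr_line[OF assms] by (simp add: cis_mult[symmetric])
      then have "cmod (chr s' (line t) - chr s (line t)) = 2" by (simp add: norm_mult)
      moreover have "cmod (chr s' (line t) - chr s (line t)) < 1"
        using that s'(2) line_in[of t] by (auto simp: topspace_\<T>)
      ultimately show False by simp
    qed
    then show ?thesis using s' by simp
  qed
  moreover have "chr s \<in> ?N" using chr_in_dual[OF assms] by simp
  ultimately have "?N = {chr s}" by blast
  moreover have "openin (dual_topology \<Sigma> \<T>) ?N"
    unfolding dual_topology_def
  proof (rule topology_generated_by_Basis, rule CollectI, intro exI conjI)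
    show "compactin \<T> (topspace \<T>)" using compact_space_\<T> by (simp add: compact_space_def)
    show "chr s \<in> carrier \<Sigma>_dual" by (rule chr_in_dual[OF assms])
    show "(0::real) < 1" by simp
  qed (rule refl)
  ultimately show ?thesis by simp
qed

lemma continuous_map_dual: "continuous_map (dual_topology \<Sigma> \<T>) euclidean \<phi>"
proof -
  have "openin (dual_topology \<Sigma> \<T>) {y \<in> carrier \<Sigma>_dual. \<phi> y \<in> U}" for U
  proof -
    have "{y \<in> carrier \<Sigma>_dual. \<phi> y \<in> U} = \<Union> ((\<lambda>s. {chr s}) ` {s \<in> freq. \<phi> (chr s) \<in> U})"
      using chr_in_dual by (auto elim: dual_eq_chr)
    then show ?thesis using openin_dual_singleton by auto
  qed
  then show ?thesis by (simp add: continuous_map_def topspace_dual_topology)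
qed

text \<open>Composition with \<open>b\<close> induces a map \<sigma> on \<open>freq\<close> that
  commutes with integer multiples. Both \<open>s\<close> and 1 are integer multiples of some 1 /
  \<open>radix_prod n\<close>, which forces \<sigma> \<open>s\<close> = \<sigma> 1 *
  \<open>s\<close>.\<close>

lemma endomorphism_dual_multiplier:
  assumes b: "continuous_endomorphism \<Sigma> \<T> b"
  obtains \<beta> where "\<And>s. s \<in> freq \<Longrightarrow> \<beta> * s \<in> freq"
    "\<And>s C. s \<in> freq \<Longrightarrow> C \<in> carrier \<Sigma> \<Longrightarrow> chr s (b C) = chr (\<beta> * s) C"
proof -
  have bhom: "b (C \<otimes>\<^bsub>\<Sigma>\<^esub> D) = b C \<otimes>\<^bsub>\<Sigma>\<^esub> b D" "b C \<in> carrier \<Sigma>" if "C \<in> carrier \<Sigma>" "D \<in> carrier \<Sigma>" for C D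
    using b that by (auto simp: continuous_endomorphism_def hom_def)
  have "\<exists>s'\<in>freq. \<forall>C\<in>carrier \<Sigma>. chr s (b C) = chr s' C" if s: "s \<in> freq" for s
  proof -
    have "continuous_map \<T> euclidean (chr s \<circ> b)"
      using b continuous_chr[OF s] by (auto simp: continuous_endomorphism_def intro: continuous_map_compose)
    then have "continuous_map \<T> euclidean (restrict (chr s \<circ> b) (carrier \<Sigma>))"
      by (rule continuous_map_eq) (simp add: topspace_\<T>)
    then have "restrict (chr s \<circ> b) (carrier \<Sigma>) \<in> carrier \<Sigma>_dual"
      using bhom comm_group_solenoid
      by (auto simp: dual_group_def hom_def circle_group_def chr_mult[OF s] comm_group_def comm_monoid_def monoid.m_closed)
    then obtain s' where "s' \<in> freq" "restrict (chr s \<circ> b) (carrier \<Sigma>) = chr s'" by (rule dual_eq_chr)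
    then show ?thesis by (metis comp_apply restrict_apply')
  qed
  then obtain \<sigma> where \<sigma>: "\<And>s. s \<in> freq \<Longrightarrow> \<sigma> s \<in> freq"
      "\<And>s C. s \<in> freq \<Longrightarrow> C \<in> carrier \<Sigma> \<Longrightarrow> chr s (b C) = chr (\<sigma> s) C" by metis
  have scale: "\<sigma> (of_int k * s) = of_int k * \<sigma> s" if s: "s \<in> freq" for k s
  proof (rule chr_inj)
    show "\<sigma> (of_int k * s) \<in> freq" by (intro \<sigma> freq_of_int_mult s)
    show "of_int k * \<sigma> s \<in> freq" by (intro \<sigma> freq_of_int_mult s)
    show "chr (\<sigma> (of_int k * s)) (line t) = chr (of_int k * \<sigma> s) (line t)" for t
      using \<sigma>(2)[OF freq_of_int_mult[OF s], of "line t" k] \<sigma>(2)[OF s, of "line t"]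
        chr_of_int_mult[OF s bhom(2)[OF line_in line_in], of k t]
        chr_of_int_mult[OF \<sigma>(1)[OF s] line_in, of k t] by simp
  qed
  have lin: "\<sigma> s = \<sigma> 1 * s" if "s \<in> freq" for s
  proof -
    from \<open>s \<in> freq\<close> obtain k n where s: "s = of_int k / of_int (radix_prod n)" by (rule freq_cases)
    let ?q = "1 / real_of_int (radix_prod n)"
    have q: "?q \<in> freq" using level_in_freq[of 1 n] by simp
    have "\<sigma> s = of_int k * \<sigma> ?q" using scale[OF q, of k] s by simp
    moreover have "\<sigma> 1 = of_int (radix_prod n) * \<sigma> ?q" using scale[OF q, of "radix_prod n"] by simp
    ultimately show ?thesis using s by simp
  qed
  show ?thesis
    using \<sigma> by (intro that[of "\<sigma> 1"]) (simp_all only: lin[symmetric])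
qed

text \<open>Triviality of the kernel makes \<open>chr s\<close> trivial on the kernel of some
  \<open>chr (r / radix_prod n)\<close>. The point of the line with parameter
  \<open>radix_prod n / r\<close> lies in that kernel, so \<open>s * radix_prod n / r\<close> is an
  integer, that is, \<open>s / r\<close> is again a frequency. If \<open>r\<close> were 0,
  \<open>line (1/2)\<close> would be neutral, although \<open>chr 1\<close> is -1 there.\<close>

lemma injective_multiplier_surj:
  assumes r: "\<And>s. s \<in> freq \<Longrightarrow> r * s \<in> freq"
    and c: "\<And>C. C \<in> carrier \<Sigma> \<Longrightarrow> c C \<in> carrier \<Sigma>"
    and dual: "\<And>s C. s \<in> freq \<Longrightarrow> C \<in> carrier \<Sigma> \<Longrightarrow> chr s (c C) = chr (r * s) C"
    and ker: "kernel \<Sigma> \<Sigma> c = {\<one>\<^bsub>\<Sigma>\<^esub>}"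
    and s: "s \<in> freq"
  shows "\<exists>s'\<in>freq. r * s' = s"
proof -
  have triv: "C = \<one>\<^bsub>\<Sigma>\<^esub>" if C: "C \<in> carrier \<Sigma>" "\<And>s. s \<in> freq \<Longrightarrow> chr (r * s) C = 1" for C
  proof -
    have "c C = \<one>\<^bsub>\<Sigma>\<^esub>" by (rule chr_eq_1_everywhere[OF c[OF C(1)]]) (simp add: dual C)
    then show ?thesis using ker C(1) by (auto simp: kernel_def)
  qed
  have "r \<noteq> 0"
  proof
    assume "r = 0"
    then have "line (1/2) = \<one>\<^bsub>\<Sigma>\<^esub>" by (intro triv) (auto simp: chr_zero)
    then have "chr 1 (line (1/2)) = 1" by (simp add: chr_one)
    then show False by (simp add: chr_line)
  qed
  obtain n where n: "\<And>C. C \<in> carrier \<Sigma> \<Longrightarrow> chr (r / of_int (radix_prod n)) C = 1 \<Longrightarrow> chr s C = 1"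
    using kernel_level[OF r triv continuous_chr[OF s] chr_mult[OF s] chr_one[OF s]] by blast
  have q: "r / of_int (radix_prod n) \<in> freq" using r[OF level_in_freq[of 1 n]] by simp
  define t where "t = of_int (radix_prod n) / r"
  have "chr (r / of_int (radix_prod n)) (line t) = 1"
    unfolding chr_line[OF q] using \<open>r \<noteq> 0\<close> by (simp add: t_def)
  then have "cis (2 * pi * (s * t)) = cis (2 * pi * 0)" using n[OF line_in] by (simp add: chr_line[OF s])
  then have "s * t - 0 \<in> \<int>" by (rule cis_2pi_eqD)
  then have "s / r \<in> freq" unfolding freq_def t_def by (auto simp: intro!: exI[of _ n])
  then show ?thesis using \<open>r \<noteq> 0\<close> by (intro bexI[of _ "s / r"]) auto
qed

end

section \<open>Multiplicative differences\<close>

definition mdiff :: "'a::ab_group_add \<Rightarrow> ('a \<Rightarrow> complex) \<Rightarrow> 'a \<Rightarrow> complex" where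
  "mdiff k f y = f (y + k) / f y"

text \<open>The equation at \<open>g + g0\<close> is divided by the equation at \<open>g\<close>.
  The form with index \<open>i\<close> does not see \<open>g0\<close>, so its factor cancels, while
  every other factor turns into a difference along the image of \<open>g0\<close>.\<close>

lemma mdiff_eliminate:
  fixes \<Lambda> :: "'i \<Rightarrow> 'g::ab_group_add \<Rightarrow> 'y::ab_group_add"
  assumes J: "finite J" "i \<in> J"
    and G: "\<And>g g'. g \<in> G \<Longrightarrow> g' \<in> G \<Longrightarrow> g + g' \<in> G"
    and add: "\<And>j g g'. \<Lambda> j (g + g') = \<Lambda> j g + \<Lambda> j g'"
    and nz: "\<And>j g. j \<in> J \<Longrightarrow> g \<in> G \<Longrightarrow> f j (\<Lambda> j g) \<noteq> 0"
    and eq: "\<And>g. g \<in> G \<Longrightarrow> (\<Prod>j\<in>J. f j (\<Lambda> j g)) = 1"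
    and g0: "g0 \<in> G" "\<Lambda> i g0 = 0" and g: "g \<in> G"
  shows "(\<Prod>j\<in>J - {i}. mdiff (\<Lambda> j g0) (f j) (\<Lambda> j g)) = 1"
proof -
  have "1 = (\<Prod>j\<in>J. f j (\<Lambda> j (g + g0))) / (\<Prod>j\<in>J. f j (\<Lambda> j g))"
    using eq g g0 G by simp
  also have "\<dots> = (\<Prod>j\<in>J. mdiff (\<Lambda> j g0) (f j) (\<Lambda> j g))"
    by (simp add: mdiff_def add prod_dividef)
  also have "\<dots> = mdiff (\<Lambda> i g0) (f i) (\<Lambda> i g) * (\<Prod>j\<in>J - {i}. mdiff (\<Lambda> j g0) (f j) (\<Lambda> j g))"
    by (rule prod.remove[OF J])
  also have "mdiff (\<Lambda> i g0) (f i) (\<Lambda> i g) = 1"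
    using nz[OF J(2) g] g0(2) by (simp add: mdiff_def)
  finally show ?thesis by simp
qed

text \<open>By \<open>onto\<close>, an element of the kernel of any other form can be given an
  arbitrary value under the form with index \<open>j\<close>. The three eliminations can thus be run
  with prescribed increments \<open>k1\<close>, \<open>k2\<close>, \<open>k3\<close>, and the base
  point \<open>y\<close> is realised in the same way.\<close>

lemma third_mdiff_eq_1:
  fixes \<Lambda> :: "'i \<Rightarrow> 'g::ab_group_add \<Rightarrow> 'y::ab_group_add"
  assumes J: "distinct [j, i1, i2, i3]"
    and G: "\<And>g g'. g \<in> G \<Longrightarrow> g' \<in> G \<Longrightarrow> g + g' \<in> G"
    and add: "\<And>j g g'. \<Lambda> j (g + g') = \<Lambda> j g + \<Lambda> j g'"
    and H: "\<And>l g. l \<in> {j, i1, i2, i3} \<Longrightarrow> g \<in> G \<Longrightarrow> \<Lambda> l g \<in> H"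
    and nz: "\<And>l y. l \<in> {j, i1, i2, i3} \<Longrightarrow> y \<in> H \<Longrightarrow> f l y \<noteq> 0"
    and eq: "\<And>g. g \<in> G \<Longrightarrow> (\<Prod>l\<in>{j, i1, i2, i3}. f l (\<Lambda> l g)) = 1"
    and onto: "\<And>i k. i \<in> {i1, i2, i3} \<Longrightarrow> k \<in> H \<Longrightarrow> \<exists>g\<in>G. \<Lambda> i g = 0 \<and> \<Lambda> j g = k"
    and ky: "k1 \<in> H" "k2 \<in> H" "k3 \<in> H" "y \<in> H"
  shows "mdiff k3 (mdiff k2 (mdiff k1 (f j))) y = 1"
proof -
  obtain g1 g2 g3 g where g: "g1 \<in> G" "\<Lambda> i1 g1 = 0" "\<Lambda> j g1 = k1"
      "g2 \<in> G" "\<Lambda> i2 g2 = 0" "\<Lambda> j g2 = k2" "g3 \<in> G" "\<Lambda> i3 g3 = 0" "\<Lambda> j g3 = k3"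
      "g \<in> G" "\<Lambda> j g = y"
    using onto[of i1 k1] onto[of i2 k2] onto[of i3 k3] onto[of i1 y] ky by auto
  let ?J = "{j, i1, i2, i3}"
  define f1 where "f1 j = mdiff (\<Lambda> j g1) (f j)" for j
  define f2 where "f2 j = mdiff (\<Lambda> j g2) (f1 j)" for j
  have nz0: "f l (\<Lambda> l g) \<noteq> 0" if "l \<in> ?J" "g \<in> G" for l g using that by (intro nz H) auto
  have nz1: "f1 l (\<Lambda> l g) \<noteq> 0" if "l \<in> ?J" "g \<in> G" for l g
    using nz0[OF that] nz0[OF that(1) G[OF that(2) g(1)]] by (simp add: f1_def mdiff_def add)
  have nz2: "f2 l (\<Lambda> l g) \<noteq> 0" if "l \<in> ?J" "g \<in> G" for l g
    using nz1[OF that] nz1[OF that(1) G[OF that(2) g(4)]] by (simp add: f2_def mdiff_def add)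
  have eq1: "(\<Prod>j\<in>?J - {i1}. f1 j (\<Lambda> j g)) = 1" if "g \<in> G" for g
    unfolding f1_def
    by (rule mdiff_eliminate[where J = ?J and i = i1 and f = f and \<Lambda> = \<Lambda>, OF _ _ G add nz0 eq g(1,2) that]) auto
  have eq2: "(\<Prod>j\<in>?J - {i1} - {i2}. f2 j (\<Lambda> j g)) = 1" if "g \<in> G" for g
    unfolding f2_def
    by (rule mdiff_eliminate[where J = "?J - {i1}" and i = i2 and f = f1 and \<Lambda> = \<Lambda>, OF _ _ G add nz1 eq1 g(4,5) that])
      (use J in auto)
  have "(\<Prod>j\<in>?J - {i1} - {i2} - {i3}. mdiff (\<Lambda> j g3) (f2 j) (\<Lambda> j g)) = 1"
    by (rule mdiff_eliminate[where J = "?J - {i1} - {i2}" and i = i3 and f = f2 and \<Lambda> = \<Lambda>, OF _ _ G add nz2 eq2 g(7,8) g(10)])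
      (use J in auto)
  moreover have "?J - {i1} - {i2} - {i3} = {j}" using J by auto
  ultimately show ?thesis by (simp add: f2_def f1_def g)
qed

context adic_base
begin

section \<open>Quadratic exponentials on the frequency group\<close>

lemma freq_cyclic:
  assumes "s \<in> freq" "s' \<in> freq"
  obtains e m n where "e \<in> freq" "s = of_int m * e" "s' = of_int n * e"
proof -
  obtain l where l: "s * of_int (radix_prod l) \<in> \<int>" "s' * of_int (radix_prod l) \<in> \<int>"
    using freq_common_level[OF assms] .
  then obtain m n where "s * of_int (radix_prod l) = of_int m" "s' * of_int (radix_prod l) = of_int n"
    by (metis Ints_cases)
  then show ?thesis
    using level_in_freq[of 1 l] by (intro that[of "1 / of_int (radix_prod l)" m n]) (simp_all add: field_simps)
qed

text \<open>The bicharacter \<open>B k l = h (k + l) / (h k * h l)\<close> satisfies \<open>B e e = (cmod (h e))\<^sup>2 > 0\<close>;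
  since any two frequencies are integer multiples of a common one, \<open>B\<close> is positive everywhere.\<close>

lemma third_mdiff_imp_gaussian:
  assumes nz: "\<And>s. s \<in> freq \<Longrightarrow> h s \<noteq> 0"
    and h0: "h 0 = 1" and herm: "\<And>s. s \<in> freq \<Longrightarrow> h (- s) = cnj (h s)"
    and third: "\<And>k l m. k \<in> freq \<Longrightarrow> l \<in> freq \<Longrightarrow> m \<in> freq \<Longrightarrow> mdiff m (mdiff l (mdiff k h)) 0 = 1"
  shows "\<And>s t. s \<in> freq \<Longrightarrow> t \<in> freq \<Longrightarrow> sgn (h (s + t)) = sgn (h s) * sgn (h t)"
    and "\<And>s. s \<in> freq \<Longrightarrow> cmod (h s) = exp (ln (cmod (h 1)) * s\<^sup>2)"
proof -
  define B where "B k l = h (k + l) / (h k * h l)" for k l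
  have B_sym: "B k l = B l k" for k l by (simp add: B_def add.commute mult.commute)
  have B_nz: "B k l \<noteq> 0" if "k \<in> freq" "l \<in> freq" for k l
    using that nz freq_add by (simp add: B_def)
  have B_add: "B (k + m) l = B k l * B m l" if klm: "k \<in> freq" "l \<in> freq" "m \<in> freq" for k l m
  proof -
    have n: "h k \<noteq> 0" "h l \<noteq> 0" "h m \<noteq> 0" "h (k + l) \<noteq> 0" "h (k + m) \<noteq> 0" "h (l + m) \<noteq> 0" "h (m + l) \<noteq> 0"
      using klm by (auto intro!: nz freq_add)
    \<comment> \<open>The third difference at 0 with denominators cleared, using
      \<open>h 0 = 1\<close>; it states precisely that \<open>B\<close> is multiplicative in its
      first argument.\<close>
    have "h (k + l + m) * h k * h l * h m = h (k + l) * h (k + m) * h (l + m)"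
      using third[OF klm] n h0 by (simp add: mdiff_def field_simps)
    then show ?thesis
      using n by (simp add: B_def field_simps)
  qed
  have B_0: "B 0 l = 1" if "l \<in> freq" for l using nz[OF that] h0 by (simp add: B_def)
  have B_nat: "B (of_nat n * k) l = B k l ^ n" if "k \<in> freq" "l \<in> freq" for n k l
  proof (induction n)
    case 0 show ?case using B_0 that by simp
  next
    case (Suc n)
    have "of_nat n * k \<in> freq" using freq_of_int_mult[OF that(1), of "int n"] by simp
    from B_add[OF that this] show ?case using Suc by (simp add: distrib_right)
  qed
  have B_minus: "B (- k) l = inverse (B k l)" if "k \<in> freq" "l \<in> freq" for k l
    using B_add[OF that freq_minus[OF that(1)]] B_0[OF that(2)] by (simp add: inverse_unique)
  have B_int: "B (of_int n * k) l = B k l powi n" if "k \<in> freq" "l \<in> freq" for n k l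
  proof (cases "n \<ge> 0")
    case True then show ?thesis using B_nat[OF that, of "nat n"] by (simp add: power_int_def)
  next
    case False
    have "B (of_int n * k) l = inverse (B (of_int (- n) * k) l)"
      using B_minus[OF freq_of_int_mult[OF that(1)] that(2), of "- n"] by simp
    then show ?thesis using False B_nat[OF that, of "nat (- n)"] by (simp add: power_int_def power_inverse)
  qed
  have B_diag: "B e e = of_real ((cmod (h e))\<^sup>2)" if e: "e \<in> freq" for e
  proof -
    \<comment> \<open>Hermitian symmetry enters here: \<open>B (- e) e\<close> =
      \<open>h 0 / (h (- e) * h e)\<close> is the reciprocal of |h e|^2.\<close>
    have "inverse (B e e) = B (- e) e" using B_minus[OF e e] by simp
    also have "\<dots> = inverse (h e * cnj (h e))" using h0 herm[OF e] by (simp add: B_def field_simps)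
    finally have "B e e = h e * cnj (h e)" by (simp only: inverse_eq_iff_eq)
    then show ?thesis by (simp only: complex_norm_square)
  qed
  have B_mult: "B (of_int m * e) (of_int n * e) = of_real (((cmod (h e))\<^sup>2) powi (n * m))" if e: "e \<in> freq" for m n e
  proof -
    have "B (of_int m * e) (of_int n * e) = (B e e powi n) powi m"
      using B_int[OF e freq_of_int_mult[OF e]] B_int[OF e e] B_sym by metis
    then show ?thesis by (simp add: B_diag[OF e] power_int_mult of_real_power_int)
  qed
  show "sgn (h (s + t)) = sgn (h s) * sgn (h t)" if st: "s \<in> freq" "t \<in> freq" for s t
  proof -
    obtain e m n where e: "e \<in> freq" "s = of_int m * e" "t = of_int n * e" using freq_cyclic[OF st] .
    define \<rho> where "\<rho> = ((cmod (h e))\<^sup>2) powi (n * m)"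
    have "\<rho> > 0" unfolding \<rho>_def using nz[OF e(1)] by simp
    have "B s t = of_real \<rho>" unfolding e \<rho>_def by (rule B_mult[OF e(1)])
    then have "h (s + t) = h s * h t * of_real \<rho>" using nz st by (simp add: B_def field_simps)
    then show ?thesis using \<open>\<rho> > 0\<close> by (simp add: sgn_mult sgn_of_real)
  qed
  have ln_mult: "ln (cmod (h (of_int m * e))) = (of_int m)\<^sup>2 * ln (cmod (h e))" if e: "e \<in> freq" for m e
  proof -
    have ln_powi: "ln (x powi k) = of_int k * ln x" if "x > 0" for x :: real and k
      using that by (simp add: powr_real_of_int'[symmetric] ln_powr)
    have me: "of_int m * e \<in> freq" by (rule freq_of_int_mult[OF e])
    have "complex_of_real ((cmod (h (of_int m * e)))\<^sup>2) = of_real (((cmod (h e))\<^sup>2) powi (m * m))"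
      using B_mult[OF e, of m m] B_diag[OF me] by simp
    then have "(cmod (h (of_int m * e)))\<^sup>2 = ((cmod (h e))\<^sup>2) powi (m * m)" by (simp only: of_real_eq_iff)
    then have "ln ((cmod (h (of_int m * e)))\<^sup>2) = of_int (m * m) * ln ((cmod (h e))\<^sup>2)"
      using nz[OF e] by (simp add: ln_powi)
    then have "2 * ln (cmod (h (of_int m * e))) = of_int (m * m) * (2 * ln (cmod (h e)))"
      using nz[OF e] nz[OF me] by (simp add: ln_realpow)
    then show ?thesis by (simp add: power2_eq_square)
  qed
  show "cmod (h s) = exp (ln (cmod (h 1)) * s\<^sup>2)" if s: "s \<in> freq" for s
  proof -
    \<comment> \<open>The exponent is normalised at frequency 1, so \<open>s\<close> and 1 are
      written over one \<open>e\<close>. From n e = 1 follows n^2 s^2 = m^2, which matches the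
      logarithms n^2 ln |h e| at 1 and m^2 ln |h e| at \<open>s\<close>.\<close>
    obtain e m n where e: "e \<in> freq" "s = of_int m * e" "1 = of_int n * e" using freq_cyclic[OF s freq_one] .
    have "(of_int n)\<^sup>2 * e\<^sup>2 = 1" using e(3) by (metis one_power2 power_mult_distrib)
    moreover have "ln (cmod (h 1)) = (of_int n)\<^sup>2 * ln (cmod (h e))" using ln_mult[OF e(1), of n] e(3) by simp
    ultimately have "ln (cmod (h 1)) * s\<^sup>2 = (of_int m)\<^sup>2 * ln (cmod (h e))"
      unfolding e(2) power_mult_distrib by (metis mult.assoc mult.commute mult.right_neutral)
    then have "ln (cmod (h 1)) * s\<^sup>2 = ln (cmod (h s))" using ln_mult[OF e(1), of m] e(2) by simp
    then show ?thesis using nz[OF s] by simp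
  qed
qed

end

section \<open>Fourier coefficients on the circle\<close>

text \<open>Trigonometric polynomials of the circle, kept as functions on the whole plane so that
  they can be integrated against measures on the complex numbers.\<close>

inductive_set laurent_sums :: "(complex \<Rightarrow> complex) set" where
  monomial: "(\<lambda>z. c * z powi k) \<in> laurent_sums"
| add: "f \<in> laurent_sums \<Longrightarrow> g \<in> laurent_sums \<Longrightarrow> (\<lambda>z. f z + g z) \<in> laurent_sums"

text \<open>Exponents do not add at the origin: \<open>0 powi 0\<close> is 1, whereas
  \<open>0 powi 1 * 0 powi -1\<close> is 0. The product therefore agrees with a Laurent sum only off
  0, which is enough on the circle.\<close>

lemma laurent_sums_mult:
  assumes "f \<in> laurent_sums" "g \<in> laurent_sums"
  shows "\<exists>p\<in>laurent_sums. \<forall>z. z \<noteq> 0 \<longrightarrow> p z = f z * g z"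
  using assms
proof (induction f rule: laurent_sums.induct)
  case (monomial c k)
  from monomial show ?case
  proof (induction g rule: laurent_sums.induct)
    case (monomial d l)
    show ?case
      by (rule bexI[OF _ laurent_sums.monomial[of "c * d" "k + l"]]) (simp add: power_int_add)
  next
    case (add f g)
    then obtain p q where "p \<in> laurent_sums" "q \<in> laurent_sums" "\<forall>z. z \<noteq> 0 \<longrightarrow> p z = c * z powi k * f z"
      "\<forall>z. z \<noteq> 0 \<longrightarrow> q z = c * z powi k * g z" by blast
    then show ?case by (intro bexI[of _ "\<lambda>z. p z + q z"]) (auto intro: laurent_sums.add simp: distrib_left)
  qed
next
  case (add f h)
  then obtain p q where "p \<in> laurent_sums" "q \<in> laurent_sums" "\<forall>z. z \<noteq> 0 \<longrightarrow> p z = f z * g z"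
    "\<forall>z. z \<noteq> 0 \<longrightarrow> q z = h z * g z" by blast
  then show ?case by (intro bexI[of _ "\<lambda>z. p z + q z"]) (auto intro: laurent_sums.add simp: distrib_right)
qed

lemma laurent_sums_continuous: "f \<in> laurent_sums \<Longrightarrow> continuous_on (sphere 0 1) f"
  by (induction rule: laurent_sums.induct) (auto intro!: continuous_intros)

lemma borel_measurable_power_int [measurable]:
  "(\<lambda>z :: complex. z powi k) \<in> borel_measurable borel"
  unfolding power_int_def by measurable

lemma laurent_sums_measurable: "f \<in> laurent_sums \<Longrightarrow> f \<in> borel_measurable borel"
  by (induction rule: laurent_sums.induct) measurable

text \<open>Stone-Weierstrass for the real algebra \<open>R\<close> of functions that coincide on
  the circle with a Laurent sum. There the inverse of z is its conjugate, so \<open>Re\<close> and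
  \<open>Im\<close> belong to \<open>R\<close>, and they separate points.\<close>

lemma laurent_sums_dense:
  assumes f: "continuous_on (sphere 0 1) f" and e: "e > 0"
  obtains p where "p \<in> laurent_sums" "\<And>z. z \<in> sphere 0 1 \<Longrightarrow> \<bar>f z - Re (p z)\<bar> < e"
proof -
  define R where "R = {g :: complex \<Rightarrow> real. \<exists>p\<in>laurent_sums. \<forall>z\<in>sphere 0 1. of_real (g z) = p z}"
  have RI: "g \<in> R" if "p \<in> laurent_sums" "\<And>z. cmod z = 1 \<Longrightarrow> of_real (g z) = p z" for g p
    unfolding R_def using that by (intro CollectI bexI[of _ p]) auto
  have RE: "\<exists>p\<in>laurent_sums. \<forall>z. cmod z = 1 \<longrightarrow> of_real (g z) = p z" if "g \<in> R" for g
    using that by (auto simp: R_def)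
  interpret function_ring_on R "sphere 0 1"
  proof
    show "compact (sphere 0 1 :: complex set)" by simp
    show "continuous_on (sphere 0 1) g" if g: "g \<in> R" for g
    proof -
      obtain p where p: "p \<in> laurent_sums" "\<forall>z. cmod z = 1 \<longrightarrow> of_real (g z) = p z" using RE[OF g] by blast
      have "continuous_on (sphere 0 1) (\<lambda>z. Re (p z))"
        by (intro continuous_intros laurent_sums_continuous p)
      moreover have "g z = Re (p z)" if "z \<in> sphere 0 1" for z
      proof -
        have "of_real (g z) = p z" using p(2) that by simp
        then show ?thesis by (metis Re_complex_of_real)
      qed
      ultimately show ?thesis using continuous_on_cong[of "sphere 0 1" "sphere 0 1" g "\<lambda>z. Re (p z)"] by blast
    qed
    show "(\<lambda>z. f z + g z) \<in> R" if fg: "f \<in> R" "g \<in> R" for f g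
    proof -
      obtain p q where "p \<in> laurent_sums" "q \<in> laurent_sums" "\<forall>z. cmod z = 1 \<longrightarrow> of_real (f z) = p z"
        "\<forall>z. cmod z = 1 \<longrightarrow> of_real (g z) = q z" using RE[OF fg(1)] RE[OF fg(2)] by blast
      then show ?thesis by (intro RI[OF laurent_sums.add, of p q]) auto
    qed
    show "(\<lambda>z. f z * g z) \<in> R" if fg: "f \<in> R" "g \<in> R" for f g
    proof -
      obtain p q where pq: "p \<in> laurent_sums" "q \<in> laurent_sums" "\<forall>z. cmod z = 1 \<longrightarrow> of_real (f z) = p z"
        "\<forall>z. cmod z = 1 \<longrightarrow> of_real (g z) = q z" using RE[OF fg(1)] RE[OF fg(2)] by blast
      then obtain r where r: "r \<in> laurent_sums" "\<And>z. z \<noteq> 0 \<Longrightarrow> r z = p z * q z" using laurent_sums_mult by blast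
      show ?thesis
      proof (rule RI[OF r(1)])
        fix z :: complex assume "cmod z = 1"
        moreover from this have "z \<noteq> 0" by auto
        ultimately show "of_real (f z * g z) = r z" using pq r(2) by simp
      qed
    qed
    show "(\<lambda>_. c) \<in> R" for c
      by (rule RI[OF laurent_sums.monomial[of "of_real c" 0]]) simp
    have conj: "inverse z = cnj z" if "cmod z = 1" for z
      using complex_norm_square[of z] that by (intro inverse_unique) simp
    have re: "Re \<in> R"
    proof (rule RI[OF laurent_sums.add[OF laurent_sums.monomial[of "1/2" 1] laurent_sums.monomial[of "1/2" "-1"]]])
      show "of_real (Re z) = 1 / 2 * z powi 1 + 1 / 2 * z powi -1" if "cmod z = 1" for z
        by (simp add: power_int_minus conj[OF that] complex_eq_iff)
    qed
    have im: "Im \<in> R"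
    proof (rule RI[OF laurent_sums.add[OF laurent_sums.monomial[of "-\<i>/2" 1] laurent_sums.monomial[of "\<i>/2" "-1"]]])
      show "of_real (Im z) = -\<i> / 2 * z powi 1 + \<i> / 2 * z powi -1" if "cmod z = 1" for z
        by (simp add: power_int_minus conj[OF that] complex_eq_iff)
    qed
    show "\<exists>f\<in>R. f x \<noteq> f y" if "x \<in> sphere 0 1" "y \<in> sphere 0 1" "x \<noteq> y" for x y
      using re im that(3) complex_eq_iff by blast
  qed
  obtain g where g: "g \<in> R" "\<And>z. z \<in> sphere 0 1 \<Longrightarrow> \<bar>f z - g z\<bar> < e"
    using Stone_Weierstrass_basic[OF f e] by blast
  obtain p where p: "p \<in> laurent_sums" "\<forall>z. cmod z = 1 \<longrightarrow> of_real (g z) = p z" using RE[OF g(1)] by blast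
  have "Re (p z) = g z" if "cmod z = 1" for z using p(2) that by (metis Re_complex_of_real)
  then show ?thesis using g(2) p by (intro that[of p]) auto
qed

text \<open>Equal Fourier coefficients give equal integrals of Laurent sums, by density of bounded
  continuous functions, and by monotone approximation of indicators equal masses of open sets.
  Approximation on the circle suffices because both measures are concentrated there.\<close>

lemma circle_measure_eqI:
  fixes M N :: "complex measure"
  assumes M: "prob_space M" "sets M = sets borel" "AE z in M. cmod z = 1"
    and N: "prob_space N" "sets N = sets borel" "AE z in N. cmod z = 1"
    and eq: "\<And>k. (\<integral>z. z powi k \<partial>M) = (\<integral>z. z powi k \<partial>N)"
  shows "M = N"
proof -
  interpret M: prob_space M by fact
  interpret N: prob_space N by fact
  note [measurable_cong] = M(2) N(2)
  have Mint: "integrable M g" and Nint: "integrable N g"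
    if "g \<in> borel_measurable borel" "\<And>z. cmod z = 1 \<Longrightarrow> norm (g z) \<le> c" for g :: "complex \<Rightarrow> 'b::{banach, second_countable_topology}" and c
  proof -
    show "integrable M g"
      by (rule M.integrable_const_bound[of _ c]) (use that M(3) in \<open>auto cong: measurable_cong_sets\<close>)
    show "integrable N g"
      by (rule N.integrable_const_bound[of _ c]) (use that N(3) in \<open>auto cong: measurable_cong_sets\<close>)
  qed
  have laurent_bound: "\<exists>c. \<forall>z. cmod z = 1 \<longrightarrow> norm (p z) \<le> c" if "p \<in> laurent_sums" for p
  proof -
    have "bounded (p ` sphere 0 1)"
      by (intro compact_imp_bounded compact_continuous_image laurent_sums_continuous that) auto
    then obtain c where "\<forall>z\<in>sphere 0 1. norm (p z) \<le> c" unfolding bounded_iff by blast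
    then show ?thesis by (intro exI[of _ c]) auto
  qed
  have int: "integrable M p \<and> integrable N p" if p: "p \<in> laurent_sums" for p
    using laurent_bound[OF p] Mint[OF laurent_sums_measurable[OF p]] Nint[OF laurent_sums_measurable[OF p]] by metis
  have laurent: "(\<integral>z. p z \<partial>M) = (\<integral>z. p z \<partial>N)" if "p \<in> laurent_sums" for p
    using that
  proof (induction rule: laurent_sums.induct)
    case (monomial c k) then show ?case by (simp add: eq)
  next
    case (add f g) then show ?case using int by simp
  qed
  have cont: "(\<integral>z. f z \<partial>M) = (\<integral>z. f z \<partial>N)"
    if f: "continuous_on UNIV f" "\<And>z. \<bar>f z\<bar> \<le> 1" for f :: "complex \<Rightarrow> real"
  proof (rule ccontr)
    assume ne: "(\<integral>z. f z \<partial>M) \<noteq> (\<integral>z. f z \<partial>N)"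
    \<comment> \<open>A third of the supposed gap: the two approximation errors together account for
      at most 2 e of the 3 e.\<close>
    define e where "e = \<bar>(\<integral>z. f z \<partial>M) - (\<integral>z. f z \<partial>N)\<bar> / 3"
    have "e > 0" using ne by (simp add: e_def)
    then obtain p where p: "p \<in> laurent_sums" "\<And>z. z \<in> sphere 0 1 \<Longrightarrow> \<bar>f z - Re (p z)\<bar> < e"
      using laurent_sums_dense[OF continuous_on_subset[OF f(1) subset_UNIV]] by metis
    have fm: "f \<in> borel_measurable borel" using f(1) by (rule borel_measurable_continuous_onI)
    have fi: "integrable M f" "integrable N f" using Mint[OF fm] Nint[OF fm] f(2) by auto
    have "\<bar>(\<integral>z. f z \<partial>M) - (\<integral>z. Re (p z) \<partial>M)\<bar> \<le> (\<integral>z. e \<partial>M)"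
    proof -
      have "norm (\<integral>z. f z - Re (p z) \<partial>M) \<le> (\<integral>z. norm (f z - Re (p z)) \<partial>M)"
        by (rule integral_norm_bound)
      also have "\<dots> \<le> (\<integral>z. e \<partial>M)"
        by (rule integral_mono_AE) (use fi int[OF p(1)] M(3) p(2) in \<open>auto intro: less_imp_le\<close>)
      finally have "norm (\<integral>z. f z - Re (p z) \<partial>M) \<le> (\<integral>z. e \<partial>M)" .
      then show ?thesis using fi int[OF p(1)] by simp
    qed
    moreover have "\<bar>(\<integral>z. f z \<partial>N) - (\<integral>z. Re (p z) \<partial>N)\<bar> \<le> (\<integral>z. e \<partial>N)"
    proof -
      have "norm (\<integral>z. f z - Re (p z) \<partial>N) \<le> (\<integral>z. norm (f z - Re (p z)) \<partial>N)"
        by (rule integral_norm_bound)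
      also have "\<dots> \<le> (\<integral>z. e \<partial>N)"
        by (rule integral_mono_AE) (use fi int[OF p(1)] N(3) p(2) in \<open>auto intro: less_imp_le\<close>)
      finally have "norm (\<integral>z. f z - Re (p z) \<partial>N) \<le> (\<integral>z. e \<partial>N)" .
      then show ?thesis using fi int[OF p(1)] by simp
    qed
    moreover have "(\<integral>z. Re (p z) \<partial>M) = (\<integral>z. Re (p z) \<partial>N)"
      using laurent[OF p(1)] int[OF p(1)] by simp
    ultimately have "\<bar>(\<integral>z. f z \<partial>M) - (\<integral>z. f z \<partial>N)\<bar> \<le> 2 * e" by (simp add: M.prob_space N.prob_space)
    then show False using \<open>e > 0\<close> by (simp add: e_def)
  qed
  have open_eq: "emeasure M U = emeasure N U" if U: "open U" for U
  \<comment> \<open>The distance to the empty set is 0 by convention, so the approximating functions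
    \<open>f k\<close> would vanish if \<open>U\<close> were the whole plane.\<close>
  proof (cases "U = UNIV")
    case True
    have "space M = UNIV" "space N = UNIV" using sets_eq_imp_space_eq[OF M(2)] sets_eq_imp_space_eq[OF N(2)] by auto
    then show ?thesis using True M.emeasure_space_1 N.emeasure_space_1 by simp
  next
    case False
    define f where "f k z = min 1 (real k * infdist z (- U))" for k z
    have fc: "continuous_on UNIV (f k)" for k unfolding f_def by (intro continuous_intros)
    have fb: "\<bar>f k z\<bar> \<le> 1" for k z by (simp add: f_def infdist_nonneg)
    have lim: "(\<lambda>k. f k z) \<longlonglongrightarrow> indicator U z" for z
    proof (cases "z \<in> U")
      case True
      have "infdist z (- U) > 0" using U False True
        by (intro infdist_pos_not_in_closed) auto
      then obtain K where K: "1 < real K * infdist z (- U)" using reals_Archimedean3 by blast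
      have "\<forall>\<^sub>F k in sequentially. f k z = 1"
        using eventually_ge_at_top[of K]
      proof eventually_elim
        case (elim k)
        then have "real K * infdist z (- U) \<le> real k * infdist z (- U)"
          by (intro mult_right_mono) (auto simp: infdist_nonneg)
        then show ?case using K by (simp add: f_def)
      qed
      then show ?thesis using True by (simp add: tendsto_eventually)
    next
      case False then show ?thesis by (simp add: f_def)
    qed
    have fm [measurable]: "f k \<in> borel_measurable borel" for k using fc by (rule borel_measurable_continuous_onI)
    have [measurable]: "U \<in> sets borel" using U by simp
    have "(\<lambda>k. \<integral>z. f k z \<partial>M) \<longlonglongrightarrow> (\<integral>z. indicator U z \<partial>M)"
      by (rule integral_dominated_convergence[where w = "\<lambda>_. 1"]) (use lim fb in auto)
    moreover have "(\<lambda>k. \<integral>z. f k z \<partial>N) \<longlonglongrightarrow> (\<integral>z. indicator U z \<partial>N)"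
      by (rule integral_dominated_convergence[where w = "\<lambda>_. 1"]) (use lim fb in auto)
    moreover have "(\<integral>z. f k z \<partial>M) = (\<integral>z. f k z \<partial>N)" for k by (rule cont[OF fc fb])
    ultimately have "(\<integral>z. indicator U z \<partial>M) = (\<integral>z. indicator U z \<partial>N :: real)"
      using LIMSEQ_unique by auto
    then have "measure M U = measure N U"
      using sets.sets_into_space[of U M] sets.sets_into_space[of U N] by (simp add: Int_absorb2)
    then show ?thesis by (simp add: M.emeasure_eq_measure N.emeasure_eq_measure)
  qed
  show ?thesis
  proof (rule measure_eqI_generator_eq[where E = "{S. open S}" and \<Omega> = UNIV and A = "\<lambda>_. UNIV"])
    show "Int_stable {S :: complex set. open S}" by (auto simp: Int_stable_def)
    show "sets M = sigma_sets UNIV {S. open S}" "sets N = sigma_sets UNIV {S. open S}"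
      using M(2) N(2) by (simp_all add: sets_borel)
  qed (use open_eq in auto)
qed

section \<open>Measures on the solenoid\<close>

context adic_base
begin

section \<open>Borel sets of the solenoid and uniqueness of measures\<close>

abbreviation level :: "nat \<Rightarrow> real" where
  "level n \<equiv> 1 / real_of_int (radix_prod n)"

abbreviation "\<B> \<equiv> borel_of \<T>"

text \<open>Each set depends on a single level. As lower level characters are powers of higher ones,
  two such conditions merge into one, so these sets form an intersection-stable generator.\<close>

definition cylinders :: "(real \<times> (nat \<Rightarrow> int)) set set set" where
  "cylinders = {{C \<in> carrier \<Sigma>. chr (level n) C \<in> V} |n V. open V}"

lemma level_freq: "level n \<in> freq"
  using level_in_freq[of 1 n] by simp

lemma chr_level_mono:
  assumes "n \<le> m"
  obtains j :: nat where "\<And>C. C \<in> carrier \<Sigma> \<Longrightarrow> chr (level n) C = chr (level m) C ^ j"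
proof -
  obtain d where d: "radix_prod m = radix_prod n * d" using radix_prod_dvd[OF assms] by blast
  have "0 < d" using d radix_prod_pos[of n] radix_prod_pos[of m] by (metis zero_less_mult_pos)
  then have eq: "level n = of_int (int (nat d)) * level m"
    using d by simp
  show ?thesis
  proof (rule that[of "nat d"])
    fix C assume C: "C \<in> carrier \<Sigma>"
    show "chr (level n) C = chr (level m) C ^ nat d"
      by (simp only: eq chr_of_int_mult[OF level_freq C] power_int_of_nat)
  qed
qed

text \<open>For \<open>x\<close> in \<open>U\<close> the fibres of the level characters through
  \<open>x\<close> shrink to \<open>x\<close>, so one of them lies in \<open>U\<close>. The image of
  the complement of \<open>U\<close> at that level is compact and misses the value at
  \<open>x\<close>; its complement cuts out a cylinder around \<open>x\<close> inside
  \<open>U\<close>. Taking for each \<open>n\<close> the largest possible open set keeps the union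
  countable.\<close>

lemma openin_Union_cylinders:
  assumes U: "openin \<T> U"
  obtains V where "\<And>n::nat. open (V n)" "U = (\<Union>n. {C \<in> carrier \<Sigma>. chr (level n) C \<in> V n})"
proof -
  define V where "V n = \<Union>{W. open W \<and> {C \<in> carrier \<Sigma>. chr (level n) C \<in> W} \<subseteq> U}" for n
  have "U \<subseteq> (\<Union>n. {C \<in> carrier \<Sigma>. chr (level n) C \<in> V n})"
  proof
    fix x assume x: "x \<in> U"
    have xX: "x \<in> carrier \<Sigma>" using U x openin_subset topspace_\<T> by blast
    have "\<exists>n. \<forall>z\<in>carrier \<Sigma>. chr (level n) z = chr (level n) x \<longrightarrow> z \<in> U"
    proof (rule level_sets_in_open)
      show "continuous_map \<T> euclidean (chr (level n))" for n by (rule continuous_chr[OF level_freq])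
      show "openin \<T> U" by fact
      show "chr (level n) z = chr (level n) x" if "z \<in> carrier \<Sigma>" "chr (level (Suc n)) z = chr (level (Suc n)) x" for n z
        using that chr_level_mono[of n "Suc n"] xX by (metis le_add2 plus_1_eq_Suc)
      show "z \<in> U" if "z \<in> carrier \<Sigma>" "\<forall>n. chr (level n) z = chr (level n) x" for z
        using chr_separates[OF that(1) xX] that(2) x by simp
    qed
    then obtain n where n: "\<And>z. z \<in> carrier \<Sigma> \<Longrightarrow> chr (level n) z = chr (level n) x \<Longrightarrow> z \<in> U" by blast
    let ?W = "- chr (level n) ` (topspace \<T> - U)"
    have "compactin \<T> (topspace \<T> - U)"
      using compact_space_\<T> U by (intro closedin_compact_space) auto
    then have "compact (chr (level n) ` (topspace \<T> - U))"
      using image_compactin[OF _ continuous_chr[OF level_freq]] by simp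
    then have "open ?W" by (simp add: compact_imp_closed open_Compl)
    moreover have "{C \<in> carrier \<Sigma>. chr (level n) C \<in> ?W} \<subseteq> U" by (auto simp: topspace_\<T>)
    moreover have "chr (level n) x \<in> ?W" using n by (fastforce simp: topspace_\<T>)
    ultimately have "chr (level n) x \<in> V n" unfolding V_def by blast
    then show "x \<in> (\<Union>n. {C \<in> carrier \<Sigma>. chr (level n) C \<in> V n})" using xX by blast
  qed
  moreover have "(\<Union>n. {C \<in> carrier \<Sigma>. chr (level n) C \<in> V n}) \<subseteq> U" by (auto simp: V_def)
  moreover have "open (V n)" for n unfolding V_def by blast
  ultimately show ?thesis using that by blast
qed

lemma cylinders_Pow: "cylinders \<subseteq> Pow (carrier \<Sigma>)"
  by (auto simp: cylinders_def)

lemma sets_\<B>: "sets \<B> = sigma_sets (carrier \<Sigma>) cylinders"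
proof -
  have "sets \<B> = sigma_sets (carrier \<Sigma>) {U. openin \<T> U}"
    unfolding borel_of_def topspace_\<T>
    by (rule sets_measure_of) (metis CollectD PowI openin_subset subsetI topspace_\<T>)
  also have "\<dots> = sigma_sets (carrier \<Sigma>) cylinders"
  proof (rule sigma_sets_eqI)
    fix U assume "U \<in> {U. openin \<T> U}"
    then obtain V where V: "\<And>n::nat. open (V n)" "U = (\<Union>n. {C \<in> carrier \<Sigma>. chr (level n) C \<in> V n})"
      using openin_Union_cylinders by blast
    have "{C \<in> carrier \<Sigma>. chr (level n) C \<in> V n} \<in> sigma_sets (carrier \<Sigma>) cylinders" for n
      using V(1) by (intro sigma_sets.Basic) (auto simp: cylinders_def)
    then show "U \<in> sigma_sets (carrier \<Sigma>) cylinders" unfolding V(2) by (rule sigma_sets.Union)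
  next
    fix U assume "U \<in> cylinders"
    then obtain n V where V: "open V" "U = {C \<in> topspace \<T>. chr (level n) C \<in> V}"
      by (auto simp: cylinders_def topspace_\<T>)
    have "openin \<T> U" unfolding V(2)
      by (rule openin_continuous_map_preimage[OF continuous_chr[OF level_freq]]) (simp add: V(1))
    then show "U \<in> sigma_sets (carrier \<Sigma>) {U. openin \<T> U}" by (intro sigma_sets.Basic) simp
  qed
  finally show ?thesis .
qed

lemma space_\<B>: "space \<B> = carrier \<Sigma>"
  by (simp add: topspace_\<T>)

lemma chr_measurable [measurable]:
  assumes "s \<in> freq"
  shows "chr s \<in> borel_measurable \<B>"
proof (rule borel_measurableI)
  fix S :: "complex set" assume "open S"
  then have "openin \<T> {C \<in> topspace \<T>. chr s C \<in> S}"
    by (intro openin_continuous_map_preimage[OF continuous_chr[OF assms]]) simp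
  then have "{C \<in> topspace \<T>. chr s C \<in> S} \<in> sets \<B>"
    unfolding borel_of_def by (intro in_measure_of) (auto dest: openin_subset)
  also have "{C \<in> topspace \<T>. chr s C \<in> S} = chr s -` S \<inter> space \<B>" by auto
  finally show "chr s -` S \<inter> space \<B> \<in> sets \<B>" .
qed

text \<open>Since cylinders generate the Borel sets, measurability is tested on complex-valued
  functions. Sums of random variables, their images under the endomorphisms and the map
  \<open>line\<close> are all handled through the algebra of characters in this way.\<close>

lemma measurable_into_\<B>:
  assumes f: "\<And>\<omega>. \<omega> \<in> space M \<Longrightarrow> f \<omega> \<in> carrier \<Sigma>"
    and m: "\<And>s. s \<in> freq \<Longrightarrow> (\<lambda>\<omega>. chr s (f \<omega>)) \<in> borel_measurable M"
  shows "f \<in> measurable M \<B>"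
proof (rule measurable_sigma_sets[OF sets_\<B> cylinders_Pow])
  show "f \<in> space M \<rightarrow> carrier \<Sigma>" using f by auto
  fix A assume "A \<in> cylinders"
  then obtain n V where V: "open V" "A = {C \<in> carrier \<Sigma>. chr (level n) C \<in> V}" by (auto simp: cylinders_def)
  have "f -` A \<inter> space M = (\<lambda>\<omega>. chr (level n) (f \<omega>)) -` V \<inter> space M" using f by (auto simp: V)
  then show "f -` A \<inter> space M \<in> sets M"
    using measurable_sets[OF m[OF level_freq], of V n] V(1) by simp
qed

text \<open>The characteristic function at \<open>k * level n\<close> is the Fourier coefficient
  with index \<open>k\<close> of the image measure under \<open>chr (level n)\<close>. The image
  measures on the circle thus agree at every level, which is agreement on cylinders.\<close>

lemma measure_eq_charfun:
  assumes \<mu>: "prob_space \<mu>" "sets \<mu> = sets \<B>" and \<nu>: "prob_space \<nu>" "sets \<nu> = sets \<B>"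
    and eq: "\<And>s. s \<in> freq \<Longrightarrow> charfun \<mu> (chr s) = charfun \<nu> (chr s)"
  shows "\<mu> = \<nu>"
proof -
  have sp: "space \<mu> = carrier \<Sigma>" "space \<nu> = carrier \<Sigma>"
    using sets_eq_imp_space_eq[OF \<mu>(2)] sets_eq_imp_space_eq[OF \<nu>(2)] space_\<B> by auto
  have meas: "chr s \<in> borel_measurable \<mu>" "chr s \<in> borel_measurable \<nu>" if "s \<in> freq" for s
    using chr_measurable[OF that] \<mu>(2) \<nu>(2) by (simp_all cong: measurable_cong_sets)
  have d: "distr \<mu> borel (chr (level n)) = distr \<nu> borel (chr (level n))" for n
  proof (rule circle_measure_eqI)
    show "prob_space (distr \<mu> borel (chr (level n)))" "prob_space (distr \<nu> borel (chr (level n)))"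
      using \<mu>(1) \<nu>(1) meas[OF level_freq] by (auto intro: prob_space.prob_space_distr)
    show "AE z in distr \<mu> borel (chr (level n)). cmod z = 1" "AE z in distr \<nu> borel (chr (level n)). cmod z = 1"
      using meas[OF level_freq[of n]] by (auto simp: AE_distr_iff sp)
    fix k
    have kf: "of_int k * level n \<in> freq" by (rule freq_of_int_mult[OF level_freq])
    have "(\<integral>z. z powi k \<partial>distr \<mu> borel (chr (level n))) = (\<integral>C. chr (level n) C powi k \<partial>\<mu>)"
      by (rule integral_distr) (use meas[OF level_freq[of n]] in measurable)
    also have "\<dots> = charfun \<mu> (chr (of_int k * level n))"
      unfolding charfun_def by (rule Bochner_Integration.integral_cong) (simp_all only: sp chr_of_int_mult[OF level_freq])
    also have "\<dots> = charfun \<nu> (chr (of_int k * level n))" by (rule eq[OF kf])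
    also have "\<dots> = (\<integral>C. chr (level n) C powi k \<partial>\<nu>)"
      unfolding charfun_def by (rule Bochner_Integration.integral_cong) (simp_all only: sp chr_of_int_mult[OF level_freq])
    also have "\<dots> = (\<integral>z. z powi k \<partial>distr \<nu> borel (chr (level n)))"
      by (rule integral_distr[symmetric]) (use meas[OF level_freq[of n]] in measurable)
    finally show "(\<integral>z. z powi k \<partial>distr \<mu> borel (chr (level n))) = (\<integral>z. z powi k \<partial>distr \<nu> borel (chr (level n)))" .
  qed simp_all
  show ?thesis
  proof (rule measure_eqI_generator_eq[where E = cylinders and \<Omega> = "carrier \<Sigma>" and A = "\<lambda>_. carrier \<Sigma>"])
    show "Int_stable cylinders"
    proof (rule Int_stableI)
      have wlog: "{C \<in> carrier \<Sigma>. chr (level n) C \<in> V} \<inter> {C \<in> carrier \<Sigma>. chr (level m) C \<in> W} \<in> cylinders"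
        if nm: "n \<le> m" and op: "open V" "open W" for n m V W
      proof -
        obtain j where j: "\<And>C. C \<in> carrier \<Sigma> \<Longrightarrow> chr (level n) C = chr (level m) C ^ j"
          using chr_level_mono[OF nm] by blast
        have "{C \<in> carrier \<Sigma>. chr (level n) C \<in> V} \<inter> {C \<in> carrier \<Sigma>. chr (level m) C \<in> W}
            = {C \<in> carrier \<Sigma>. chr (level m) C \<in> (\<lambda>z. z ^ j) -` V \<inter> W}"
          using j by auto
        moreover have "open ((\<lambda>z :: complex. z ^ j) -` V \<inter> W)"
          using op by (intro open_Int open_vimage continuous_intros)
        ultimately show ?thesis unfolding cylinders_def by blast
      qed
      fix A B assume "A \<in> cylinders" "B \<in> cylinders"
      then obtain n m V W where A: "open V" "A = {C \<in> carrier \<Sigma>. chr (level n) C \<in> V}"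
        and B: "open W" "B = {C \<in> carrier \<Sigma>. chr (level m) C \<in> W}" unfolding cylinders_def by blast
      show "A \<inter> B \<in> cylinders"
      proof (cases "n \<le> m")
        case True then show ?thesis unfolding A(2) B(2) by (rule wlog[OF _ A(1) B(1)])
      next
        case False
        then have "B \<inter> A \<in> cylinders" unfolding A(2) B(2) by (intro wlog[OF _ B(1) A(1)]) simp
        then show ?thesis by (simp only: Int_commute)
      qed
    qed
    show "emeasure \<mu> A = emeasure \<nu> A" if A: "A \<in> cylinders" for A
    proof -
      obtain n V where V: "open V" "A = {C \<in> carrier \<Sigma>. chr (level n) C \<in> V}"
        using A unfolding cylinders_def by blast
      have "emeasure \<mu> A = emeasure (distr \<mu> borel (chr (level n))) V"
        using V(1) by (subst emeasure_distr[OF meas(1)[OF level_freq]]) (auto simp: V(2) sp intro: arg_cong[where f = "emeasure \<mu>"])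
      also have "\<dots> = emeasure \<nu> A" unfolding d
        using V(1) by (subst emeasure_distr[OF meas(2)[OF level_freq]]) (auto simp: V(2) sp intro: arg_cong[where f = "emeasure \<nu>"])
      finally show ?thesis .
    qed
    have "carrier \<Sigma> = {C \<in> carrier \<Sigma>. chr (level 0) C \<in> UNIV}" by simp
    then show "range (\<lambda>_. carrier \<Sigma>) \<subseteq> cylinders" unfolding cylinders_def by blast
    show "emeasure \<mu> (carrier \<Sigma>) \<noteq> \<infinity>"
      using prob_space.emeasure_space_1[OF \<mu>(1)] sp by simp
  qed (use \<mu>(2) \<nu>(2) sets_\<B> cylinders_Pow in auto)
qed

section \<open>Characteristic functions, convolution and Gaussian distributions\<close>

lemma charfun_props:
  assumes \<mu>: "prob_space \<mu>" "sets \<mu> = sets \<B>"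
  shows "charfun \<mu> (chr 0) = 1"
    and "\<And>s. s \<in> freq \<Longrightarrow> charfun \<mu> (chr (- s)) = cnj (charfun \<mu> (chr s))"
proof -
  interpret prob_space \<mu> by fact
  have sp: "space \<mu> = carrier \<Sigma>" using sets_eq_imp_space_eq[OF \<mu>(2)] space_\<B> by simp
  have "charfun \<mu> (chr 0) = (\<integral>C. 1 \<partial>\<mu>)"
    unfolding charfun_def by (rule Bochner_Integration.integral_cong) (auto simp: sp chr_zero)
  then show "charfun \<mu> (chr 0) = 1" by (simp add: prob_space)
  show "charfun \<mu> (chr (- s)) = cnj (charfun \<mu> (chr s))" if "s \<in> freq" for s
  proof -
    have "charfun \<mu> (chr (- s)) = (\<integral>C. cnj (chr s C) \<partial>\<mu>)"
      unfolding charfun_def by (rule Bochner_Integration.integral_cong) (auto simp: sp chr_minus[OF that])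
    then show ?thesis by (simp add: charfun_def)
  qed
qed

lemma solenoid_mult_closed: "C \<in> carrier \<Sigma> \<Longrightarrow> D \<in> carrier \<Sigma> \<Longrightarrow> C \<otimes>\<^bsub>\<Sigma>\<^esub> D \<in> carrier \<Sigma>"
  using comm_group_solenoid by (simp add: comm_group_def comm_monoid_def monoid.m_closed)

lemma measurable_solenoid_mult:
  assumes f: "f \<in> measurable M \<B>" and g: "g \<in> measurable M \<B>"
  shows "(\<lambda>\<omega>. f \<omega> \<otimes>\<^bsub>\<Sigma>\<^esub> g \<omega>) \<in> measurable M \<B>"
proof (rule measurable_into_\<B>)
  have fg: "f \<omega> \<in> carrier \<Sigma>" "g \<omega> \<in> carrier \<Sigma>" if "\<omega> \<in> space M" for \<omega>
    using measurable_space[OF f that] measurable_space[OF g that] space_\<B> by auto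
  show "f \<omega> \<otimes>\<^bsub>\<Sigma>\<^esub> g \<omega> \<in> carrier \<Sigma>" if "\<omega> \<in> space M" for \<omega>
    using fg[OF that] by (rule solenoid_mult_closed)
  fix s assume s: "s \<in> freq"
  have "(\<lambda>\<omega>. chr s (f \<omega>) * chr s (g \<omega>)) \<in> borel_measurable M"
    using measurable_compose[OF f chr_measurable[OF s]] measurable_compose[OF g chr_measurable[OF s]] by simp
  then show "(\<lambda>\<omega>. chr s (f \<omega> \<otimes>\<^bsub>\<Sigma>\<^esub> g \<omega>)) \<in> borel_measurable M"
    by (subst measurable_cong[where g = "\<lambda>\<omega>. chr s (f \<omega>) * chr s (g \<omega>)"]) (auto simp: chr_mult[OF s] fg)
qed

lemma convolution_props:
  assumes \<mu>: "prob_space \<mu>" "sets \<mu> = sets \<B>" and \<gamma>: "prob_space \<gamma>" "sets \<gamma> = sets \<B>"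
  shows "prob_space (group_convolution \<Sigma> \<T> \<mu> \<gamma>)" "sets (group_convolution \<Sigma> \<T> \<mu> \<gamma>) = sets \<B>"
    and "\<And>s. s \<in> freq \<Longrightarrow>
      charfun (group_convolution \<Sigma> \<T> \<mu> \<gamma>) (chr s) = charfun \<mu> (chr s) * charfun \<gamma> (chr s)"
proof -
  interpret M: prob_space \<mu> by fact
  interpret G: prob_space \<gamma> by fact
  interpret P: pair_prob_space \<mu> \<gamma> ..
  have sp: "space \<mu> = carrier \<Sigma>" "space \<gamma> = carrier \<Sigma>"
    using sets_eq_imp_space_eq[OF \<mu>(2)] sets_eq_imp_space_eq[OF \<gamma>(2)] space_\<B> by auto
  have 1: "fst \<in> measurable (\<mu> \<Otimes>\<^sub>M \<gamma>) \<B>" "snd \<in> measurable (\<mu> \<Otimes>\<^sub>M \<gamma>) \<B>"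
    using measurable_fst[of \<mu> \<gamma>] measurable_snd[of \<mu> \<gamma>] \<mu>(2) \<gamma>(2) by (auto cong: measurable_cong_sets)
  have mult: "(\<lambda>(x, y). x \<otimes>\<^bsub>\<Sigma>\<^esub> y) \<in> measurable (\<mu> \<Otimes>\<^sub>M \<gamma>) \<B>"
    using measurable_solenoid_mult[OF 1] by (simp add: case_prod_unfold)
  show "prob_space (group_convolution \<Sigma> \<T> \<mu> \<gamma>)"
    unfolding group_convolution_def by (rule P.prob_space_distr[OF mult])
  show "sets (group_convolution \<Sigma> \<T> \<mu> \<gamma>) = sets \<B>" by (simp add: group_convolution_def)
  show "charfun (group_convolution \<Sigma> \<T> \<mu> \<gamma>) (chr s) = charfun \<mu> (chr s) * charfun \<gamma> (chr s)" if s: "s \<in> freq" for s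
  proof -
    have "charfun (group_convolution \<Sigma> \<T> \<mu> \<gamma>) (chr s) = (\<integral>p. chr s (case p of (x, y) \<Rightarrow> x \<otimes>\<^bsub>\<Sigma>\<^esub> y) \<partial>(\<mu> \<Otimes>\<^sub>M \<gamma>))"
      unfolding charfun_def group_convolution_def by (rule integral_distr[OF mult chr_measurable[OF s]])
    also have "\<dots> = (\<integral>p. chr s (fst p) * chr s (snd p) \<partial>(\<mu> \<Otimes>\<^sub>M \<gamma>))"
      by (rule Bochner_Integration.integral_cong) (auto simp: space_pair_measure sp chr_mult[OF s])
    also have "\<dots> = (\<integral>x. (\<integral>y. chr s x * chr s y \<partial>\<gamma>) \<partial>\<mu>)"
    proof -
      have m: "(\<lambda>p. chr s (fst p) * chr s (snd p)) \<in> borel_measurable (\<mu> \<Otimes>\<^sub>M \<gamma>)"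
        using measurable_compose[OF 1(1) chr_measurable[OF s]] measurable_compose[OF 1(2) chr_measurable[OF s]] by simp
      have "integrable (\<mu> \<Otimes>\<^sub>M \<gamma>) (\<lambda>p. chr s (fst p) * chr s (snd p))"
        by (rule P.integrable_const_bound[of _ 1]) (use m in \<open>auto simp: space_pair_measure sp norm_mult\<close>)
      from P.integral_fst'[OF this] show ?thesis by simp
    qed
    also have "\<dots> = charfun \<mu> (chr s) * charfun \<gamma> (chr s)" by (simp add: charfun_def)
    finally show ?thesis .
  qed
qed

text \<open>A real normal variable is wound into the solenoid along \<open>line\<close> and
  translated by \<open>x\<close>; for \<kappa> = 0 this is the point mass at
  \<open>x\<close>.\<close>

lemma gaussian_exists:
  assumes x: "x \<in> carrier \<Sigma>" and \<kappa>: "0 \<le> \<kappa>"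
  obtains \<gamma> where "gaussian_distribution \<Sigma> \<T> \<gamma>"
    "\<And>s. s \<in> freq \<Longrightarrow> charfun \<gamma> (chr s) = chr s x * of_real (exp (- (\<kappa> * s\<^sup>2)))"
proof -
  \<comment> \<open>Chosen so that (2 \<pi> s c)^2 / 2 = \<kappa> s^2, the exponent of the standard
    normal characteristic function at 2 \<pi> s c.\<close>
  define c where "c = sqrt (2 * \<kappa>) / (2 * pi)"
  interpret N: prob_space std_normal_distribution
    by (rule prob_space_normal_density) simp
  have meas: "(\<lambda>z. x \<otimes>\<^bsub>\<Sigma>\<^esub> line (c * z)) \<in> measurable std_normal_distribution \<B>"
  proof (rule measurable_solenoid_mult)
    show "(\<lambda>z. x) \<in> measurable std_normal_distribution \<B>"
      by (rule measurable_const) (simp only: space_\<B> x)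
    show "(\<lambda>z. line (c * z)) \<in> measurable std_normal_distribution \<B>"
      by (rule measurable_into_\<B>) (simp_all add: chr_line cis_conv_exp)
  qed
  define \<gamma> where "\<gamma> = distr std_normal_distribution \<B> (\<lambda>z. x \<otimes>\<^bsub>\<Sigma>\<^esub> line (c * z))"
  have prob: "prob_space \<gamma>" unfolding \<gamma>_def by (rule N.prob_space_distr[OF meas])
  have cf: "charfun \<gamma> (chr s) = chr s x * of_real (exp (- (\<kappa> * s\<^sup>2)))" if s: "s \<in> freq" for s
  proof -
    have "charfun \<gamma> (chr s) = (\<integral>z. chr s (x \<otimes>\<^bsub>\<Sigma>\<^esub> line (c * z)) \<partial>std_normal_distribution)"
      unfolding charfun_def \<gamma>_def by (rule integral_distr[OF meas chr_measurable[OF s]])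
    also have "\<dots> = (\<integral>z. chr s x * iexp ((2 * pi * s * c) * z) \<partial>std_normal_distribution)"
      by (simp add: chr_mult[OF s x] chr_line[OF s] cis_conv_exp mult.assoc)
    also have "\<dots> = chr s x * char std_normal_distribution (2 * pi * s * c)"
      by (simp add: char_def)
    also have "char std_normal_distribution (2 * pi * s * c) = of_real (exp (- (\<kappa> * s\<^sup>2)))"
    proof -
      have "(2 * pi * s * c)\<^sup>2 = 2 * \<kappa> * s\<^sup>2"
        using \<kappa> by (simp add: c_def power_mult_distrib power_divide)
      then show ?thesis by (simp add: char_std_normal_distribution)
    qed
    finally show ?thesis .
  qed
  \<comment> \<open>The quadratic form has to be a function of characters, so the frequency is read
    back from the character; this is well defined because different frequencies give different
    characters.\<close>
  define freq_of where "freq_of y = (SOME s. s \<in> freq \<and> y = chr s)" for y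
  have freq_of: "freq_of (chr s) = s" if "s \<in> freq" for s
    unfolding freq_of_def by (rule some_equality) (use that chr_eq_iff in auto)
  have "gaussian_distribution \<Sigma> \<T> \<gamma>"
    unfolding gaussian_distribution_def
  proof (intro conjI prob bexI[OF _ x] exI[of _ "\<lambda>y. \<kappa> * (freq_of y)\<^sup>2"] ballI continuous_map_dual)
    show "sets \<gamma> = sets \<B>" by (simp add: \<gamma>_def)
    show "0 \<le> \<kappa> * (freq_of u)\<^sup>2" for u using \<kappa> by simp
    fix u assume "u \<in> carrier \<Sigma>_dual"
    then obtain s where s: "s \<in> freq" "u = chr s" by (rule dual_eq_chr)
    show "charfun \<gamma> u = u x * of_real (exp (- (\<kappa> * (freq_of u)\<^sup>2)))"
      by (simp only: s(2) cf[OF s(1)] freq_of[OF s(1)])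
    fix v assume "v \<in> carrier \<Sigma>_dual"
    then obtain t where t: "t \<in> freq" "v = chr t" by (rule dual_eq_chr)
    show "\<kappa> * (freq_of (u \<otimes>\<^bsub>\<Sigma>_dual\<^esub> v))\<^sup>2 + \<kappa> * (freq_of (u \<otimes>\<^bsub>\<Sigma>_dual\<^esub> inv\<^bsub>\<Sigma>_dual\<^esub> v))\<^sup>2
        = 2 * (\<kappa> * (freq_of u)\<^sup>2 + \<kappa> * (freq_of v)\<^sup>2)"
      using s(1) t(1) by (simp add: s(2) t(2) dual_inv_chr dual_mult_chr freq_of freq_minus freq_add freq_diff)
        (simp add: power2_eq_square algebra_simps)
  qed
  then show ?thesis using cf that by blast
qed

lemma determined_up_to_gaussian:
  assumes \<mu>: "prob_space \<mu>" "sets \<mu> = sets \<B>" and \<nu>: "prob_space \<nu>" "sets \<nu> = sets \<B>"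
    and nz: "nonvanishing_charfun \<Sigma> \<T> \<mu>" "nonvanishing_charfun \<Sigma> \<T> \<nu>"
    and third: "\<And>k l m. k \<in> freq \<Longrightarrow> l \<in> freq \<Longrightarrow> m \<in> freq \<Longrightarrow>
      mdiff m (mdiff l (mdiff k (\<lambda>s. charfun \<mu> (chr s) / charfun \<nu> (chr s)))) 0 = 1"
  shows "\<exists>\<gamma>. gaussian_distribution \<Sigma> \<T> \<gamma> \<and>
    (\<nu> = group_convolution \<Sigma> \<T> \<mu> \<gamma> \<or> \<mu> = group_convolution \<Sigma> \<T> \<nu> \<gamma>)"
proof -
  have n: "charfun \<mu> (chr s) \<noteq> 0" "charfun \<nu> (chr s) \<noteq> 0" if "s \<in> freq" for s
    using nz chr_in_dual[OF that] by (auto simp: nonvanishing_charfun_def)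
  define h where "h s = charfun \<mu> (chr s) / charfun \<nu> (chr s)" for s
  have h_nz: "h s \<noteq> 0" if "s \<in> freq" for s using n[OF that] by (simp add: h_def)
  have h_0: "h 0 = 1" by (simp add: h_def charfun_props(1) \<mu> \<nu>)
  have h_herm: "h (- s) = cnj (h s)" if "s \<in> freq" for s
    by (simp add: h_def charfun_props(2) \<mu> \<nu> that)
  have third_h: "mdiff m (mdiff l (mdiff k h)) 0 = 1" if "k \<in> freq" "l \<in> freq" "m \<in> freq" for k l m
    using third[OF that] by (simp add: h_def[abs_def])
  have gauss_sgn: "sgn (h (s + t)) = sgn (h s) * sgn (h t)" if "s \<in> freq" "t \<in> freq" for s t
    by (rule third_mdiff_imp_gaussian(1)[where h = h]) (fact h_nz h_0 h_herm third_h that)+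
  have gauss_norm: "cmod (h s) = exp (ln (cmod (h 1)) * s\<^sup>2)" if "s \<in> freq" for s
    by (rule third_mdiff_imp_gaussian(2)[where h = h]) (fact h_nz h_0 h_herm third_h that)+
  define \<kappa> where "\<kappa> = ln (cmod (h 1))"
  have sgn_norm: "cmod (sgn (h s)) = 1" if "s \<in> freq" for s using h_nz[OF that] by (simp add: norm_sgn)
  have h_eq: "h s = sgn (h s) * of_real (exp (\<kappa> * s\<^sup>2))" if "s \<in> freq" for s
    using gauss_norm[OF that] h_nz[OF that] by (simp add: \<kappa>_def sgn_eq)
  show ?thesis
  \<comment> \<open>For \<kappa> \<le> 0 the quotient \<open>h\<close> is itself the characteristic
    function of a Gaussian. For \<kappa> > 0 its modulus exceeds 1 at frequency 1, and the
    reciprocal, with the inverse phase, takes its place.\<close>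
  proof (cases "\<kappa> \<le> 0")
    case True
    obtain x where x: "x \<in> carrier \<Sigma>" "\<And>s. s \<in> freq \<Longrightarrow> chr s x = sgn (h s)"
      using exists_with_chr[of "\<lambda>s. sgn (h s)", OF gauss_sgn sgn_norm] by blast
    obtain \<gamma> where \<gamma>: "gaussian_distribution \<Sigma> \<T> \<gamma>"
      "\<And>s. s \<in> freq \<Longrightarrow> charfun \<gamma> (chr s) = chr s x * of_real (exp (- (- \<kappa> * s\<^sup>2)))"
      using gaussian_exists[OF x(1), of "- \<kappa>"] True by auto
    have g: "prob_space \<gamma>" "sets \<gamma> = sets \<B>" using \<gamma>(1) by (auto simp: gaussian_distribution_def)
    have "\<mu> = group_convolution \<Sigma> \<T> \<nu> \<gamma>"
    proof (rule measure_eq_charfun[OF \<mu> convolution_props(1,2)[OF \<nu> g]])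
      fix s assume s: "s \<in> freq"
      have "charfun \<mu> (chr s) = charfun \<nu> (chr s) * h s" using n[OF s] by (simp add: h_def)
      also have "h s = charfun \<gamma> (chr s)" using h_eq[OF s] \<gamma>(2)[OF s] x(2)[OF s] by simp
      finally show "charfun \<mu> (chr s) = charfun (group_convolution \<Sigma> \<T> \<nu> \<gamma>) (chr s)"
        by (simp add: convolution_props(3)[OF \<nu> g s])
    qed
    then show ?thesis using \<gamma>(1) by blast
  next
    case False
    obtain x where x: "x \<in> carrier \<Sigma>" "\<And>s. s \<in> freq \<Longrightarrow> chr s x = inverse (sgn (h s))"
      using exists_with_chr[of "\<lambda>s. inverse (sgn (h s))"] gauss_sgn sgn_norm
      by (auto simp: norm_inverse inverse_mult_distrib)
    obtain \<gamma> where \<gamma>: "gaussian_distribution \<Sigma> \<T> \<gamma>"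
      "\<And>s. s \<in> freq \<Longrightarrow> charfun \<gamma> (chr s) = chr s x * of_real (exp (- (\<kappa> * s\<^sup>2)))"
      using gaussian_exists[OF x(1), of "\<kappa>"] False by auto
    have g: "prob_space \<gamma>" "sets \<gamma> = sets \<B>" using \<gamma>(1) by (auto simp: gaussian_distribution_def)
    have "\<nu> = group_convolution \<Sigma> \<T> \<mu> \<gamma>"
    proof (rule measure_eq_charfun[OF \<nu> convolution_props(1,2)[OF \<mu> g]])
      fix s assume s: "s \<in> freq"
      have "charfun \<nu> (chr s) = charfun \<mu> (chr s) * inverse (h s)" using n[OF s] by (simp add: h_def)
      also have "inverse (h s) = inverse (sgn (h s)) * inverse (of_real (exp (\<kappa> * s\<^sup>2)))"
        by (subst h_eq[OF s]) (rule inverse_mult_distrib)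
      also have "\<dots> = charfun \<gamma> (chr s)" using \<gamma>(2)[OF s] x(2)[OF s] by (simp add: exp_minus of_real_inverse)
      finally show "charfun \<nu> (chr s) = charfun (group_convolution \<Sigma> \<T> \<mu> \<gamma>) (chr s)"
        by (simp add: convolution_props(3)[OF \<mu> g s])
    qed
    then show ?thesis using \<gamma>(1) by blast
  qed
qed

lemma charfun_joint:
  assumes P: "prob_space P" and I: "finite I" "prob_space.indep_vars P (\<lambda>_. \<B>) \<xi> I"
    and t: "\<And>j. j \<in> I \<Longrightarrow> t j \<in> freq"
  shows "(\<integral>\<omega>. (\<Prod>j\<in>I. chr (t j) (\<xi> j \<omega>)) \<partial>P) = (\<Prod>j\<in>I. charfun (distr P \<B> (\<xi> j)) (chr (t j)))"
proof -
  interpret prob_space P by fact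
  have m: "\<xi> j \<in> measurable P \<B>" if "j \<in> I" for j using I(2) that by (auto simp: indep_vars_def)
  have cm: "(\<lambda>\<omega>. chr (t j) (\<xi> j \<omega>)) \<in> borel_measurable P" if "j \<in> I" for j
    using measurable_compose[OF m[OF that] chr_measurable[OF t[OF that]]] .
  have "indep_vars (\<lambda>_. borel) (\<lambda>j \<omega>. chr (t j) (\<xi> j \<omega>)) I"
    by (rule indep_vars_compose2[OF I(2)]) (rule chr_measurable[OF t])
  moreover have "integrable P (\<lambda>\<omega>. chr (t j) (\<xi> j \<omega>))" if "j \<in> I" for j
    by (rule integrable_const_bound[of _ 1])
      (use cm[OF that] measurable_space[OF m[OF that]] space_\<B> in auto)
  ultimately have "(\<integral>\<omega>. (\<Prod>j\<in>I. chr (t j) (\<xi> j \<omega>)) \<partial>P) = (\<Prod>j\<in>I. \<integral>\<omega>. chr (t j) (\<xi> j \<omega>) \<partial>P)"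
    by (rule indep_vars_lebesgue_integral[OF I(1)])
  also have "\<dots> = (\<Prod>j\<in>I. charfun (distr P \<B> (\<xi> j)) (chr (t j)))"
    unfolding charfun_def by (intro prod.cong refl integral_distr[symmetric] m chr_measurable t)
  finally show ?thesis .
qed

end

section \<open>Two linear forms\<close>

context adic_base
begin

text \<open>Collecting the characters evaluated at \<xi> \<open>j\<close> gives the frequency
  \<alpha> \<open>j * u\<close> + \<beta> \<open>j * v\<close>, and independence splits the
  expectation. The 0/1 vector \<alpha> unites the two cases: \<alpha> \<open>4 = 0\<close> stands
  for the summand missing from \<open>L\<^sub>1\<close>, because \<open>chr 0\<close> is 1.\<close>

lemma two_forms_charfun:
  fixes \<xi> :: "nat \<Rightarrow> 'w \<Rightarrow> (real \<times> (nat \<Rightarrow> int)) set" and \<alpha> \<beta> :: "nat \<Rightarrow> real"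
  assumes P: "prob_space P" and indep: "prob_space.indep_vars P (\<lambda>_. \<B>) \<xi> {1, 2, 3, 4}"
    and b: "\<And>j C. j \<in> {1, 2, 3, 4} \<Longrightarrow> C \<in> carrier \<Sigma> \<Longrightarrow> b j C \<in> carrier \<Sigma>"
    and \<beta>: "\<And>j s. j \<in> {1, 2, 3, 4} \<Longrightarrow> s \<in> freq \<Longrightarrow> \<beta> j * s \<in> freq"
    and chr_b: "\<And>j s C. j \<in> {1, 2, 3, 4} \<Longrightarrow> s \<in> freq \<Longrightarrow> C \<in> carrier \<Sigma> \<Longrightarrow>
      chr s (b j C) = chr (\<beta> j * s) C"
    and L1: "L\<^sub>1 = (\<lambda>\<omega>. \<xi> 1 \<omega> \<otimes>\<^bsub>\<Sigma>\<^esub> \<xi> 2 \<omega> \<otimes>\<^bsub>\<Sigma>\<^esub> \<xi> 3 \<omega> \<otimes>\<^bsub>\<Sigma>\<^esub> \<xi> 4 \<omega>) \<and> \<alpha> = (\<lambda>_. 1) \<or>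
      L\<^sub>1 = (\<lambda>\<omega>. \<xi> 1 \<omega> \<otimes>\<^bsub>\<Sigma>\<^esub> \<xi> 2 \<omega> \<otimes>\<^bsub>\<Sigma>\<^esub> \<xi> 3 \<omega>) \<and> \<alpha> = (\<lambda>j. if j = 4 then 0 else 1)"
    and L2: "L\<^sub>2 = (\<lambda>\<omega>. b 1 (\<xi> 1 \<omega>) \<otimes>\<^bsub>\<Sigma>\<^esub> b 2 (\<xi> 2 \<omega>) \<otimes>\<^bsub>\<Sigma>\<^esub> b 3 (\<xi> 3 \<omega>) \<otimes>\<^bsub>\<Sigma>\<^esub> b 4 (\<xi> 4 \<omega>))"
    and u: "u \<in> freq" and v: "v \<in> freq"
  shows "(\<integral>p. chr u (fst p) * chr v (snd p) \<partial>distr P (\<B> \<Otimes>\<^sub>M \<B>) (\<lambda>\<omega>. (L\<^sub>1 \<omega>, L\<^sub>2 \<omega>)))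
    = (\<Prod>j\<in>{1, 2, 3, 4}. charfun (distr P \<B> (\<xi> j)) (chr (\<alpha> j * u + \<beta> j * v)))"
proof -
  interpret prob_space P by fact
  have m: "\<xi> j \<in> measurable P \<B>" if "j \<in> {1, 2, 3, 4}" for j
    using indep that by (auto simp: indep_vars_def)
  have c: "\<xi> j \<omega> \<in> carrier \<Sigma>" if "j \<in> {1, 2, 3, 4}" "\<omega> \<in> space P" for j \<omega>
    using measurable_space[OF m[OF that(1)] that(2)] space_\<B> by simp
  have mb: "(\<lambda>\<omega>. b j (\<xi> j \<omega>)) \<in> measurable P \<B>" if j: "j \<in> {1, 2, 3, 4}" for j
  proof (rule measurable_into_\<B>)
    show "b j (\<xi> j \<omega>) \<in> carrier \<Sigma>" if "\<omega> \<in> space P" for \<omega> by (intro b c that j)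
    fix s assume s: "s \<in> freq"
    have "(\<lambda>\<omega>. chr (\<beta> j * s) (\<xi> j \<omega>)) \<in> borel_measurable P"
      by (rule measurable_compose[OF m[OF j] chr_measurable[OF \<beta>[OF j s]]])
    then show "(\<lambda>\<omega>. chr s (b j (\<xi> j \<omega>))) \<in> borel_measurable P"
      by (subst measurable_cong[where g = "\<lambda>\<omega>. chr (\<beta> j * s) (\<xi> j \<omega>)"]) (simp_all add: chr_b[OF j s c[OF j]])
  qed
  have mL1: "L\<^sub>1 \<in> measurable P \<B>"
    using L1
  proof (elim disjE conjE)
    assume "L\<^sub>1 = (\<lambda>\<omega>. \<xi> 1 \<omega> \<otimes>\<^bsub>\<Sigma>\<^esub> \<xi> 2 \<omega> \<otimes>\<^bsub>\<Sigma>\<^esub> \<xi> 3 \<omega> \<otimes>\<^bsub>\<Sigma>\<^esub> \<xi> 4 \<omega>)"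
    then show ?thesis by (simp only:) (intro measurable_solenoid_mult m; simp)
  next
    assume "L\<^sub>1 = (\<lambda>\<omega>. \<xi> 1 \<omega> \<otimes>\<^bsub>\<Sigma>\<^esub> \<xi> 2 \<omega> \<otimes>\<^bsub>\<Sigma>\<^esub> \<xi> 3 \<omega>)"
    then show ?thesis by (simp only:) (intro measurable_solenoid_mult m; simp)
  qed
  have mL2: "L\<^sub>2 \<in> measurable P \<B>"
    unfolding L2 by (intro measurable_solenoid_mult mb; simp)
  have t: "\<alpha> j * u + \<beta> j * v \<in> freq" if "j \<in> {1, 2, 3, 4}" for j
  proof -
    have "\<alpha> j * u \<in> freq" using L1 u by auto
    then show ?thesis by (intro freq_add \<beta> that v)
  qed
  have forms: "chr u (L\<^sub>1 \<omega>) * chr v (L\<^sub>2 \<omega>) = (\<Prod>j\<in>{1, 2, 3, 4}. chr (\<alpha> j * u + \<beta> j * v) (\<xi> j \<omega>))"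
    if \<omega>: "\<omega> \<in> space P" for \<omega>
  proof -
    have c': "\<xi> 1 \<omega> \<in> carrier \<Sigma>" "\<xi> 2 \<omega> \<in> carrier \<Sigma>" "\<xi> 3 \<omega> \<in> carrier \<Sigma>" "\<xi> 4 \<omega> \<in> carrier \<Sigma>"
      by (intro c \<omega>; simp)+
    have b': "b 1 (\<xi> 1 \<omega>) \<in> carrier \<Sigma>" "b 2 (\<xi> 2 \<omega>) \<in> carrier \<Sigma>" "b 3 (\<xi> 3 \<omega>) \<in> carrier \<Sigma>" "b 4 (\<xi> 4 \<omega>) \<in> carrier \<Sigma>"
      by (intro b c'; simp)+
    have "chr v (L\<^sub>2 \<omega>) = (\<Prod>j\<in>{1, 2, 3, 4}. chr (\<beta> j * v) (\<xi> j \<omega>))"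
      unfolding L2 by (simp add: chr_mult[OF v] b' c' solenoid_mult_closed chr_b v mult.assoc del: One_nat_def)
    moreover have "chr u (L\<^sub>1 \<omega>) = (\<Prod>j\<in>{1, 2, 3, 4}. chr (\<alpha> j * u) (\<xi> j \<omega>))"
      using L1 by (elim disjE conjE) (simp_all add: chr_mult[OF u] c' solenoid_mult_closed chr_zero mult.assoc del: One_nat_def)
    moreover have "chr (\<alpha> j * u + \<beta> j * v) (\<xi> j \<omega>) = chr (\<alpha> j * u) (\<xi> j \<omega>) * chr (\<beta> j * v) (\<xi> j \<omega>)"
      if j: "j \<in> {1, 2, 3, 4}" for j
    proof (rule chr_add[OF _ \<beta>[OF j v] c[OF j \<omega>]])
      show "\<alpha> j * u \<in> freq" using L1 u by auto
    qed
    ultimately show ?thesis by (simp only: prod.distrib mult.commute cong: prod.cong)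
  qed
  have "(\<integral>p. chr u (fst p) * chr v (snd p) \<partial>distr P (\<B> \<Otimes>\<^sub>M \<B>) (\<lambda>\<omega>. (L\<^sub>1 \<omega>, L\<^sub>2 \<omega>)))
      = (\<integral>\<omega>. chr u (L\<^sub>1 \<omega>) * chr v (L\<^sub>2 \<omega>) \<partial>P)"
  proof (subst integral_distr)
    show "(\<lambda>\<omega>. (L\<^sub>1 \<omega>, L\<^sub>2 \<omega>)) \<in> measurable P (\<B> \<Otimes>\<^sub>M \<B>)" by (rule measurable_Pair[OF mL1 mL2])
    show "(\<lambda>p. chr u (fst p) * chr v (snd p)) \<in> borel_measurable (\<B> \<Otimes>\<^sub>M \<B>)"
      by (rule borel_measurable_times[OF measurable_compose[OF measurable_fst chr_measurable[OF u]]
            measurable_compose[OF measurable_snd chr_measurable[OF v]]])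
  qed simp
  also have "\<dots> = (\<integral>\<omega>. (\<Prod>j\<in>{1, 2, 3, 4}. chr (\<alpha> j * u + \<beta> j * v) (\<xi> j \<omega>)) \<partial>P)"
    by (rule Bochner_Integration.integral_cong[OF refl forms])
  also have "\<dots> = (\<Prod>j\<in>{1, 2, 3, 4}. charfun (distr P \<B> (\<xi> j)) (chr (\<alpha> j * u + \<beta> j * v)))"
    by (rule charfun_joint[OF P _ indep t]) auto
  finally show ?thesis .
qed

text \<open>The dual of a difference is multiplication by \<phi> - \<psi>. This is verified after
  multiplying by \<open>chr s (g C)\<close>, which absorbs the group inverse inside
  \<open>hom_diff\<close>; triviality of the kernel then gives surjectivity.\<close>

lemma hom_diff_multiplier:
  assumes c: "\<And>C. C \<in> carrier \<Sigma> \<Longrightarrow> f C \<in> carrier \<Sigma>" "\<And>C. C \<in> carrier \<Sigma> \<Longrightarrow> g C \<in> carrier \<Sigma>"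
    and q: "\<And>s. s \<in> freq \<Longrightarrow> \<phi> * s \<in> freq" "\<And>s. s \<in> freq \<Longrightarrow> \<psi> * s \<in> freq"
    and chr: "\<And>s C. s \<in> freq \<Longrightarrow> C \<in> carrier \<Sigma> \<Longrightarrow> chr s (f C) = chr (\<phi> * s) C"
      "\<And>s C. s \<in> freq \<Longrightarrow> C \<in> carrier \<Sigma> \<Longrightarrow> chr s (g C) = chr (\<psi> * s) C"
    and ker: "kernel \<Sigma> \<Sigma> (hom_diff \<Sigma> f g) = {\<one>\<^bsub>\<Sigma>\<^esub>}"
    and k: "k \<in> freq"
  shows "\<exists>s\<in>freq. (\<phi> - \<psi>) * s = k"
proof (rule injective_multiplier_surj[OF _ _ _ ker k])
  interpret S: comm_group \<Sigma> by (rule comm_group_solenoid)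
  show "(\<phi> - \<psi>) * s \<in> freq" if "s \<in> freq" for s
    using freq_diff[OF q(1)[OF that] q(2)[OF that]] by (simp add: left_diff_distrib)
  show "hom_diff \<Sigma> f g C \<in> carrier \<Sigma>" if "C \<in> carrier \<Sigma>" for C
    using c that by (simp add: hom_diff_def)
  show "chr s (hom_diff \<Sigma> f g C) = chr ((\<phi> - \<psi>) * s) C" if s: "s \<in> freq" and C: "C \<in> carrier \<Sigma>" for s C
  proof -
    have nz: "chr (\<psi> * s) C \<noteq> 0" using norm_chr[OF C, of "\<psi> * s"] by auto
    have "chr s (hom_diff \<Sigma> f g C) * chr s (g C) = chr s (f C)"
      using c C by (simp add: hom_diff_def S.m_assoc flip: chr_mult[OF s])
    moreover have "chr ((\<phi> - \<psi>) * s) C * chr (\<psi> * s) C = chr (\<phi> * s) C"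
      using chr_add[OF freq_diff[OF q(1)[OF s] q(2)[OF s]] q(2)[OF s] C] by (simp add: left_diff_distrib)
    ultimately have "chr s (hom_diff \<Sigma> f g C) * chr (\<psi> * s) C = chr ((\<phi> - \<psi>) * s) C * chr (\<psi> * s) C"
      by (simp add: chr[OF s C])
    then show ?thesis using nz by simp
  qed
qed

end

theorem theorem2:
  fixes a :: "nat \<Rightarrow> int"
    and X (structure)
    and T :: "(real \<times> (nat \<Rightarrow> int)) set topology"
    and P :: "'w measure" and Q :: "'v measure"
    and \<xi> :: "nat \<Rightarrow> 'w \<Rightarrow> (real \<times> (nat \<Rightarrow> int)) set"
    and \<eta> :: "nat \<Rightarrow> 'v \<Rightarrow> (real \<times> (nat \<Rightarrow> int)) set"
    and b :: "nat \<Rightarrow> (real \<times> (nat \<Rightarrow> int)) set \<Rightarrow> (real \<times> (nat \<Rightarrow> int)) set"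
    and \<mu> \<nu> :: "nat \<Rightarrow> (real \<times> (nat \<Rightarrow> int)) set measure"
    and L\<^sub>1 L\<^sub>2 :: "'w \<Rightarrow> (real \<times> (nat \<Rightarrow> int)) set"
    and M\<^sub>1 M\<^sub>2 :: "'v \<Rightarrow> (real \<times> (nat \<Rightarrow> int)) set"
  assumes a: "\<And>j. a j > 1"
    and X: "X = solenoid a"
    and T: "T = solenoid_topology a"
    and P: "prob_space P"
    and Q: "prob_space Q"
    and indep_\<xi>: "prob_space.indep_vars P (\<lambda>_. borel_of T) \<xi> {1, 2, 3, 4}"
    and indep_\<eta>: "prob_space.indep_vars Q (\<lambda>_. borel_of T) \<eta> {1, 2, 3, 4}"
    and \<mu>: "\<And>j. j \<in> {1, 2, 3, 4} \<Longrightarrow> \<mu> j = distr P (borel_of T) (\<xi> j)"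
    and \<nu>: "\<And>j. j \<in> {1, 2, 3, 4} \<Longrightarrow> \<nu> j = distr Q (borel_of T) (\<eta> j)"
    and nonvanishing_\<mu>: "\<And>j. j \<in> {1, 2, 3, 4} \<Longrightarrow> nonvanishing_charfun X T (\<mu> j)"
    and nonvanishing_\<nu>: "\<And>j. j \<in> {1, 2, 3, 4} \<Longrightarrow> nonvanishing_charfun X T (\<nu> j)"
    and b: "\<And>j. j \<in> {1, 2, 3, 4} \<Longrightarrow> continuous_endomorphism X T (b j)"
    and L\<^sub>2: "L\<^sub>2 = (\<lambda>\<omega>. b 1 (\<xi> 1 \<omega>) \<otimes> b 2 (\<xi> 2 \<omega>) \<otimes> b 3 (\<xi> 3 \<omega>) \<otimes> b 4 (\<xi> 4 \<omega>))"
    and M\<^sub>2: "M\<^sub>2 = (\<lambda>\<omega>. b 1 (\<eta> 1 \<omega>) \<otimes> b 2 (\<eta> 2 \<omega>) \<otimes> b 3 (\<eta> 3 \<omega>) \<otimes> b 4 (\<eta> 4 \<omega>))"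
    and cases:
      "L\<^sub>1 = (\<lambda>\<omega>. \<xi> 1 \<omega> \<otimes> \<xi> 2 \<omega> \<otimes> \<xi> 3 \<omega> \<otimes> \<xi> 4 \<omega>) \<and>
       M\<^sub>1 = (\<lambda>\<omega>. \<eta> 1 \<omega> \<otimes> \<eta> 2 \<omega> \<otimes> \<eta> 3 \<omega> \<otimes> \<eta> 4 \<omega>) \<and>
       (\<forall>i\<in>{1, 2, 3, 4}. \<forall>j\<in>{1, 2, 3, 4}.
          i \<noteq> j \<longrightarrow> kernel X X (hom_diff X (b i) (b j)) = {\<one>})
       \<or>
       L\<^sub>1 = (\<lambda>\<omega>. \<xi> 1 \<omega> \<otimes> \<xi> 2 \<omega> \<otimes> \<xi> 3 \<omega>) \<and>
       M\<^sub>1 = (\<lambda>\<omega>. \<eta> 1 \<omega> \<otimes> \<eta> 2 \<omega> \<otimes> \<eta> 3 \<omega>) \<and>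
       (\<forall>i\<in>{1, 2, 3}. \<forall>j\<in>{1, 2, 3}.
          i \<noteq> j \<longrightarrow> kernel X X (hom_diff X (b i) (b j)) = {\<one>}) \<and>
       kernel X X (b 4) = {\<one>}"
    and identically_distributed:
      "distr P (borel_of T \<Otimes>\<^sub>M borel_of T) (\<lambda>\<omega>. (L\<^sub>1 \<omega>, L\<^sub>2 \<omega>)) =
       distr Q (borel_of T \<Otimes>\<^sub>M borel_of T) (\<lambda>\<omega>. (M\<^sub>1 \<omega>, M\<^sub>2 \<omega>))"
  shows "\<forall>j\<in>{1, 2, 3, 4}. \<exists>\<gamma>. gaussian_distribution X T \<gamma> \<and>
           (\<nu> j = group_convolution X T (\<mu> j) \<gamma> \<or> \<mu> j = group_convolution X T (\<nu> j) \<gamma>)"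
proof -
  interpret adic_base a by unfold_locales (rule a)
  let ?I = "{1, 2, 3, 4} :: nat set"
  have bc: "b j C \<in> carrier \<Sigma>" if "j \<in> ?I" "C \<in> carrier \<Sigma>" for j C
    using b[OF that(1)] that(2) by (auto simp: X continuous_endomorphism_def hom_def)
  have "\<exists>r. (\<forall>s\<in>freq. r * s \<in> freq) \<and> (\<forall>s\<in>freq. \<forall>C\<in>carrier \<Sigma>. chr s (b j C) = chr (r * s) C)"
    if j: "j \<in> ?I" for j
  proof -
    obtain r where "\<And>s. s \<in> freq \<Longrightarrow> r * s \<in> freq"
      "\<And>s C. s \<in> freq \<Longrightarrow> C \<in> carrier \<Sigma> \<Longrightarrow> chr s (b j C) = chr (r * s) C"
      using endomorphism_dual_multiplier[OF b[OF j, unfolded X T]] by blast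
    then show ?thesis by blast
  qed
  then have "\<exists>\<beta>. \<forall>j\<in>?I. (\<forall>s\<in>freq. \<beta> j * s \<in> freq) \<and> (\<forall>s\<in>freq. \<forall>C\<in>carrier \<Sigma>. chr s (b j C) = chr (\<beta> j * s) C)"
    by (intro bchoice ballI)
  then obtain \<beta> where multipliers: "\<forall>j\<in>?I. (\<forall>s\<in>freq. \<beta> j * s \<in> freq) \<and>
      (\<forall>s\<in>freq. \<forall>C\<in>carrier \<Sigma>. chr s (b j C) = chr (\<beta> j * s) C)" ..
  have \<beta>: "\<beta> j * s \<in> freq" if "j \<in> ?I" "s \<in> freq" for j s
    using bspec[OF multipliers that(1)] that(2) by blast
  have chr_b: "chr s (b j C) = chr (\<beta> j * s) C" if "j \<in> ?I" "s \<in> freq" "C \<in> carrier \<Sigma>" for j s C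
    using bspec[OF multipliers that(1)] that(2,3) by blast
  have diff_surj: "\<exists>s\<in>freq. (\<beta> i - \<beta> j) * s = k"
    if "i \<in> ?I" "j \<in> ?I" "kernel X X (hom_diff X (b i) (b j)) = {\<one>}" "k \<in> freq" for i j k
    using hom_diff_multiplier[OF bc[OF that(1)] bc[OF that(2)] \<beta>[OF that(1)] \<beta>[OF that(2)]
        chr_b[OF that(1)] chr_b[OF that(2)] that(3)[unfolded X] that(4)] .
  \<comment> \<open>From here on both cases run alike through \<alpha>, and \<open>onto\<close>
    retains all that is used of the kernel hypotheses: the kernel of one form is mapped onto
    \<open>freq\<close> by any other.\<close>
  obtain \<alpha> :: "nat \<Rightarrow> real" where
    \<alpha>_L: "L\<^sub>1 = (\<lambda>\<omega>. \<xi> 1 \<omega> \<otimes>\<^bsub>\<Sigma>\<^esub> \<xi> 2 \<omega> \<otimes>\<^bsub>\<Sigma>\<^esub> \<xi> 3 \<omega> \<otimes>\<^bsub>\<Sigma>\<^esub> \<xi> 4 \<omega>) \<and> \<alpha> = (\<lambda>_. 1) \<or>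
      L\<^sub>1 = (\<lambda>\<omega>. \<xi> 1 \<omega> \<otimes>\<^bsub>\<Sigma>\<^esub> \<xi> 2 \<omega> \<otimes>\<^bsub>\<Sigma>\<^esub> \<xi> 3 \<omega>) \<and> \<alpha> = (\<lambda>j. if j = 4 then 0 else 1)"
    and \<alpha>_M: "M\<^sub>1 = (\<lambda>\<omega>. \<eta> 1 \<omega> \<otimes>\<^bsub>\<Sigma>\<^esub> \<eta> 2 \<omega> \<otimes>\<^bsub>\<Sigma>\<^esub> \<eta> 3 \<omega> \<otimes>\<^bsub>\<Sigma>\<^esub> \<eta> 4 \<omega>) \<and> \<alpha> = (\<lambda>_. 1) \<or>
      M\<^sub>1 = (\<lambda>\<omega>. \<eta> 1 \<omega> \<otimes>\<^bsub>\<Sigma>\<^esub> \<eta> 2 \<omega> \<otimes>\<^bsub>\<Sigma>\<^esub> \<eta> 3 \<omega>) \<and> \<alpha> = (\<lambda>j. if j = 4 then 0 else 1)"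
    and onto: "\<And>i j k. i \<in> ?I \<Longrightarrow> j \<in> ?I \<Longrightarrow> i \<noteq> j \<Longrightarrow> k \<in> freq \<Longrightarrow>
      \<exists>u\<in>freq. \<exists>v\<in>freq. \<alpha> i * u + \<beta> i * v = 0 \<and> \<alpha> j * u + \<beta> j * v = k"
  proof -
    \<comment> \<open>When both forms contain \<open>u\<close> with coefficient 1, the kernel of the
      form \<open>i\<close> consists of the pairs (-\<beta>_i v, v), and there the form
      \<open>j\<close> equals (\<beta>_j - \<beta>_i) v.\<close>
    have both: "\<exists>u\<in>freq. \<exists>v\<in>freq. 1 * u + \<beta> i * v = 0 \<and> 1 * u + \<beta> j * v = k"
      if ij: "i \<in> ?I" "j \<in> ?I" "kernel X X (hom_diff X (b j) (b i)) = {\<one>}" "k \<in> freq" for i j k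
    proof -
      obtain v where v: "v \<in> freq" "(\<beta> j - \<beta> i) * v = k" using diff_surj[OF ij(2,1,3,4)] by blast
      then show ?thesis
        using \<beta>[OF ij(1) v(1)]
        by (intro bexI[of _ "- (\<beta> i * v)"] bexI[of _ v]) (auto simp: left_diff_distrib freq_minus)
    qed
    from cases show thesis
    proof (elim disjE conjE)
      assume L: "L\<^sub>1 = (\<lambda>\<omega>. \<xi> 1 \<omega> \<otimes> \<xi> 2 \<omega> \<otimes> \<xi> 3 \<omega> \<otimes> \<xi> 4 \<omega>)"
        and M: "M\<^sub>1 = (\<lambda>\<omega>. \<eta> 1 \<omega> \<otimes> \<eta> 2 \<omega> \<otimes> \<eta> 3 \<omega> \<otimes> \<eta> 4 \<omega>)"
        and ker: "\<forall>i\<in>?I. \<forall>j\<in>?I. i \<noteq> j \<longrightarrow> kernel X X (hom_diff X (b i) (b j)) = {\<one>}"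
      show thesis
      proof (rule that[of "\<lambda>_. 1"])
        show "\<exists>u\<in>freq. \<exists>v\<in>freq. 1 * u + \<beta> i * v = 0 \<and> 1 * u + \<beta> j * v = k"
          if ij: "i \<in> ?I" "j \<in> ?I" "i \<noteq> j" "k \<in> freq" for i j k
        proof (rule both[OF ij(1,2) _ ij(4)])
          show "kernel X X (hom_diff X (b j) (b i)) = {\<one>}" using ker ij(1-3) by metis
        qed
      qed (use L M X in auto)
    next
      assume L: "L\<^sub>1 = (\<lambda>\<omega>. \<xi> 1 \<omega> \<otimes> \<xi> 2 \<omega> \<otimes> \<xi> 3 \<omega>)"
        and M: "M\<^sub>1 = (\<lambda>\<omega>. \<eta> 1 \<omega> \<otimes> \<eta> 2 \<omega> \<otimes> \<eta> 3 \<omega>)"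
        and ker: "\<forall>i\<in>{1, 2, 3}. \<forall>j\<in>{1, 2, 3}. i \<noteq> j \<longrightarrow> kernel X X (hom_diff X (b i) (b j)) = {\<one>}"
        and ker4: "kernel X X (b 4) = {\<one>}"
      have I4: "4 \<in> ?I" by simp
      have surj4: "\<exists>v\<in>freq. \<beta> 4 * v = k" if "k \<in> freq" for k
        using injective_multiplier_surj[OF \<beta>[OF I4] bc[OF I4] chr_b[OF I4] ker4[unfolded X] that] .
      show thesis
      proof (rule that[of "\<lambda>j. if j = 4 then 0 else 1"])
        show "\<exists>u\<in>freq. \<exists>v\<in>freq. (if i = 4 then 0 else 1) * u + \<beta> i * v = 0 \<and> (if j = 4 then 0 else 1) * u + \<beta> j * v = k"
          if ij: "i \<in> ?I" "j \<in> ?I" "i \<noteq> j" "k \<in> freq" for i j k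
        proof -
          \<comment> \<open>The fourth form is \<beta>_4 v alone. If it is to vanish, (k, 0) works,
            since the other form is then \<open>u\<close>. If it is to take the value
            \<open>k\<close>, injectivity of b_4 provides \<open>v\<close>, and \<open>u\<close> is
            adjusted to kill the form \<open>i\<close>. The remaining pairs are as in the first
            case.\<close>
          consider (a) "i = 4" | (b) "j = 4" | (c) "i \<in> {1, 2, 3}" "j \<in> {1, 2, 3}" using ij by auto
          then show ?thesis
          proof cases
            case a
            then show ?thesis using ij by (intro bexI[of _ k] bexI[of _ 0]) auto
          next
            case b
            obtain v where v: "v \<in> freq" "\<beta> 4 * v = k" using surj4[OF ij(4)] by blast
            show ?thesis
              using b v ij freq_minus[OF \<beta>[OF ij(1) v(1)]]
              by (intro bexI[of _ "- (\<beta> i * v)"] bexI[of _ v]) auto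
          next
            case c
            have "kernel X X (hom_diff X (b j) (b i)) = {\<one>}" using ker c ij(3) by metis
            from both[OF ij(1,2) this ij(4)] show ?thesis using c by auto
          qed
        qed
      qed (use L M X in auto)
    qed
  qed
  define h where "h j s = charfun (\<mu> j) (chr s) / charfun (\<nu> j) (chr s)" for j s
  have \<mu>_nz: "charfun (\<mu> j) (chr s) \<noteq> 0" and \<nu>_nz: "charfun (\<nu> j) (chr s) \<noteq> 0"
    if "j \<in> ?I" "s \<in> freq" for j s
    using nonvanishing_\<mu>[OF that(1)] nonvanishing_\<nu>[OF that(1)] chr_in_dual[OF that(2)]
    by (auto simp: nonvanishing_charfun_def X T)
  have \<alpha>: "\<alpha> j * u \<in> freq" if "u \<in> freq" for j u using \<alpha>_L that by auto
  have functional_eq: "(\<Prod>j\<in>?I. h j (\<alpha> j * u + \<beta> j * v)) = 1" if u: "u \<in> freq" and v: "v \<in> freq" for u v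
  proof -
    have "(\<Prod>j\<in>?I. charfun (distr P \<B> (\<xi> j)) (chr (\<alpha> j * u + \<beta> j * v)))
        = (\<Prod>j\<in>?I. charfun (distr Q \<B> (\<eta> j)) (chr (\<alpha> j * u + \<beta> j * v)))"
      using two_forms_charfun[OF P indep_\<xi>[unfolded T] bc \<beta> chr_b \<alpha>_L L\<^sub>2[unfolded X] u v]
        two_forms_charfun[OF Q indep_\<eta>[unfolded T] bc \<beta> chr_b \<alpha>_M M\<^sub>2[unfolded X] u v]
        identically_distributed[unfolded T] by simp
    then have "(\<Prod>j\<in>?I. charfun (\<mu> j) (chr (\<alpha> j * u + \<beta> j * v)))
        = (\<Prod>j\<in>?I. charfun (\<nu> j) (chr (\<alpha> j * u + \<beta> j * v)))"
      by (simp only: \<mu> \<nu> T cong: prod.cong)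
    moreover have "(\<Prod>j\<in>?I. charfun (\<nu> j) (chr (\<alpha> j * u + \<beta> j * v))) \<noteq> 0"
      using \<nu>_nz freq_add[OF \<alpha>[OF u] \<beta>[OF _ v]] by (simp only: prod_zero_iff finite.intros) blast
    ultimately show ?thesis unfolding h_def prod_dividef by simp
  qed
  show ?thesis
  proof
    fix j assume j: "j \<in> ?I"
    obtain i1 i2 i3 where i: "distinct [j, i1, i2, i3]" "?I = {j, i1, i2, i3}"
    proof -
      from j consider "j = 1" | "j = 2" | "j = 3" | "j = 4" by blast
      then show thesis
      proof cases
        case 1 then show thesis by (intro that[of 2 3 4]) auto
      next
        case 2 then show thesis by (intro that[of 1 3 4]) auto
      next
        case 3 then show thesis by (intro that[of 1 2 4]) auto
      next
        case 4 then show thesis by (intro that[of 1 2 3]) auto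
      qed
    qed
    define \<Lambda> where "\<Lambda> j g = \<alpha> j * fst g + \<beta> j * snd g" for j and g :: "real \<times> real"
    have third: "mdiff k3 (mdiff k2 (mdiff k1 (h j))) 0 = 1"
      if k: "k1 \<in> freq" "k2 \<in> freq" "k3 \<in> freq" for k1 k2 k3
    proof (rule third_mdiff_eq_1[where \<Lambda> = \<Lambda> and G = "freq \<times> freq" and H = freq and f = h, OF i(1)])
      show "g + g' \<in> freq \<times> freq" if "g \<in> freq \<times> freq" "g' \<in> freq \<times> freq" for g g'
        using that by (auto intro: freq_add)
      show "\<Lambda> j (g + g') = \<Lambda> j g + \<Lambda> j g'" for j g g' by (simp add: \<Lambda>_def algebra_simps)
      show "\<Lambda> l g \<in> freq" if "l \<in> {j, i1, i2, i3}" "g \<in> freq \<times> freq" for l g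
        using that unfolding \<Lambda>_def i(2)[symmetric] by (intro freq_add \<alpha> \<beta>) auto
      show "h l y \<noteq> 0" if "l \<in> {j, i1, i2, i3}" "y \<in> freq" for l y
        using \<mu>_nz \<nu>_nz that unfolding i(2)[symmetric] by (simp add: h_def)
      show "(\<Prod>l\<in>{j, i1, i2, i3}. h l (\<Lambda> l g)) = 1" if "g \<in> freq \<times> freq" for g
        unfolding i(2)[symmetric] \<Lambda>_def by (rule functional_eq) (use that in auto)
      show "\<exists>g\<in>freq \<times> freq. \<Lambda> l g = 0 \<and> \<Lambda> j g = k" if l: "l \<in> {i1, i2, i3}" "k \<in> freq" for l k
      proof -
        have "l \<in> ?I" "l \<noteq> j" using l i by auto
        then obtain u v where "u \<in> freq" "v \<in> freq" "\<alpha> l * u + \<beta> l * v = 0" "\<alpha> j * u + \<beta> j * v = k"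
          using onto[of l j k] j l by blast
        then show ?thesis by (intro bexI[of _ "(u, v)"]) (auto simp: \<Lambda>_def)
      qed
    qed (use k in auto)
    interpret P: prob_space P by (rule P)
    interpret Q: prob_space Q by (rule Q)
    have "\<xi> j \<in> measurable P \<B>" "\<eta> j \<in> measurable Q \<B>"
      using indep_\<xi> indep_\<eta> j unfolding P.indep_vars_def Q.indep_vars_def T by auto
    then have prob: "prob_space (\<mu> j)" "prob_space (\<nu> j)"
      unfolding \<mu>[OF j] \<nu>[OF j] T by (auto intro: P.prob_space_distr Q.prob_space_distr)
    have sets: "sets (\<mu> j) = sets \<B>" "sets (\<nu> j) = sets \<B>"
      by (simp_all add: \<mu>[OF j] \<nu>[OF j] T)
    show "\<exists>\<gamma>. gaussian_distribution X T \<gamma> \<and>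
        (\<nu> j = group_convolution X T (\<mu> j) \<gamma> \<or> \<mu> j = group_convolution X T (\<nu> j) \<gamma>)"
      unfolding X T
      by (rule determined_up_to_gaussian[OF prob(1) sets(1) prob(2) sets(2)
            nonvanishing_\<mu>[OF j, unfolded X T] nonvanishing_\<nu>[OF j, unfolded X T] third[unfolded h_def[abs_def]]])
  qed
qed

end
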